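(* Let $\Phi$ be an irreducible reduced crystallographic root system with finite Weyl group $W$, finite simple reflections $\mathbb S$ and affine simple reflections $\tilde{\mathbb S}$. Let $J\subset\tilde{\mathbb S}$ be a spherical type, i.e. such that the subgroup $\tilde W_J$ generated by $J$ is finite. Then there exist $x\in{}^JW$ and $I\subset\mathbb S$ such that (i) $w_0=(x^{-1}\,\overline{w_J}\,x)\,w_I$; (ii) this decomposition is $\ell_R$-additive, i.e. $\ell_R(w_0)=\ell_R(w_J)+\ell_R(w_I)$; (iii) $d(x,xw_I)=\ell_R(w_I)$.
   Context: $\Phi^+$ and $\Delta=\{\alpha_1,\dots,\alpha_n\}$ are the positive and simple roots, $\theta$ is the longest (highest) root, $\ell$ is the length function. The affine Weyl group is $W_{\rm aff}=\mathbb Z\Phi^\vee\rtimes W$, a Coxeter group with simple reflections $\tilde{\mathbb S}=\mathbb S\cup\{s_0\}$, where $\mathbb S=\{s_1,\dots,s_n\}$ and $s_0$ is the reflection in the affine simple root $-\theta+1$. The projection $W_{\rm aff}\to W$ is denoted $w\mapsto\overline w$. For $s\in\tilde{\mathbb S}$ let $\alpha_s$ be the corresponding simple affine root and $\overline{\alpha_s}\in\Phi$ its spherical (finite) part, so $\overline{\alpha_{s_i}}=\alpha_i$ for $i\ge1$ and $\overline{\alpha_{s_0}}=-\theta$. For $J\subset\tilde{\mathbb S}$ put ${}^JW=\{w\in W: w^{-1}\overline{\alpha_s}\in\Phi^+\text{ for all }s\in J\}$; $w_J$ is the longest element of the finite group $\tilde W_J\subset W_{\rm aff}$ (with $w_\emptyset=1$),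 and $w_0=w_{\mathbb S}$ is the longest element of $W$. $\ell_R$ denotes reflection length: $\ell_R(w_J)$ is the smallest $l$ such that $w_J$ is a product of $l$ reflections of $\tilde W_J$; for $w\in W$, $\ell_R(w)$ is the smallest $l$ such that $w$ is a product of $l$ reflections of $W$; one has $\ell_R(\overline{w_J})=\ell_R(w_J)$. The quantum Bruhat graph is the directed graph with vertex set $W$, with upward edges $w\to ws_\alpha$ for $\alpha\in\Phi^+$ with $\ell(ws_\alpha)=\ell(w)+1$ and downward edges $w\to ws_\alpha$ for $\alpha\in\Phi^+$ with $\ell(ws_\alpha)=\ell(w)-\langle2\rho,\alpha^\vee\rangle+1$, where $2\rho$ is the sum of the positive roots. $d(x,y)$ is the minimal number of edges of a directed path from $x$ to $y$. *)

theory Defs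
  imports "HOL-Analysis.Analysis" "HOL-Algebra.Bij" "HOL-Algebra.Generated_Groups"
begin

definition coroot :: "'a::real_inner \<Rightarrow> 'a" where
  "coroot \<alpha> = (2 / (\<alpha> \<bullet> \<alpha>)) *\<^sub>R \<alpha>"

definition reflection :: "'a::real_inner \<Rightarrow> 'a \<Rightarrow> 'a" where
  "reflection \<alpha> v = v - (\<alpha> \<bullet> v) *\<^sub>R coroot \<alpha>"

definition root_system :: "'a::euclidean_space set \<Rightarrow> bool" where
  "root_system \<Phi> \<longleftrightarrow>
     finite \<Phi> \<and> 0 \<notin> \<Phi> \<and> span \<Phi> = UNIV \<and>
     (\<forall>\<alpha>\<in>\<Phi>. reflection \<alpha> ` \<Phi> = \<Phi>)"

definition crystallographic :: "'a::real_inner set \<Rightarrow> bool" where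
  "crystallographic \<Phi> \<longleftrightarrow> (\<forall>\<alpha>\<in>\<Phi>. \<forall>\<beta>\<in>\<Phi>. \<beta> \<bullet> coroot \<alpha> \<in> \<int>)"

definition reduced_roots :: "'a::real_inner set \<Rightarrow> bool" where
  "reduced_roots \<Phi> \<longleftrightarrow> (\<forall>\<alpha>\<in>\<Phi>. \<forall>c::real. c *\<^sub>R \<alpha> \<in> \<Phi> \<longrightarrow> c = 1 \<or> c = - 1)"

definition irreducible_roots :: "'a::real_inner set \<Rightarrow> bool" where
  "irreducible_roots \<Phi> \<longleftrightarrow>
     \<Phi> \<noteq> {} \<and>
     \<not> (\<exists>A B. A \<noteq> {} \<and> B \<noteq> {} \<and> A \<union> B = \<Phi> \<and> A \<inter> B = {} \<and>
           (\<forall>\<alpha>\<in>A. \<forall>\<beta>\<in>B. \<alpha> \<bullet> \<beta> = 0))"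

definition nonneg_comb :: "'a::real_vector set \<Rightarrow> 'a set" where
  "nonneg_comb \<Delta> = {\<Sum>\<alpha>\<in>\<Delta>. real (c \<alpha>) *\<^sub>R \<alpha> | c :: 'a \<Rightarrow> nat. True}"

definition simple_system :: "'a::euclidean_space set \<Rightarrow> 'a set \<Rightarrow> bool" where
  "simple_system \<Phi> \<Delta> \<longleftrightarrow>
     \<Delta> \<subseteq> \<Phi> \<and> independent \<Delta> \<and> span \<Delta> = UNIV \<and>
     (\<forall>\<beta>\<in>\<Phi>. \<beta> \<in> nonneg_comb \<Delta> \<or> - \<beta> \<in> nonneg_comb \<Delta>)"

definition positive_roots :: "'a::euclidean_space set \<Rightarrow> 'a set \<Rightarrow> 'a set" where
  "positive_roots \<Phi> \<Delta> = \<Phi> \<inter> nonneg_comb \<Delta>"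

definition highest_root :: "'a::euclidean_space set \<Rightarrow> 'a set \<Rightarrow> 'a" where
  "highest_root \<Phi> \<Delta> = (THE \<theta>. \<theta> \<in> \<Phi> \<and> (\<forall>\<beta>\<in>\<Phi>. \<theta> - \<beta> \<in> nonneg_comb \<Delta>))"

text \<open>
  The affine root \<open>\<alpha> + k\<close> is the pair \<open>(\<alpha>, k)\<close>, viewed as the affine function
  \<open>v \<mapsto> \<langle>\<alpha>, v\<rangle> + k\<close>; \<open>fst\<close> is its finite part. The affine Weyl group is realised by affine
  transformations of the ambient space: \<open>\<lambda> \<in> \<int>\<Phi>\<^sup>\<or>\<close> acts as translation by \<open>\<lambda>\<close> and \<open>W\<close> acts
  linearly. In particular \<open>s\<^sub>0\<close> is the reflection in the hyperplane \<open>\<langle>\<theta>, v\<rangle> = 1\<close>.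
\<close>

definition affine_reflection :: "'a::real_inner \<times> int \<Rightarrow> 'a \<Rightarrow> 'a" where
  "affine_reflection a v = v - (fst a \<bullet> v + of_int (snd a)) *\<^sub>R coroot (fst a)"

lemma affine_reflection_zero: "affine_reflection (\<alpha>, 0) = reflection \<alpha>"
  by (simp add: fun_eq_iff affine_reflection_def reflection_def)

definition affine_simple_roots ::
  "'a::euclidean_space set \<Rightarrow> 'a set \<Rightarrow> ('a \<times> int) set" where
  "affine_simple_roots \<Phi> \<Delta> = insert (- highest_root \<Phi> \<Delta>, 1) ((\<lambda>\<alpha>. (\<alpha>, 0)) ` \<Delta>)"

definition simple_reflections :: "'a::euclidean_space set \<Rightarrow> ('a \<Rightarrow> 'a) set" where
  "simple_reflections \<Delta> = reflection ` \<Delta>"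

definition affine_simple_reflections ::
  "'a::euclidean_space set \<Rightarrow> 'a set \<Rightarrow> ('a \<Rightarrow> 'a) set" where
  "affine_simple_reflections \<Phi> \<Delta> = affine_reflection ` affine_simple_roots \<Phi> \<Delta>"

definition generated_group :: "('a \<Rightarrow> 'a) set \<Rightarrow> ('a \<Rightarrow> 'a) set" where
  "generated_group S = generate (BijGroup UNIV) S"

definition weyl_group :: "'a::euclidean_space set \<Rightarrow> ('a \<Rightarrow> 'a) set" where
  "weyl_group \<Phi> = generated_group (reflection ` \<Phi>)"

text \<open>
  The projection from the affine Weyl group to \<open>W\<close> takes the linear part of an affine map.
\<close>

definition linear_part :: "('a::real_vector \<Rightarrow> 'a) \<Rightarrow> 'a \<Rightarrow> 'a" where
  "linear_part w v = w v - w 0"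

text \<open>
  Only used for \<open>w\<close> that is a product of elements of \<open>S\<close> (unspecified otherwise).
\<close>

definition word_length :: "('a \<Rightarrow> 'a) set \<Rightarrow> ('a \<Rightarrow> 'a) \<Rightarrow> nat" where
  "word_length S w =
     (LEAST l. \<exists>ws. length ws = l \<and> set ws \<subseteq> S \<and> foldr (\<circ>) ws id = w)"

text \<open>
  The length here is that of the affine Weyl group; it restricts to the length function of every
  standard parabolic subgroup, and in particular to that of \<open>W\<close>.
\<close>

definition longest_element ::
  "'a::euclidean_space set \<Rightarrow> 'a set \<Rightarrow> ('a \<Rightarrow> 'a) set \<Rightarrow> 'a \<Rightarrow> 'a" where
  "longest_element \<Phi> \<Delta> J =
     (THE w. w \<in> generated_group J \<and>
        (\<forall>u\<in>generated_group J.
           word_length (affine_simple_reflections \<Phi> \<Delta>) u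
             \<le> word_length (affine_simple_reflections \<Phi> \<Delta>) w))"

text \<open>
  The reflections of the Coxeter group generated by \<open>J\<close> are the conjugates of the elements of \<open>J\<close>;
  for \<open>J\<close> the set of simple reflections of \<open>W\<close> they are the reflections in the roots.
\<close>

definition group_reflections :: "('a \<Rightarrow> 'a) set \<Rightarrow> ('a \<Rightarrow> 'a) set" where
  "group_reflections J = {u \<circ> s \<circ> inv_into UNIV u | u s. u \<in> generated_group J \<and> s \<in> J}"

definition reflection_length :: "('a \<Rightarrow> 'a) set \<Rightarrow> ('a \<Rightarrow> 'a) \<Rightarrow> nat" where
  "reflection_length J = word_length (group_reflections J)"

text \<open>
  Simple affine roots correspond bijectively to their reflections, so the quantification over
  \<open>a\<close> below is the one over \<open>s \<in> J\<close> with \<open>a = \<alpha>\<^sub>s\<close>.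
\<close>

definition left_coset_reps ::
  "'a::euclidean_space set \<Rightarrow> 'a set \<Rightarrow> ('a \<Rightarrow> 'a) set \<Rightarrow> ('a \<Rightarrow> 'a) set" where
  "left_coset_reps \<Phi> \<Delta> J =
     {w \<in> weyl_group \<Phi>. \<forall>a\<in>affine_simple_roots \<Phi> \<Delta>.
        affine_reflection a \<in> J \<longrightarrow> inv_into UNIV w (fst a) \<in> positive_roots \<Phi> \<Delta>}"

definition two_rho :: "'a::euclidean_space set \<Rightarrow> 'a set \<Rightarrow> 'a" where
  "two_rho \<Phi> \<Delta> = (\<Sum>\<alpha>\<in>positive_roots \<Phi> \<Delta>. \<alpha>)"

definition quantum_bruhat_edges ::
  "'a::euclidean_space set \<Rightarrow> 'a set \<Rightarrow> (('a \<Rightarrow> 'a) \<times> ('a \<Rightarrow> 'a)) set" where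
  "quantum_bruhat_edges \<Phi> \<Delta> =
     {(w, w \<circ> reflection \<alpha>) | w \<alpha>.
        w \<in> weyl_group \<Phi> \<and> \<alpha> \<in> positive_roots \<Phi> \<Delta> \<and>
        (let l = word_length (simple_reflections \<Delta>) in
           l (w \<circ> reflection \<alpha>) = l w + 1 \<or>
           real (l (w \<circ> reflection \<alpha>)) = real (l w) - two_rho \<Phi> \<Delta> \<bullet> coroot \<alpha> + 1)}"

text \<open>
  The quantum Bruhat graph is strongly connected, so a path exists for all \<open>x, y \<in> W\<close>.
\<close>

definition quantum_bruhat_distance ::
  "'a::euclidean_space set \<Rightarrow> 'a set \<Rightarrow> ('a \<Rightarrow> 'a) \<Rightarrow> ('a \<Rightarrow> 'a) \<Rightarrow> nat" where
  "quantum_bruhat_distance \<Phi> \<Delta> x y = (LEAST n. (x, y) \<in> quantum_bruhat_edges \<Phi> \<Delta> ^^ n)"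

end

theory Submission
  imports Defs
begin

text \<open>
  The proof is uniform, without a case distinction by type.

  \<^bold>\<open>Choosing x and I.\<close> Let \<open>g\<close> be the linear part of \<open>w\<^sub>J\<close>. Since the group generated by \<open>J\<close> is finite, it
  fixes a point \<open>q\<close>, and the vector from \<open>q\<close> to a point of the fundamental alcove pairs positively
  with the gradients of the simple roots of \<open>J\<close>. If \<open>p\<close> is this vector, then \<open>g p\<close> pairs
  negatively with them, so \<open>p - g p\<close> lies in the (-1)-eigenspace of \<open>g\<close> and pairs positively with all of them;
  perturb it to a generic vector \<open>y\<close> of this eigenspace with the same property. Let \<open>x \<in> W\<close> be such that \<open>v = x\<inverse> y\<close> is dominant, and let \<open>I\<close> consist of
  the simple reflections that fix \<open>v\<close>. The gradients of \<open>J\<close> are then mapped by \<open>x\<inverse>\<close> to roots that are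
  positive on \<open>v\<close>, hence to positive roots.

  \<^bold>\<open>The decomposition.\<close> Put \<open>u = x\<inverse> g x\<close>. Then \<open>u v = -v\<close>, so \<open>-v\<close> is conjugate to \<open>v\<close>; as each orbit has
  only one dominant vector, \<open>w\<^sub>0 v = -v\<close>. Hence \<open>u w\<^sub>0\<close> fixes \<open>v\<close> and belongs to the parabolic
  subgroup of \<open>I\<close> (\<open>dominant_stabilizer\<close>). A root orthogonal to \<open>v\<close> is, by genericity, orthogonal to the whole
  (-1)-eigenspace of \<open>u\<close>, so \<open>u\<close> fixes it. Therefore \<open>u w\<^sub>0\<close> makes the simple roots of \<open>I\<close> negative, as
  \<open>w\<^sub>0\<close> does, and must be \<open>w\<^sub>I\<close>.

  \<^bold>\<open>Reflection lengths.\<close> Each of \<open>w\<^sub>0\<close>, \<open>w\<^sub>J\<close>, \<open>w\<^sub>I\<close> is the product of the reflections in a Kostant cascade, a set of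
  pairwise orthogonal roots obtained by repeatedly taking a long dominant root and passing to the roots
  orthogonal to it (\<open>cascade_negates\<close>). A product of \<open>k\<close> orthogonal reflections has reflection length \<open>k\<close>
  (\<open>orthogonal_reflections_minimal\<close>). The cascade of \<open>J\<close>, moved by \<open>x\<inverse>\<close>, lies in the (-1)-eigenspace of \<open>u\<close>,
  and that of \<open>I\<close> is fixed by \<open>u\<close>, so together they form an orthogonal factorisation of \<open>w\<^sub>0\<close>.

  \<^bold>\<open>The path.\<close> Within the choices left for \<open>x\<close>, one can arrange that \<open>x\<close> makes the positive roots orthogonal
  to \<open>v\<close> negative. Then multiplying \<open>x\<close> by the cascade reflections of \<open>w\<^sub>I\<close> one after the other gives
  downward edges of the quantum Bruhat graph (\<open>cascade_top_downward_edge\<close>), because cascade roots are long in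
  the subsystem that they are taken from. No path is shorter, since edges multiply by reflections.

  The standard facts about reduced words, longest elements, dominant vectors and the highest root are developed
  along the way.
\<close>

section \<open>Groups generated by involutions\<close>

definition composite :: "('a \<Rightarrow> 'a) list \<Rightarrow> 'a \<Rightarrow> 'a" where
  "composite ws = foldr (\<circ>) ws id"

lemma composite_Nil [simp]: "composite [] = id"
  by (simp add: composite_def)

lemma composite_Cons [simp]: "composite (w # ws) = w \<circ> composite ws"
  by (simp add: composite_def)

lemma composite_append [simp]: "composite (us @ ts) = composite us \<circ> composite ts"
  by (induction us) (auto simp: comp_assoc)

lemma composite_rev_involutions:
  assumes "\<And>s. s \<in> set ws \<Longrightarrow> s \<circ> s = id"
  shows "composite (rev ws) \<circ> composite ws = id"
  using assms
proof (induction ws)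
  case (Cons s ws)
  have "composite (rev (s # ws)) \<circ> composite (s # ws)
      = composite (rev ws) \<circ> (s \<circ> s) \<circ> composite ws"
    by (simp add: comp_assoc)
  also have "s \<circ> s = id" by (rule Cons.prems) simp
  finally show ?case using Cons by simp
qed simp

text \<open>
  Words in a set of involutions are already closed under inverses, by reversal.
\<close>

lemma generated_group_eq_words:
  assumes inv: "\<And>s. s \<in> S \<Longrightarrow> s \<circ> s = id"
  shows "generated_group S = {composite ws | ws. set ws \<subseteq> S}"
proof -
  interpret G: group "BijGroup (UNIV :: 'a set)" by (rule group_BijGroup)
  let ?G = "BijGroup (UNIV :: 'a set)"
  have carr: "f \<in> carrier ?G \<longleftrightarrow> bij f" for f
    by (simp add: BijGroup_def Bij_def)
  have mult: "f \<otimes>\<^bsub>?G\<^esub> g = f \<circ> g" if "bij f" "bij g" for f g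
    using that by (simp add: BijGroup_def Bij_def compose_def fun_eq_iff)
  have one: "\<one>\<^bsub>?G\<^esub> = id"
    by (simp add: BijGroup_def fun_eq_iff)
  have bijS: "bij s" if "s \<in> S" for s
    using inv[OF that] o_bij by blast
  have minv: "inv\<^bsub>?G\<^esub> s = s" if "s \<in> S" for s
    by (rule G.inv_equality)
      (simp_all only: carr bijS[OF that] mult one inv[OF that])
  have bijw: "bij (composite ws)" if "set ws \<subseteq> S" for ws
    using that by (induction ws) (auto intro: bij_comp bijS)
  note one_id = one
  show ?thesis
  proof (rule equalityI; rule subsetI)
    fix g assume "g \<in> generated_group S"
    then have "g \<in> generate ?G S" by (simp add: generated_group_def)
    then show "g \<in> {composite ws | ws. set ws \<subseteq> S}"
    proof induction
      case one
      have "id = composite ([] :: ('a \<Rightarrow> 'a) list)" by simp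
      then show ?case unfolding one_id by fastforce
    next
      case (incl h)
      have "h = composite [h]" by simp
      with incl show ?case by (intro CollectI exI[of _ "[h]"]) simp
    next
      case (inv h)
      have "h = composite [h]" by simp
      with inv show ?case unfolding minv[OF inv]
        by (intro CollectI exI[of _ "[h]"]) simp
    next
      case (eng g h)
      then obtain us vs where uv: "set us \<subseteq> S" "g = composite us"
        "set vs \<subseteq> S" "h = composite vs" by blast
      then have "g \<otimes>\<^bsub>?G\<^esub> h = composite (us @ vs)"
        by (simp add: mult bijw)
      moreover have "set (us @ vs) \<subseteq> S" using uv by simp
      ultimately show ?case by blast
    qed
  next
    fix g assume "g \<in> {composite ws | ws. set ws \<subseteq> S}"
    then obtain ws where "set ws \<subseteq> S" "g = composite ws" by blast
    moreover have "composite ws \<in> generate ?G S" if "set ws \<subseteq> S" for ws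
      using that
    proof (induction ws)
      case Nil
      show "composite [] \<in> generate ?G S"
        using generate.one[of ?G S] by (simp only: one composite_Nil)
    next
      case (Cons s ws)
      then have sw: "s \<in> S" "set ws \<subseteq> S" "composite ws \<in> generate ?G S" by auto
      then have "s \<otimes>\<^bsub>?G\<^esub> composite ws \<in> generate ?G S"
        by (intro generate.eng[OF generate.incl])
      then show "composite (s # ws) \<in> generate ?G S"
        by (simp only: composite_Cons mult[OF bijS[OF sw(1)] bijw[OF sw(2)]])
    qed
    ultimately have "g \<in> generate ?G S" by simp
    then show "g \<in> generated_group S" by (simp add: generated_group_def)
  qed
qed

lemma generated_group_id: "(\<And>s. s \<in> S \<Longrightarrow> s \<circ> s = id) \<Longrightarrow> id \<in> generated_group S"
  by (subst generated_group_eq_words) (auto intro!: exI[of _ "[]"])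

lemma generated_group_gen:
  "(\<And>s. s \<in> S \<Longrightarrow> s \<circ> s = id) \<Longrightarrow> s \<in> S \<Longrightarrow> s \<in> generated_group S"
  by (subst generated_group_eq_words) (auto intro!: exI[of _ "[s]"])

lemma generated_group_comp:
  assumes "\<And>s. s \<in> S \<Longrightarrow> s \<circ> s = id" "g \<in> generated_group S" "h \<in> generated_group S"
  shows "g \<circ> h \<in> generated_group S"
proof -
  obtain us vs where "set us \<subseteq> S" "g = composite us" "set vs \<subseteq> S" "h = composite vs"
    using assms by (subst (asm) (1 2) generated_group_eq_words) auto
  then have "g \<circ> h = composite (us @ vs)" "set (us @ vs) \<subseteq> S"
    by simp_all
  then show ?thesis using assms(1) by (subst generated_group_eq_words) blast+
qed

lemma generated_group_inverse:
  assumes inv: "\<And>s. s \<in> S \<Longrightarrow> s \<circ> s = id" and g: "g \<in> generated_group S"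
  obtains h where "h \<in> generated_group S" "h \<circ> g = id" "g \<circ> h = id" "inv_into UNIV g = h"
proof -
  obtain ws where ws: "set ws \<subseteq> S" "g = composite ws"
    using g inv by (subst (asm) generated_group_eq_words) auto
  let ?h = "composite (rev ws)"
  have 1: "?h \<circ> g = id" using composite_rev_involutions[of ws] ws inv by auto
  have 2: "g \<circ> ?h = id" using composite_rev_involutions[of "rev ws"] ws inv by auto
  have "set (rev ws) \<subseteq> S" using ws by simp
  then have "?h \<in> generated_group S" using inv by (subst generated_group_eq_words) blast+
  moreover have "inv_into UNIV g = ?h" by (rule inv_unique_comp[OF 2 1])
  ultimately show thesis using that 1 2 by blast
qed

lemma generated_group_mono:
  assumes "\<And>s. s \<in> T \<Longrightarrow> s \<circ> s = id" "S \<subseteq> T"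
  shows "generated_group S \<subseteq> generated_group T"
proof -
  have "generated_group S = {composite ws | ws. set ws \<subseteq> S}"
    "generated_group T = {composite ws | ws. set ws \<subseteq> T}"
    using assms by (intro generated_group_eq_words; blast)+
  then show ?thesis using assms(2) by blast
qed

lemma generated_group_subset:
  assumes inv: "\<And>s. s \<in> T \<Longrightarrow> s \<circ> s = id" "\<And>s. s \<in> S \<Longrightarrow> s \<circ> s = id"
    and sub: "S \<subseteq> generated_group T"
  shows "generated_group S \<subseteq> generated_group T"
proof
  fix g assume "g \<in> generated_group S"
  then obtain ws where "set ws \<subseteq> S" "g = composite ws"
    using inv by (subst (asm) generated_group_eq_words) auto
  then show "g \<in> generated_group T"
    using sub by (induction ws arbitrary: g)
      (auto intro: generated_group_comp generated_group_id inv)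
qed


section \<open>Chambers, exchange and length\<close>

text \<open>
  The combinatorics of reduced words is needed twice, for the finite Weyl group and for the affine
  one. Both act on a space that is cut up by the zero sets of a family \<open>R\<close> of real functions (the
  roots); \<open>p\<close> is a point in the base chamber, whose walls are the zero sets of the functions
  \<open>rt i\<close>. Writing roots as functions on the space turns the action of the group on roots into
  composition, and the sign of a root into its sign at \<open>p\<close>.
\<close>

locale wall_system =
  fixes R :: "('b \<Rightarrow> real) set" and p :: 'b and K :: "'i set"
    and refl :: "'i \<Rightarrow> 'b \<Rightarrow> 'b" and rt :: "'i \<Rightarrow> 'b \<Rightarrow> real"
  assumes refl_refl: "i \<in> K \<Longrightarrow> refl i (refl i v) = v"
    and root_refl: "f \<in> R \<Longrightarrow> i \<in> K \<Longrightarrow> (\<lambda>v. f (refl i v)) \<in> R"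
    and simple_root: "i \<in> K \<Longrightarrow> rt i \<in> R"
    and simple_root_refl: "i \<in> K \<Longrightarrow> rt i (refl i v) = - rt i v"
    and root_nonzero: "f \<in> R \<Longrightarrow> f p \<noteq> 0"
    and simple_root_pos: "i \<in> K \<Longrightarrow> 0 < rt i p"
    and refl_permutes_pos: "f \<in> R \<Longrightarrow> i \<in> K \<Longrightarrow> 0 < f p \<Longrightarrow> f \<noteq> rt i \<Longrightarrow> 0 < f (refl i p)"
    and refl_conj: "i \<in> K \<Longrightarrow> j \<in> K \<Longrightarrow> set is \<subseteq> K \<Longrightarrow>
      (\<lambda>v. rt i (composite (map refl is) v)) = rt j \<Longrightarrow>
      refl i \<circ> composite (map refl is) = composite (map refl is) \<circ> refl j"
begin

abbreviation word :: "'i list \<Rightarrow> 'b \<Rightarrow> 'b" where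
  "word is \<equiv> composite (map refl is)"

lemma word_append: "word (us @ ts) = word us \<circ> word ts"
  by simp

lemma refl_comp_refl: "i \<in> K \<Longrightarrow> refl i \<circ> refl i = id"
  by (simp add: fun_eq_iff refl_refl)

lemma refl_involution: "J \<subseteq> K \<Longrightarrow> s \<in> refl ` J \<Longrightarrow> s \<circ> s = id"
  using refl_comp_refl by blast

lemma root_word: "f \<in> R \<Longrightarrow> set is \<subseteq> K \<Longrightarrow> (\<lambda>v. f (word is v)) \<in> R"
proof (induction "is" arbitrary: f)
  case (Cons i "is")
  have "(\<lambda>v. (\<lambda>v. f (refl i v)) (word is v)) \<in> R"
    using Cons.prems by (intro Cons.IH root_refl) auto
  then show ?case by simp
qed simp

lemma in_generated_iff:
  assumes "J \<subseteq> K"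
  shows "g \<in> generated_group (refl ` J) \<longleftrightarrow> (\<exists>is. set is \<subseteq> J \<and> g = word is)"
proof -
  have "g \<in> generated_group (refl ` J) \<longleftrightarrow>
      (\<exists>ws. set ws \<subseteq> refl ` J \<and> g = composite ws)"
    by (subst generated_group_eq_words) (use refl_involution[OF assms] in blast)+
  also have "\<dots> \<longleftrightarrow> (\<exists>is. set is \<subseteq> J \<and> g = word is)"
  proof
    assume "\<exists>ws. set ws \<subseteq> refl ` J \<and> g = composite ws"
    then obtain ws where ws: "set ws \<subseteq> refl ` J" "g = composite ws" by blast
    from ws(1) have "ws \<in> lists (refl ` J)" by auto
    then obtain "is" where "is \<in> lists J" "ws = map refl is"
      by (auto simp: lists_image)
    then show "\<exists>is. set is \<subseteq> J \<and> g = word is" using ws(2) by (auto intro!: exI[of _ "is"])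
  next
    assume "\<exists>is. set is \<subseteq> J \<and> g = word is"
    then show "\<exists>ws. set ws \<subseteq> refl ` J \<and> g = composite ws"
      by (metis image_mono image_set)
  qed
  finally show ?thesis .
qed

text \<open>
  The root \<open>rt i\<close> is positive at the chamber of \<open>us\<close> and negative at that of \<open>us @ ts\<close>, so the
  gallery crosses the wall of \<open>i\<close> within \<open>ts\<close>. Reflecting the rest of the gallery in this wall
  deletes the letter at which the crossing takes place.
\<close>

lemma exchange:
  assumes "i \<in> K" "set us \<subseteq> K" "set ts \<subseteq> K"
    and "0 < rt i (word us p)" "rt i (word (us @ ts) p) < 0"
  shows "\<exists>ts'. length ts = Suc (length ts') \<and> set ts' \<subseteq> set ts \<and>
           refl i \<circ> word (us @ ts) = word (us @ ts')"
  using assms(3,5)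
proof (induction ts rule: rev_induct)
  case Nil
  with assms(4) show ?case by simp
next
  case (snoc j ts)
  let ?w = "word (us @ ts)"
  have wj: "word (us @ ts @ [j]) = ?w \<circ> refl j"
    by (simp only: append_assoc[symmetric] word_append[of _ "[j]"]) simp
  have f: "(\<lambda>v. rt i (?w v)) \<in> R"
    using assms snoc.prems by (intro root_word simple_root) auto
  consider "rt i (?w p) < 0" | "rt i (?w p) > 0" using root_nonzero[OF f] by linarith
  then show ?case
  proof cases
    case 1
    have "set ts \<subseteq> K" using snoc.prems by simp
    from snoc.IH[OF this 1] obtain ts' where
      t: "length ts = Suc (length ts')" "set ts' \<subseteq> set ts" "refl i \<circ> ?w = word (us @ ts')"
      by blast
    have "refl i \<circ> word (us @ ts @ [j]) = word (us @ ts') \<circ> refl j"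
      unfolding wj comp_assoc[symmetric] t(3) ..
    also have "\<dots> = word (us @ ts' @ [j])"
      by (simp only: append_assoc[symmetric] word_append[of _ "[j]"]) simp
    finally have "refl i \<circ> word (us @ ts @ [j]) = word (us @ ts' @ [j])" .
    moreover have "length (ts @ [j]) = Suc (length (ts' @ [j]))"
      "set (ts' @ [j]) \<subseteq> set (ts @ [j])" using t by auto
    ultimately show ?thesis by blast
  next
    case 2
    have "rt i (?w (refl j p)) < 0" using snoc.prems(2) unfolding wj by simp
    then have eq: "(\<lambda>v. rt i (?w v)) = rt j"
      using refl_permutes_pos[OF f, of j] 2 snoc.prems(1) by force
    have "refl i \<circ> ?w = ?w \<circ> refl j"
      by (rule refl_conj[OF _ _ _ eq]) (use assms snoc.prems in auto)
    then have "refl i \<circ> word (us @ ts @ [j]) = ?w \<circ> (refl j \<circ> refl j)"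
      unfolding wj comp_assoc[symmetric] by simp
    also have "\<dots> = ?w" using snoc.prems by (simp add: refl_comp_refl)
    finally have "refl i \<circ> word (us @ ts @ [j]) = word (us @ ts)" .
    moreover have "length (ts @ [j]) = Suc (length ts)" "set ts \<subseteq> set (ts @ [j])" by auto
    ultimately show ?thesis by blast
  qed
qed

text \<open>
  The roots that separate the base chamber from its image under \<open>w\<close>; in the usual language these are
  the inversions of \<open>w\<inverse>\<close>.
\<close>

definition separating :: "('b \<Rightarrow> 'b) \<Rightarrow> ('b \<Rightarrow> real) set" where
  "separating w = {f \<in> R. 0 < f p \<and> f (w p) < 0}"

lemma separating_id [simp]: "separating id = {}"
  by (auto simp: separating_def)

text \<open>
  Since the reflection in a wall of the base chamber permutes the positive roots other than that wall,
  prepending a simple reflection transports the separating set, up to the one root \<open>rt i\<close>. Whether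
  \<open>rt i\<close> is gained or lost is decided by its sign at the chamber of \<open>w\<close>.
\<close>

lemma separating_refl_subset:
  assumes "i \<in> K"
  shows "separating (refl i \<circ> w) \<subseteq> insert (rt i) ((\<lambda>f v. f (refl i v)) ` separating w)"
proof
  fix f assume f: "f \<in> separating (refl i \<circ> w)"
  show "f \<in> insert (rt i) ((\<lambda>f v. f (refl i v)) ` separating w)"
  proof (cases "f = rt i")
    case False
    with f assms have "(\<lambda>v. f (refl i v)) \<in> separating w"
      by (auto simp: separating_def root_refl refl_permutes_pos)
    moreover have "f = (\<lambda>v. (\<lambda>v. f (refl i v)) (refl i v))"
      using assms by (simp add: refl_refl)
    ultimately show ?thesis by (intro insertI2 image_eqI)
  qed simp
qed

lemma word_Nil: "word [] = id"
  by (simp only: list.map composite_Nil)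

lemma word_Cons: "word (i # is) = refl i \<circ> word is"
  by (simp only: list.map composite_Cons)

lemma finite_separating: "set is \<subseteq> K \<Longrightarrow> finite (separating (word is))"
proof (induction "is")
  case Nil
  show "finite (separating (word []))" unfolding word_Nil by simp
next
  case (Cons i "is")
  then have "finite (insert (rt i) ((\<lambda>f v. f (refl i v)) ` separating (word is)))" by simp
  with Cons.prems show "finite (separating (word (i # is)))"
    unfolding word_Cons using finite_subset[OF separating_refl_subset] by simp
qed

lemma card_separating_up:
  assumes i: "i \<in> K" and "is": "set is \<subseteq> K" and pos: "0 < rt i (word is p)"
  shows "card (separating (refl i \<circ> word is)) = Suc (card (separating (word is)))"
proof -
  let ?T = "\<lambda>f v. f (refl i v) :: real" and ?N = "separating (word is)"
  have TT: "?T (?T f) = f" for f using i by (simp add: refl_refl)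
  have "?T f \<in> separating (refl i \<circ> word is)" if "f \<in> ?N" for f
    using that pos i refl_permutes_pos[of f i]
    by (cases "f = rt i") (auto simp: separating_def root_refl refl_refl)
  moreover have "rt i \<in> separating (refl i \<circ> word is)"
    using i pos by (auto simp: separating_def simple_root simple_root_pos simple_root_refl)
  ultimately have "separating (refl i \<circ> word is) = insert (rt i) (?T ` ?N)"
    using separating_refl_subset[OF i, of "word is"] by auto
  moreover have "rt i \<notin> ?T ` ?N"
  proof
    assume "rt i \<in> ?T ` ?N"
    then obtain f where f: "f \<in> ?N" "rt i = ?T f" by blast
    have "f p = rt i (refl i p)" using i by (simp add: f(2) refl_refl)
    also have "\<dots> < 0" using i by (simp add: simple_root_refl simple_root_pos)
    finally show False using f(1) by (simp add: separating_def)
  qed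
  moreover have "card (?T ` ?N) = card ?N"
    by (rule card_image, rule inj_on_inverseI[where g = ?T]) (rule TT)
  ultimately show ?thesis using finite_separating[OF "is"] by simp
qed

lemma simple_root_word_nonzero: "i \<in> K \<Longrightarrow> set is \<subseteq> K \<Longrightarrow> rt i (word is p) \<noteq> 0"
  using root_nonzero[OF root_word[OF simple_root]] by blast

lemma card_separating_down:
  assumes i: "i \<in> K" and "is": "set is \<subseteq> K" and neg: "rt i (word is p) < 0"
  shows "Suc (card (separating (refl i \<circ> word is))) = card (separating (word is))"
proof -
  have "card (separating (refl i \<circ> word (i # is))) = Suc (card (separating (word (i # is))))"
    using assms by (intro card_separating_up) (auto simp: simple_root_refl)
  moreover have "refl i \<circ> word (i # is) = word is"
    using i by (simp add: comp_assoc[symmetric] refl_comp_refl)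
  ultimately show ?thesis by simp
qed

lemma card_separating_le: "set is \<subseteq> K \<Longrightarrow> card (separating (word is)) \<le> length is"
proof (induction "is")
  case Nil
  show "card (separating (word [])) \<le> length []" unfolding word_Nil by simp
next
  case (Cons i "is")
  then have i: "i \<in> K" "set is \<subseteq> K" by auto
  then have "card (separating (refl i \<circ> word is)) \<le> Suc (card (separating (word is)))"
    using card_separating_up[of i "is"] card_separating_down[of i "is"]
      simple_root_word_nonzero[of i "is"] by linarith
  also have "\<dots> \<le> length (i # is)" using Cons.IH i by simp
  finally show "card (separating (word (i # is))) \<le> length (i # is)" unfolding word_Cons .
qed

lemma reduced_word:
  assumes "J \<subseteq> K" "set is \<subseteq> J"
  shows "\<exists>js. set js \<subseteq> J \<and> word js = word is \<and> length js = card (separating (word is))"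
  using assms(2)
proof (induction "is")
  case Nil
  have "length [] = card (separating (word []))" unfolding word_Nil by simp
  then show ?case by (metis empty_iff list.set(1) subsetI)
next
  case (Cons i "is")
  then obtain js where js: "set js \<subseteq> J" "word js = word is"
    "length js = card (separating (word is))" by auto
  have i: "i \<in> K" "i \<in> J" "set js \<subseteq> K" "set is \<subseteq> K" using Cons assms js by auto
  show ?case
  proof (cases "0 < rt i (word is p)")
    case True
    then have "length (i # js) = card (separating (word (i # is)))"
      unfolding word_Cons using card_separating_up[OF i(1,4)] js(3) by simp
    moreover have "word (i # js) = word (i # is)" unfolding word_Cons js(2) ..
    moreover have "set (i # js) \<subseteq> J" using js(1) i(2) by simp
    ultimately show ?thesis by blast
  next
    case False
    then have neg: "rt i (word is p) < 0"
      using simple_root_word_nonzero[OF i(1,4)] by linarith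
    have "0 < rt i (word [] p)" unfolding word_Nil using simple_root_pos[OF i(1)] by simp
    from exchange[OF i(1) _ i(3) this] obtain ts where
      ts: "length js = Suc (length ts)" "set ts \<subseteq> set js" "refl i \<circ> word is = word ts"
      using neg unfolding append_Nil js(2) by auto
    have "length ts = card (separating (word (i # is)))"
      unfolding word_Cons using card_separating_down[OF i(1,4) neg] js(3) ts(1) by simp
    moreover have "word ts = word (i # is)" unfolding word_Cons ts(3) ..
    ultimately show ?thesis using ts(2) js(1) by blast
  qed
qed

text \<open>
  The right-hand side does not depend on \<open>J\<close>: the length functions of all parabolic subgroups agree.
\<close>

lemma word_length_eq_card_separating:
  assumes J: "J \<subseteq> K" and g: "g \<in> generated_group (refl ` J)"
  shows "word_length (refl ` J) g = card (separating g)"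
  unfolding word_length_def composite_def[symmetric]
proof (rule Least_equality)
  obtain "is" where "is": "set is \<subseteq> J" "g = word is" using g in_generated_iff[OF J] by blast
  obtain js where "set js \<subseteq> J" "word js = g" "length js = card (separating g)"
    using reduced_word[OF J "is"(1)] "is"(2) by auto
  then show "\<exists>ws. length ws = card (separating g) \<and> set ws \<subseteq> refl ` J \<and> composite ws = g"
    by (intro exI[of _ "map refl js"]) auto
next
  fix l assume "\<exists>ws. length ws = l \<and> set ws \<subseteq> refl ` J \<and> composite ws = g"
  then obtain ws where ws: "length ws = l" "set ws \<subseteq> refl ` J" "composite ws = g" by blast
  then have "ws \<in> lists (refl ` J)" by auto
  then obtain "is" where "is \<in> lists J" "ws = map refl is"
    by (auto simp: lists_image)
  then show "card (separating g) \<le> l" using ws card_separating_le[of "is"] J by auto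
qed

lemma separating_empty_imp_id:
  assumes "J \<subseteq> K" "g \<in> generated_group (refl ` J)" "card (separating g) = 0"
  shows "g = id"
proof -
  obtain "is" where "is": "set is \<subseteq> J" "g = word is" using assms in_generated_iff by blast
  then show ?thesis using reduced_word[OF assms(1) "is"(1)] assms(3) by auto
qed

text \<open>
  A reduced prefix \<open>us\<close> of \<open>w\<close> grows by one letter \<open>i\<close> at the front: as \<open>rt i\<close> is negative at the chamber
  of \<open>w\<close>, exchange deletes a letter of the word, and as \<open>i\<close> lengthens \<open>us\<close>, the deleted letter lies
  behind \<open>us\<close>.
\<close>

lemma reduced_word_prefix:
  assumes J: "J \<subseteq> K" and ws: "set ws \<subseteq> J" and neg: "\<And>i. i \<in> J \<Longrightarrow> rt i (word ws p) < 0"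
    and "set us \<subseteq> J" "length us = card (separating (word us))"
  shows "\<exists>ts. set ts \<subseteq> J \<and> word (us @ ts) = word ws \<and>
           length us + length ts = card (separating (word ws))"
  using assms(4,5)
proof (induction us)
  case Nil
  obtain ts where "set ts \<subseteq> J" "word ts = word ws" "length ts = card (separating (word ws))"
    using reduced_word[OF J ws] by blast
  then show ?case by (intro exI[of _ ts]) (simp only: append_Nil list.size add_0_left)
next
  case (Cons i us)
  have i: "i \<in> K" "i \<in> J" "set us \<subseteq> K" "set us \<subseteq> J" using Cons J by auto
  have le: "card (separating (word us)) \<le> length us" using card_separating_le i(3) .
  have len: "Suc (length us) = card (separating (refl i \<circ> word us))"
    using Cons.prems(2) by (simp add: comp_def)
  have pos: "0 < rt i (word us p)"
    using le len card_separating_down[OF i(1,3)] simple_root_word_nonzero[OF i(1,3)]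
    by linarith
  have red: "length us = card (separating (word us))"
    using card_separating_up[OF i(1,3) pos] len by simp
  obtain ts where ts: "set ts \<subseteq> J" "word (us @ ts) = word ws"
    "length us + length ts = card (separating (word ws))"
    using Cons.IH[OF i(4) red] by blast
  obtain ts' where t': "length ts = Suc (length ts')" "set ts' \<subseteq> set ts"
    "refl i \<circ> word (us @ ts) = word (us @ ts')"
    using exchange[OF i(1,3) _ pos, of ts] ts(1) J neg[OF i(2)] by (metis ts(2) subset_trans)
  have "word ((i # us) @ ts') = refl i \<circ> word (us @ ts')"
    by (simp only: append_Cons word_Cons)
  also have "\<dots> = refl i \<circ> (refl i \<circ> word ws)"
    unfolding t'(3)[symmetric] ts(2) ..
  also have "\<dots> = word ws"
    unfolding comp_assoc[symmetric] refl_comp_refl[OF i(1)] by simp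
  finally have "word ((i # us) @ ts') = word ws" .
  moreover have "length (i # us) + length ts' = card (separating (word ws))" "set ts' \<subseteq> J"
    using ts t' by auto
  ultimately show ?case by blast
qed

text \<open>
  Longest elements are recognised by signs of simple roots: by \<open>reduced_word_prefix\<close> each element \<open>u\<close>
  of the parabolic subgroup begins a reduced word of \<open>w\<close>, and one of full length is \<open>w\<close> itself.
\<close>

lemma opposite_chamber_longest:
  assumes J: "J \<subseteq> K" and w: "w \<in> generated_group (refl ` J)"
    and neg: "\<And>i. i \<in> J \<Longrightarrow> rt i (w p) < 0"
    and u: "u \<in> generated_group (refl ` J)"
  shows "card (separating u) \<le> card (separating w)"
    and "card (separating u) = card (separating w) \<Longrightarrow> u = w"
proof -
  obtain ws where ws: "set ws \<subseteq> J" "w = word ws" using w in_generated_iff[OF J] by blast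
  obtain us' where "set us' \<subseteq> J" "u = word us'" using u in_generated_iff[OF J] by blast
  then obtain us where us: "set us \<subseteq> J" "u = word us" "length us = card (separating u)"
    using reduced_word[OF J] by metis
  obtain ts where ts: "set ts \<subseteq> J" "word (us @ ts) = w"
    "length us + length ts = card (separating w)"
    using reduced_word_prefix[OF J ws(1) _ us(1)] neg us(2,3) unfolding ws(2) by auto
  show "card (separating u) \<le> card (separating w)" using ts us by simp
  assume "card (separating u) = card (separating w)"
  then have "ts = []" using ts us by simp
  then show "u = w" using ts us by simp
qed

end

section \<open>Reflections and products of orthogonal reflections\<close>

lemma inner_coroot_self: "\<alpha> \<noteq> 0 \<Longrightarrow> \<alpha> \<bullet> coroot \<alpha> = 2"
  by (simp add: coroot_def)

lemma inner_coroot_pos: "\<alpha> \<noteq> 0 \<Longrightarrow> 0 < v \<bullet> coroot \<alpha> \<longleftrightarrow> 0 < v \<bullet> \<alpha>"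
  using inner_ge_zero[of \<alpha>] by (auto simp: coroot_def zero_less_divide_iff simp del: inner_ge_zero)

lemma linear_reflection: "linear (reflection \<alpha>)"
  by (rule linearI) (simp_all add: reflection_def inner_add_right scaleR_add_left algebra_simps)

lemma reflection_inner_swap: "reflection \<alpha> v \<bullet> w = v \<bullet> reflection \<alpha> w"
  by (simp add: reflection_def coroot_def inner_diff_left inner_diff_right inner_commute)

lemma reflection_reflection [simp]: "reflection \<alpha> (reflection \<alpha> v) = v"
proof (cases "\<alpha> = 0")
  case False
  then show ?thesis
    by (simp add: reflection_def inner_diff_right inner_coroot_self algebra_simps
        flip: scaleR_add_left)
qed (simp add: reflection_def)

lemma reflection_comp_reflection: "reflection \<alpha> \<circ> reflection \<alpha> = id"
  by (simp add: fun_eq_iff)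

lemma reflection_inner: "reflection \<alpha> v \<bullet> reflection \<alpha> w = v \<bullet> w"
  by (simp add: reflection_inner_swap)

lemma orthogonal_transformation_reflection: "orthogonal_transformation (reflection \<alpha>)"
  by (simp add: orthogonal_transformation_def linear_reflection reflection_inner)

lemma reflection_self [simp]: "reflection \<alpha> \<alpha> = - \<alpha>"
proof (cases "\<alpha> = 0")
  case False
  then show ?thesis
    by (simp add: reflection_def coroot_def flip: scaleR_left_diff_distrib)
      (simp add: scaleR_2)
qed (simp add: reflection_def)

lemma reflection_orthogonal: "\<alpha> \<bullet> v = 0 \<Longrightarrow> reflection \<alpha> v = v"
  by (simp add: reflection_def)

lemma reflection_conj:
  assumes "orthogonal_transformation g"
  shows "g (reflection \<alpha> v) = reflection (g \<alpha>) (g v)"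
  using assms
  by (simp add: reflection_def coroot_def orthogonal_transformation_def linear_diff linear_cmul)

lemma norm_reflection: "norm (reflection \<alpha> v) = norm v"
  by (simp add: norm_eq_sqrt_inner reflection_inner)

lemma orthogonal_transformation_composite:
  "(\<And>g. g \<in> set gs \<Longrightarrow> orthogonal_transformation g) \<Longrightarrow> orthogonal_transformation (composite gs)"
proof (induction gs)
  case Nil
  show "orthogonal_transformation (composite [])" by (simp add: id_def)
next
  case (Cons g gs)
  then have "orthogonal_transformation g" "orthogonal_transformation (composite gs)" by auto
  then show "orthogonal_transformation (composite (g # gs))"
    unfolding composite_Cons by (rule orthogonal_transformation_compose)
qed

definition orthogonal_list :: "'a::euclidean_space list \<Rightarrow> bool" where
  "orthogonal_list \<beta>s \<longleftrightarrow> distinct \<beta>s \<and> 0 \<notin> set \<beta>s \<and> pairwise orthogonal (set \<beta>s)"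

text \<open>
  The symmetry of this formula gives all that is needed about such products: they are self-adjoint
  involutions that negate exactly the span of the list.
\<close>

lemma composite_orthogonal_reflections:
  assumes "orthogonal_list \<beta>s"
  shows "composite (map reflection \<beta>s) v = v - (\<Sum>\<beta>\<in>set \<beta>s. (\<beta> \<bullet> v) *\<^sub>R coroot \<beta>)"
  using assms
proof (induction \<beta>s)
  case (Cons \<beta> \<beta>s)
  have orth: "\<beta> \<bullet> \<gamma> = 0" if "\<gamma> \<in> set \<beta>s" for \<gamma>
    using Cons.prems that by (auto simp: orthogonal_list_def pairwise_def orthogonal_def)
  have "\<beta> \<bullet> (\<Sum>\<gamma>\<in>set \<beta>s. (\<gamma> \<bullet> v) *\<^sub>R coroot \<gamma>) = 0"
    by (simp add: inner_sum_right coroot_def orth)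
  moreover have "composite (map reflection \<beta>s) v = v - (\<Sum>\<gamma>\<in>set \<beta>s. (\<gamma> \<bullet> v) *\<^sub>R coroot \<gamma>)"
    using Cons by (auto simp: orthogonal_list_def pairwise_insert)
  moreover have "\<beta> \<notin> set \<beta>s" using Cons.prems by (simp add: orthogonal_list_def)
  ultimately show ?case
    by (simp add: reflection_def[of \<beta>] inner_diff_right)
qed simp

context
  fixes \<beta>s :: "'a::euclidean_space list" and g
  assumes \<beta>s: "orthogonal_list \<beta>s"
  defines "g \<equiv> composite (map reflection \<beta>s)"
begin

lemma orthogonal_reflections_fix: "(\<And>\<beta>. \<beta> \<in> set \<beta>s \<Longrightarrow> \<beta> \<bullet> v = 0) \<Longrightarrow> g v = v"
  using composite_orthogonal_reflections[OF \<beta>s, of v] by (simp add: g_def)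

lemma orthogonal_reflections_negate:
  assumes "\<beta> \<in> set \<beta>s"
  shows "g \<beta> = - \<beta>"
proof -
  have "(\<Sum>\<gamma>\<in>set \<beta>s. (\<gamma> \<bullet> \<beta>) *\<^sub>R coroot \<gamma>) = (\<beta> \<bullet> \<beta>) *\<^sub>R coroot \<beta>"
    using assms \<beta>s
    by (subst sum.remove[of _ \<beta>])
      (auto simp: orthogonal_list_def pairwise_def orthogonal_def intro!: sum.neutral)
  moreover have "\<beta> \<noteq> 0" using assms \<beta>s by (auto simp: orthogonal_list_def)
  ultimately have "g \<beta> = \<beta> - 2 *\<^sub>R \<beta>"
    using composite_orthogonal_reflections[OF \<beta>s, of \<beta>] by (simp add: coroot_def g_def)
  then show ?thesis by (simp add: scaleR_2)
qed

lemma orthogonal_transformation_reflections: "orthogonal_transformation g"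
  unfolding g_def
  by (rule orthogonal_transformation_composite) (auto simp: orthogonal_transformation_reflection)

lemma orthogonal_reflections_swap: "g v \<bullet> w = v \<bullet> g w"
  using composite_orthogonal_reflections[OF \<beta>s]
  by (simp add: g_def inner_diff_left inner_diff_right inner_sum_left inner_sum_right coroot_def
      inner_commute ac_simps)

lemma orthogonal_reflections_involution: "g (g v) = v"
proof (rule vector_eq_rdot[THEN iffD1], rule allI)
  fix w
  show "g (g v) \<bullet> w = v \<bullet> w"
    using orthogonal_transformation_reflections
    by (simp add: orthogonal_transformation_def orthogonal_reflections_swap)
qed

end

lemma diff_composite_reflections_in_span:
  "v - composite (map reflection \<alpha>s) v \<in> span (set \<alpha>s)"
proof (induction \<alpha>s)
  case (Cons \<alpha> \<alpha>s)
  let ?u = "composite (map reflection \<alpha>s) v"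
  have "v - composite (map reflection (\<alpha> # \<alpha>s)) v = (v - ?u) + (\<alpha> \<bullet> ?u) *\<^sub>R coroot \<alpha>"
    by (simp add: reflection_def)
  also have "\<dots> \<in> span (set (\<alpha> # \<alpha>s))"
    using Cons span_mono[of "set \<alpha>s" "set (\<alpha> # \<alpha>s)"]
    by (intro span_add span_scale) (auto simp: coroot_def span_base intro!: span_scale)
  finally show ?case .
qed (simp add: span_zero)

text \<open>
  Each \<open>\<beta>\<close> of the orthogonal list is half of its own displacement under the product, hence lies in
  the span of any list of roots whose reflections have the same product; count dimensions.
\<close>

lemma orthogonal_reflections_minimal:
  assumes "orthogonal_list \<beta>s"
    and eq: "composite (map reflection \<beta>s) = composite (map reflection \<alpha>s)"
  shows "length \<beta>s \<le> length \<alpha>s"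
proof -
  have "set \<beta>s \<subseteq> span (set \<alpha>s)"
  proof
    fix \<beta> assume "\<beta> \<in> set \<beta>s"
    then have "\<beta> - composite (map reflection \<alpha>s) \<beta> = 2 *\<^sub>R \<beta>"
      using orthogonal_reflections_negate[OF assms(1)] by (simp add: scaleR_2 flip: eq)
    then have "2 *\<^sub>R \<beta> \<in> span (set \<alpha>s)"
      by (metis diff_composite_reflections_in_span)
    then have "(1/2) *\<^sub>R 2 *\<^sub>R \<beta> \<in> span (set \<alpha>s)" by (rule span_scale)
    then show "\<beta> \<in> span (set \<alpha>s)" by simp
  qed
  moreover have "independent (set \<beta>s)"
    using assms(1) unfolding orthogonal_list_def by (intro pairwise_orthogonal_independent) auto
  ultimately have "card (set \<beta>s) \<le> card (set \<alpha>s)"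
    using independent_span_bound[of "set \<alpha>s" "set \<beta>s"] by simp
  also have "\<dots> \<le> length \<alpha>s" by (rule card_length)
  finally show ?thesis using assms(1) by (simp add: orthogonal_list_def distinct_card)
qed


section \<open>Kostant cascades\<close>

definition reflection_closed :: "'a::euclidean_space set \<Rightarrow> bool" where
  "reflection_closed \<Psi> \<longleftrightarrow> (\<forall>\<alpha>\<in>\<Psi>. \<forall>\<beta>\<in>\<Psi>. reflection \<alpha> \<beta> \<in> \<Psi>)"

text \<open>
  For a root system \<open>\<Psi>\<close> with positive roots cut out by the regular vector \<open>p\<close>, this picks the highest
  root of an irreducible component with roots of maximal length. The description by
  length and pairing with \<open>p\<close> makes sense without any decomposition into components.
\<close>

definition cascade_top :: "'a::euclidean_space \<Rightarrow> 'a set \<Rightarrow> 'a \<Rightarrow> bool" where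
  "cascade_top p \<Psi> \<beta> \<longleftrightarrow> \<beta> \<in> \<Psi> \<and> 0 < \<beta> \<bullet> p \<and> (\<forall>\<gamma>\<in>\<Psi>. norm \<gamma> \<le> norm \<beta>) \<and>
     (\<forall>\<gamma>\<in>\<Psi>. norm \<gamma> = norm \<beta> \<longrightarrow> \<gamma> \<bullet> p \<le> \<beta> \<bullet> p)"

primrec cascade :: "'a::euclidean_space \<Rightarrow> 'a set \<Rightarrow> 'a list \<Rightarrow> bool" where
  "cascade p \<Psi> [] \<longleftrightarrow> \<Psi> = {}"
| "cascade p \<Psi> (\<beta> # \<beta>s) \<longleftrightarrow> cascade_top p \<Psi> \<beta> \<and> cascade p {\<gamma>\<in>\<Psi>. \<gamma> \<bullet> \<beta> = 0} \<beta>s"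

lemma reflection_closed_orthogonal:
  "reflection_closed \<Psi> \<Longrightarrow> reflection_closed {\<gamma>\<in>\<Psi>. \<gamma> \<bullet> v = 0}"
  by (auto simp: reflection_closed_def reflection_def inner_diff_left coroot_def)

lemma cascade_top_exists:
  assumes "finite \<Psi>" "reflection_closed \<Psi>" "\<And>\<gamma>. \<gamma> \<in> \<Psi> \<Longrightarrow> \<gamma> \<bullet> p \<noteq> 0" "\<Psi> \<noteq> {}"
  shows "\<exists>\<beta>. cascade_top p \<Psi> \<beta>"
proof -
  define M where "M = {\<gamma>\<in>\<Psi>. norm \<gamma> = Max (norm ` \<Psi>)}"
  have "Max (norm ` \<Psi>) \<in> norm ` \<Psi>" using assms by (intro Max_in) auto
  then obtain \<gamma>\<^sub>0 where "\<gamma>\<^sub>0 \<in> \<Psi>" "norm \<gamma>\<^sub>0 = Max (norm ` \<Psi>)" by auto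
  then have "\<gamma>\<^sub>0 \<in> M" by (simp add: M_def)
  then have "finite M" "M \<noteq> {}" using assms(1) by (auto simp: M_def)
  then have "Max ((\<lambda>\<gamma>. \<gamma> \<bullet> p) ` M) \<in> (\<lambda>\<gamma>. \<gamma> \<bullet> p) ` M" by (intro Max_in) auto
  then obtain \<beta> where \<beta>: "\<beta> \<in> M" "\<beta> \<bullet> p = Max ((\<lambda>\<gamma>. \<gamma> \<bullet> p) ` M)" by auto
  have max: "\<gamma> \<bullet> p \<le> \<beta> \<bullet> p" if "\<gamma> \<in> M" for \<gamma> using that \<open>finite M\<close> \<beta> by simp
  have "\<beta> \<in> \<Psi>" using \<beta>(1) by (simp add: M_def)
  then have "- \<beta> \<in> \<Psi>" using assms(2) reflection_self[of \<beta>] unfolding reflection_closed_def by metis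
  then have "- \<beta> \<in> M" using \<beta> by (simp add: M_def)
  then have "0 < \<beta> \<bullet> p" using max[of "- \<beta>"] assms(3)[of \<beta>] \<beta> by (auto simp: M_def)
  then show ?thesis
    using \<beta> max assms(1) by (auto simp: cascade_top_def M_def intro!: exI[of _ \<beta>])
qed

lemma cascade_exists:
  assumes "finite \<Psi>" "reflection_closed \<Psi>" "\<And>\<gamma>. \<gamma> \<in> \<Psi> \<Longrightarrow> \<gamma> \<bullet> p \<noteq> 0"
  shows "\<exists>\<beta>s. cascade p \<Psi> \<beta>s"
  using assms
proof (induction \<Psi> rule: finite_psubset_induct)
  case (psubset \<Psi>)
  show ?case
  proof (cases "\<Psi> = {}")
    case False
    then obtain \<beta> where \<beta>: "cascade_top p \<Psi> \<beta>"
      using cascade_top_exists psubset by metis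
    then have "\<beta> \<in> \<Psi>" "\<beta> \<noteq> 0" by (auto simp: cascade_top_def)
    then have "\<beta> \<notin> {\<gamma>\<in>\<Psi>. \<gamma> \<bullet> \<beta> = 0}" by simp
    with \<open>\<beta> \<in> \<Psi>\<close> have "{\<gamma>\<in>\<Psi>. \<gamma> \<bullet> \<beta> = 0} \<subset> \<Psi>" by blast
    then obtain \<beta>s where "cascade p {\<gamma>\<in>\<Psi>. \<gamma> \<bullet> \<beta> = 0} \<beta>s"
      using psubset.IH[of "{\<gamma>\<in>\<Psi>. \<gamma> \<bullet> \<beta> = 0}"] psubset.prems reflection_closed_orthogonal by auto
    with \<beta> show ?thesis by (intro exI[of _ "\<beta> # \<beta>s"]) simp
  qed (auto intro: exI[of _ "[]"])
qed

text \<open>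
  Otherwise reflecting \<open>\<beta>\<close> in \<open>\<gamma>\<close> would give a root of the same length that is higher than \<open>\<beta>\<close>.
\<close>

lemma cascade_top_dominant:
  assumes "reflection_closed \<Psi>" "cascade_top p \<Psi> \<beta>" "\<gamma> \<in> \<Psi>" "0 < \<gamma> \<bullet> p"
  shows "0 \<le> \<gamma> \<bullet> \<beta>"
proof -
  have "reflection \<gamma> \<beta> \<in> \<Psi>" using assms by (auto simp: reflection_closed_def cascade_top_def)
  then have "reflection \<gamma> \<beta> \<bullet> p \<le> \<beta> \<bullet> p"
    using assms(2) by (auto simp: cascade_top_def norm_reflection)
  then have "0 \<le> (\<gamma> \<bullet> \<beta>) * (coroot \<gamma> \<bullet> p)"
    by (simp add: reflection_def inner_diff_left)
  moreover have "0 < coroot \<gamma> \<bullet> p"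
    using assms(4) by (auto simp: coroot_def intro!: divide_pos_pos)
  ultimately show ?thesis by (simp add: zero_le_mult_iff)
qed

lemma cascade_subset: "cascade p \<Psi> \<beta>s \<Longrightarrow> set \<beta>s \<subseteq> \<Psi>"
  by (induction \<beta>s arbitrary: \<Psi>) (auto simp: cascade_top_def)

lemma cascade_orthogonal: "cascade p \<Psi> \<beta>s \<Longrightarrow> orthogonal_list \<beta>s"
proof (induction \<beta>s arbitrary: \<Psi>)
  case Nil
  then show ?case by (simp add: orthogonal_list_def)
next
  case (Cons \<beta> \<beta>s)
  then have "orthogonal_list \<beta>s" "\<beta> \<noteq> 0" by (auto simp: cascade_top_def)
  moreover have "\<gamma> \<bullet> \<beta> = 0" if "\<gamma> \<in> set \<beta>s" for \<gamma>
    using Cons.prems that cascade_subset[of p _ \<beta>s] by auto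
  moreover from this have "\<beta> \<notin> set \<beta>s" using \<open>\<beta> \<noteq> 0\<close> inner_eq_zero_iff by blast
  ultimately show ?case
    by (auto simp: orthogonal_list_def pairwise_insert orthogonal_def inner_commute)
qed

lemma composite_reflections_in_closed:
  "reflection_closed \<Psi> \<Longrightarrow> set \<beta>s \<subseteq> \<Psi> \<Longrightarrow> \<gamma> \<in> \<Psi> \<Longrightarrow> composite (map reflection \<beta>s) \<gamma> \<in> \<Psi>"
  by (induction \<beta>s) (auto simp: reflection_closed_def)

text \<open>
  The product of a cascade is the longest element. The later roots are orthogonal to the top
  root \<open>\<beta>\<close>, so their reflections preserve the pairing with \<open>\<beta>\<close>; a root with positive pairing is
  therefore made negative by \<open>\<beta>\<close> alone, and a root orthogonal to \<open>\<beta>\<close> by the rest of the cascade.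
\<close>

lemma cascade_negates:
  assumes "reflection_closed \<Psi>" "\<And>\<gamma>. \<gamma> \<in> \<Psi> \<Longrightarrow> \<gamma> \<bullet> p \<noteq> 0" "cascade p \<Psi> \<beta>s" "\<gamma> \<in> \<Psi>" "0 < \<gamma> \<bullet> p"
  shows "\<gamma> \<bullet> composite (map reflection \<beta>s) p < 0"
  using assms
proof (induction \<beta>s arbitrary: \<Psi>)
  case (Cons \<beta> \<beta>s)
  let ?g = "composite (map reflection \<beta>s)" and ?\<Psi> = "{\<gamma>\<in>\<Psi>. \<gamma> \<bullet> \<beta> = 0}"
  have top: "cascade_top p \<Psi> \<beta>" and casc: "cascade p ?\<Psi> \<beta>s" using Cons.prems by auto
  have eq: "\<gamma> \<bullet> composite (map reflection (\<beta> # \<beta>s)) p = reflection \<beta> \<gamma> \<bullet> ?g p"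
    by (simp add: reflection_inner_swap)
  consider "\<gamma> \<bullet> \<beta> = 0" | "0 < \<gamma> \<bullet> \<beta>"
    using cascade_top_dominant[OF Cons.prems(1) top Cons.prems(4,5)] by linarith
  then show ?case
  proof cases
    case 1
    then have "\<gamma> \<bullet> ?g p < 0"
      using Cons.prems casc reflection_closed_orthogonal[OF Cons.prems(1)]
      by (intro Cons.IH[of ?\<Psi>]) auto
    with 1 show ?thesis unfolding eq by (simp add: reflection_orthogonal inner_commute)
  next
    case 2
    have orth: "orthogonal_list \<beta>s" by (rule cascade_orthogonal[OF casc])
    note swap = orthogonal_reflections_swap[OF orth]
    have sub: "set \<beta>s \<subseteq> \<Psi>" using cascade_subset[OF casc] by auto
    have "\<beta> \<in> \<Psi>" using top by (simp add: cascade_top_def)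
    then have "reflection \<beta> \<gamma> \<in> \<Psi>" using Cons.prems by (auto simp: reflection_closed_def)
    then have in\<Psi>: "?g (reflection \<beta> \<gamma>) \<in> \<Psi>"
      by (rule composite_reflections_in_closed[OF Cons.prems(1) sub])
    have "?g \<beta> = \<beta>"
      using cascade_subset[OF casc] by (intro orthogonal_reflections_fix[OF orth]) auto
    then have "?g (reflection \<beta> \<gamma>) \<bullet> \<beta> = - (\<gamma> \<bullet> \<beta>)"
      by (simp add: swap reflection_inner_swap)
    then have "\<not> 0 < ?g (reflection \<beta> \<gamma>) \<bullet> p"
      using cascade_top_dominant[OF Cons.prems(1) top in\<Psi>] 2 by linarith
    then have "?g (reflection \<beta> \<gamma>) \<bullet> p < 0" using Cons.prems(2)[OF in\<Psi>] by linarith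
    then show ?thesis unfolding eq swap by simp
  qed
qed simp

section \<open>Root systems with a base\<close>

lemma orthogonal_transformation_dual:
  fixes w :: "'a::euclidean_space \<Rightarrow> 'a"
  assumes w: "orthogonal_transformation w" and eq: "\<And>v. i \<bullet> w v = j \<bullet> v"
  shows "w j = i"
proof (rule vector_eq_rdot[THEN iffD1], rule allI)
  fix u
  obtain v where "u = w v" using orthogonal_transformation_surj[OF w] by blast
  then show "w j \<bullet> u = i \<bullet> u" using w eq by (simp add: orthogonal_transformation_def)
qed

lemma Nats_nonneg: "x \<in> \<nat> \<Longrightarrow> 0 \<le> (x :: real)"
  by (erule Nats_cases) simp

locale based_root_system =
  fixes \<Phi> \<Delta> :: "'a::euclidean_space set"
  assumes root_system: "root_system \<Phi>" and crystallographic: "crystallographic \<Phi>"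
    and reduced: "reduced_roots \<Phi>" and irreducible: "irreducible_roots \<Phi>"
    and base: "simple_system \<Phi> \<Delta>"
begin

lemma finite_roots: "finite \<Phi>" and zero_not_root: "0 \<notin> \<Phi>"
  using root_system by (auto simp: root_system_def)

lemma reflection_root: "\<alpha> \<in> \<Phi> \<Longrightarrow> \<beta> \<in> \<Phi> \<Longrightarrow> reflection \<alpha> \<beta> \<in> \<Phi>"
  using root_system by (auto simp: root_system_def)

lemma closed_roots: "reflection_closed \<Phi>"
  by (simp add: reflection_closed_def reflection_root)

lemma uminus_root: "\<alpha> \<in> \<Phi> \<Longrightarrow> - \<alpha> \<in> \<Phi>"
  using reflection_root[of \<alpha> \<alpha>] by simp

lemma base_roots: "\<alpha> \<in> \<Delta> \<Longrightarrow> \<alpha> \<in> \<Phi>"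
  using base by (auto simp: simple_system_def)

lemma finite_base: "finite \<Delta>"
  using base finite_roots finite_subset by (auto simp: simple_system_def)

lemma root_nonzero [simp]: "\<alpha> \<in> \<Phi> \<Longrightarrow> \<alpha> \<noteq> 0"
  using zero_not_root by auto

lemma coroot_integer: "\<alpha> \<in> \<Phi> \<Longrightarrow> \<beta> \<in> \<Phi> \<Longrightarrow> \<beta> \<bullet> coroot \<alpha> \<in> \<int>"
  using crystallographic by (auto simp: crystallographic_def)

text \<open>
  The fundamental coweights, that is, the basis dual to \<open>\<Delta>\<close>; coefficients of roots are read off as
  pairings with them. They are chosen by \<open>SOME\<close> since only the values on \<open>\<Delta>\<close> are determined.
\<close>

definition coweight :: "'a \<Rightarrow> 'a" where
  "coweight = (SOME \<omega>. \<forall>\<alpha>\<in>\<Delta>. \<forall>\<gamma>\<in>\<Delta>. \<omega> \<alpha> \<bullet> \<gamma> = (if \<gamma> = \<alpha> then 1 else 0))"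

lemma coweight_base:
  assumes "\<alpha> \<in> \<Delta>" "\<gamma> \<in> \<Delta>"
  shows "coweight \<alpha> \<bullet> \<gamma> = (if \<gamma> = \<alpha> then 1 else 0)"
proof -
  have "\<exists>\<omega>. \<forall>\<gamma>\<in>\<Delta>. \<omega> \<bullet> \<gamma> = (if \<gamma> = \<alpha> then 1 else 0)" for \<alpha>
  proof -
    obtain f :: "'a \<Rightarrow> real" where f: "linear f" "\<forall>\<gamma>\<in>\<Delta>. f \<gamma> = (if \<gamma> = \<alpha> then 1 else 0)"
      using linear_independent_extend[of \<Delta> "\<lambda>\<gamma>. if \<gamma> = \<alpha> then 1 else 0 :: real"] base
      by (auto simp: simple_system_def)
    then show ?thesis
      using adjoint_works[OF f(1), of _ 1] by (intro exI[of _ "adjoint f 1"]) (simp add: inner_commute)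
  qed
  then have "\<exists>\<omega>. \<forall>\<alpha>\<in>\<Delta>. \<forall>\<gamma>\<in>\<Delta>. \<omega> \<alpha> \<bullet> \<gamma> = (if \<gamma> = \<alpha> then 1 else 0)" by metis
  from someI_ex[OF this] show ?thesis using assms unfolding coweight_def by blast
qed

lemma coweight_sum:
  assumes "\<alpha> \<in> \<Delta>"
  shows "coweight \<alpha> \<bullet> (\<Sum>\<gamma>\<in>\<Delta>. c \<gamma> *\<^sub>R \<gamma>) = c \<alpha>"
proof -
  have "coweight \<alpha> \<bullet> (\<Sum>\<gamma>\<in>\<Delta>. c \<gamma> *\<^sub>R \<gamma>) = (\<Sum>\<gamma>\<in>\<Delta>. if \<gamma> = \<alpha> then c \<gamma> else 0)"
    using assms by (auto simp: inner_sum_right coweight_base intro!: sum.cong)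
  then show ?thesis using assms finite_base by simp
qed

lemma coweight_expansion: "x = (\<Sum>\<alpha>\<in>\<Delta>. (coweight \<alpha> \<bullet> x) *\<^sub>R \<alpha>)"
proof -
  have "x \<in> span \<Delta>" using base by (auto simp: simple_system_def)
  then obtain c where c: "x = (\<Sum>\<alpha>\<in>\<Delta>. c \<alpha> *\<^sub>R \<alpha>)" using finite_base by (auto simp: span_finite)
  then have "c \<alpha> = coweight \<alpha> \<bullet> x" if "\<alpha> \<in> \<Delta>" for \<alpha> using coweight_sum[OF that] by simp
  then have "(\<Sum>\<alpha>\<in>\<Delta>. c \<alpha> *\<^sub>R \<alpha>) = (\<Sum>\<alpha>\<in>\<Delta>. (coweight \<alpha> \<bullet> x) *\<^sub>R \<alpha>)" by (intro sum.cong) auto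
  with c show ?thesis by simp
qed

lemma inner_expansion: "v \<bullet> x = (\<Sum>\<alpha>\<in>\<Delta>. (coweight \<alpha> \<bullet> x) * (v \<bullet> \<alpha>))"
  by (subst coweight_expansion) (simp add: inner_sum_right)

lemma eq_zero_if_coweights: "(\<And>\<alpha>. \<alpha> \<in> \<Delta> \<Longrightarrow> coweight \<alpha> \<bullet> x = 0) \<Longrightarrow> x = 0"
  by (subst coweight_expansion) simp

lemma nonneg_comb_iff: "x \<in> nonneg_comb \<Delta> \<longleftrightarrow> (\<forall>\<alpha>\<in>\<Delta>. coweight \<alpha> \<bullet> x \<in> \<nat>)"
proof
  assume "x \<in> nonneg_comb \<Delta>"
  then show "\<forall>\<alpha>\<in>\<Delta>. coweight \<alpha> \<bullet> x \<in> \<nat>"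
    by (auto simp: nonneg_comb_def coweight_sum)
next
  assume nat: "\<forall>\<alpha>\<in>\<Delta>. coweight \<alpha> \<bullet> x \<in> \<nat>"
  define c where "c \<alpha> = nat \<lfloor>coweight \<alpha> \<bullet> x\<rfloor>" for \<alpha>
  have "real (c \<alpha>) = coweight \<alpha> \<bullet> x" if "\<alpha> \<in> \<Delta>" for \<alpha>
    using nat that by (auto simp: c_def elim!: Nats_cases)
  then have "x = (\<Sum>\<alpha>\<in>\<Delta>. real (c \<alpha>) *\<^sub>R \<alpha>)"
    by (subst coweight_expansion) simp
  then show "x \<in> nonneg_comb \<Delta>" unfolding nonneg_comb_def by blast
qed

text \<open>
  Pairing with this regular dominant vector is the usual height of a root, so that its sign decides
  positivity.
\<close>

definition height_vector :: 'a where
  "height_vector = (\<Sum>\<alpha>\<in>\<Delta>. coweight \<alpha>)"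

abbreviation height :: "'a \<Rightarrow> real" where
  "height x \<equiv> x \<bullet> height_vector"

lemma height_eq: "height x = (\<Sum>\<alpha>\<in>\<Delta>. coweight \<alpha> \<bullet> x)"
  by (simp add: height_vector_def inner_sum_right inner_commute)

lemma height_base: "\<alpha> \<in> \<Delta> \<Longrightarrow> height \<alpha> = 1"
  using finite_base by (simp add: height_eq coweight_base)

lemma root_cases:
  assumes "\<beta> \<in> \<Phi>"
  obtains "0 < height \<beta>" "\<beta> \<in> positive_roots \<Phi> \<Delta>" "\<And>\<alpha>. \<alpha> \<in> \<Delta> \<Longrightarrow> coweight \<alpha> \<bullet> \<beta> \<in> \<nat>"
  | "height \<beta> < 0" "\<beta> \<notin> positive_roots \<Phi> \<Delta>" "\<And>\<alpha>. \<alpha> \<in> \<Delta> \<Longrightarrow> - (coweight \<alpha> \<bullet> \<beta>) \<in> \<nat>"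
proof -
  have pos: "0 < height x" if "x \<in> nonneg_comb \<Delta>" "x \<noteq> 0" for x
  proof -
    have "\<exists>\<alpha>\<in>\<Delta>. coweight \<alpha> \<bullet> x \<noteq> 0" using eq_zero_if_coweights that(2) by blast
    moreover have "0 \<le> coweight \<alpha> \<bullet> x" if "\<alpha> \<in> \<Delta>" for \<alpha>
      using \<open>x \<in> nonneg_comb \<Delta>\<close> that nonneg_comb_iff Nats_nonneg by blast
    ultimately show ?thesis
      unfolding height_eq using finite_base by (metis less_le sum_pos2)
  qed
  have "\<beta> \<in> nonneg_comb \<Delta> \<or> - \<beta> \<in> nonneg_comb \<Delta>"
    using base assms by (auto simp: simple_system_def)
  then show thesis
  proof
    assume 1: "\<beta> \<in> nonneg_comb \<Delta>"
    then show thesis using that(1) pos[of \<beta>] assms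
      by (auto simp: positive_roots_def nonneg_comb_iff)
  next
    assume 2: "- \<beta> \<in> nonneg_comb \<Delta>"
    then have neg: "height \<beta> < 0" using pos[of "- \<beta>"] assms by simp
    then have "\<beta> \<notin> positive_roots \<Phi> \<Delta>" using pos[of \<beta>] assms by (auto simp: positive_roots_def)
    then show thesis using that(2) neg 2 by (simp add: nonneg_comb_iff)
  qed
qed

lemma height_nonzero: "\<beta> \<in> \<Phi> \<Longrightarrow> height \<beta> \<noteq> 0"
  by (erule root_cases) auto

lemma positive_iff_height: "\<beta> \<in> positive_roots \<Phi> \<Delta> \<longleftrightarrow> \<beta> \<in> \<Phi> \<and> 0 < height \<beta>"
proof (cases "\<beta> \<in> \<Phi>")
  case True
  then show ?thesis by (rule root_cases) (use True in auto)
qed (auto simp: positive_roots_def)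

lemma coweight_nonneg:
  assumes "\<beta> \<in> \<Phi>" "0 < height \<beta>" "\<alpha> \<in> \<Delta>"
  shows "0 \<le> coweight \<alpha> \<bullet> \<beta>"
  using assms(1)
proof (rule root_cases)
  assume "\<And>\<alpha>. \<alpha> \<in> \<Delta> \<Longrightarrow> coweight \<alpha> \<bullet> \<beta> \<in> \<nat>"
  then show ?thesis using assms(3) Nats_nonneg by blast
qed (use assms(2) in simp)

lemma coweight_nonpos:
  assumes "\<beta> \<in> \<Phi>" "height \<beta> < 0" "\<alpha> \<in> \<Delta>"
  shows "coweight \<alpha> \<bullet> \<beta> \<le> 0"
  using coweight_nonneg[of "- \<beta>" \<alpha>] assms by (simp add: uminus_root)

lemma coweight_integer:
  assumes "\<beta> \<in> \<Phi>" "\<alpha> \<in> \<Delta>"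
  shows "coweight \<alpha> \<bullet> \<beta> \<in> \<int>"
  using assms(1)
proof (rule root_cases)
  assume "\<And>\<alpha>. \<alpha> \<in> \<Delta> \<Longrightarrow> coweight \<alpha> \<bullet> \<beta> \<in> \<nat>"
  then show ?thesis using assms(2) Nats_subset_Ints by blast
next
  assume "\<And>\<alpha>. \<alpha> \<in> \<Delta> \<Longrightarrow> - (coweight \<alpha> \<bullet> \<beta>) \<in> \<nat>"
  then have "- (coweight \<alpha> \<bullet> \<beta>) \<in> \<int>" using assms(2) Nats_subset_Ints by blast
  then show ?thesis using Ints_minus by fastforce
qed

lemma dominant_nonneg:
  assumes "\<And>\<alpha>. \<alpha> \<in> \<Delta> \<Longrightarrow> 0 \<le> v \<bullet> \<alpha>" "\<beta> \<in> \<Phi>" "0 < height \<beta>"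
  shows "0 \<le> v \<bullet> \<beta>"
  by (subst inner_expansion) (use assms coweight_nonneg in \<open>intro sum_nonneg mult_nonneg_nonneg, auto\<close>)

lemma dominant_nonpos:
  assumes "\<And>\<alpha>. \<alpha> \<in> \<Delta> \<Longrightarrow> 0 \<le> v \<bullet> \<alpha>" "\<beta> \<in> \<Phi>" "height \<beta> < 0"
  shows "v \<bullet> \<beta> \<le> 0"
  using dominant_nonneg[of v "- \<beta>"] assms by (simp add: uminus_root)

text \<open>
  A positive root other than \<open>\<alpha>\<close> is not a multiple of \<open>\<alpha>\<close>, so it has a positive coefficient
  at some other simple root, and the reflection leaves that coefficient unchanged.
\<close>

lemma simple_reflection_permutes_pos:
  assumes "\<alpha> \<in> \<Delta>" "\<beta> \<in> \<Phi>" "0 < height \<beta>" "\<beta> \<noteq> \<alpha>"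
  shows "0 < height (reflection \<alpha> \<beta>)"
proof -
  have "\<exists>\<gamma>\<in>\<Delta>. \<gamma> \<noteq> \<alpha> \<and> coweight \<gamma> \<bullet> \<beta> \<noteq> 0"
  proof (rule ccontr)
    assume none: "\<not> ?thesis"
    have "\<beta> = (\<Sum>\<gamma>\<in>\<Delta>. (coweight \<gamma> \<bullet> \<beta>) *\<^sub>R \<gamma>)" by (rule coweight_expansion)
    also have "\<dots> = (\<Sum>\<gamma>\<in>{\<alpha>}. (coweight \<gamma> \<bullet> \<beta>) *\<^sub>R \<gamma>)"
      using none assms(1) finite_base by (intro sum.mono_neutral_right) auto
    finally have "\<beta> = (coweight \<alpha> \<bullet> \<beta>) *\<^sub>R \<alpha>" by simp
    then have "coweight \<alpha> \<bullet> \<beta> = 1 \<or> coweight \<alpha> \<bullet> \<beta> = - 1"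
      using reduced assms base_roots by (metis reduced_roots_def)
    then show False
      using \<open>\<beta> = (coweight \<alpha> \<bullet> \<beta>) *\<^sub>R \<alpha>\<close> assms coweight_nonneg[OF assms(2,3,1)] by auto
  qed
  then obtain \<gamma> where \<gamma>: "\<gamma> \<in> \<Delta>" "\<gamma> \<noteq> \<alpha>" "coweight \<gamma> \<bullet> \<beta> \<noteq> 0" by blast
  have root: "reflection \<alpha> \<beta> \<in> \<Phi>" using assms base_roots reflection_root by blast
  have "coweight \<gamma> \<bullet> reflection \<alpha> \<beta> = coweight \<gamma> \<bullet> \<beta>"
    using \<gamma> assms(1) by (simp add: reflection_def coroot_def inner_diff_right coweight_base)
  then have "0 < coweight \<gamma> \<bullet> reflection \<alpha> \<beta>"
    using \<gamma> coweight_nonneg[OF assms(2,3) \<gamma>(1)] by simp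
  then show ?thesis
    using coweight_nonpos[OF root _ \<gamma>(1)] height_nonzero[OF root] by linarith
qed


subsection \<open>The finite Weyl group\<close>

abbreviation W :: "('a \<Rightarrow> 'a) set" where
  "W \<equiv> generated_group (reflection ` \<Delta>)"

lemma reflection_image_involution: "s \<in> reflection ` A \<Longrightarrow> s \<circ> s = id"
  by (auto simp: reflection_comp_reflection)

definition root_functions :: "('a \<Rightarrow> real) set" where
  "root_functions = (\<lambda>\<beta> v. \<beta> \<bullet> v) ` \<Phi>"

sublocale finite_walls: wall_system root_functions height_vector \<Delta> reflection "\<lambda>\<alpha> v. \<alpha> \<bullet> v"
proof
  fix f i v
  show "i \<in> \<Delta> \<Longrightarrow> reflection i (reflection i v) = v" by simp
  show "f \<in> root_functions \<Longrightarrow> i \<in> \<Delta> \<Longrightarrow> (\<lambda>v. f (reflection i v)) \<in> root_functions"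
    by (auto simp: root_functions_def reflection_root base_roots simp flip: reflection_inner_swap)
  show "i \<in> \<Delta> \<Longrightarrow> (\<lambda>v. i \<bullet> v) \<in> root_functions"
    by (auto simp: root_functions_def base_roots)
  show "i \<in> \<Delta> \<Longrightarrow> i \<bullet> reflection i v = - (i \<bullet> v)"
    by (simp flip: reflection_inner_swap)
  show "f \<in> root_functions \<Longrightarrow> f height_vector \<noteq> 0"
    by (auto simp: root_functions_def height_nonzero)
  show "i \<in> \<Delta> \<Longrightarrow> 0 < i \<bullet> height_vector" by (simp add: height_base)
  assume f: "f \<in> root_functions" "i \<in> \<Delta>" "0 < f height_vector" "f \<noteq> (\<lambda>v. i \<bullet> v)"
  then obtain \<beta> where \<beta>: "\<beta> \<in> \<Phi>" "f = (\<lambda>v. \<beta> \<bullet> v)" by (auto simp: root_functions_def)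
  with f have "\<beta> \<noteq> i" by blast
  then have "0 < height (reflection i \<beta>)" using f \<beta> simple_reflection_permutes_pos by simp
  then show "0 < f (reflection i height_vector)" by (simp add: \<beta>(2) flip: reflection_inner_swap)
next
  fix i j and "is" :: "'a list"
  let ?w = "composite (map reflection is)"
  assume eq: "(\<lambda>v. i \<bullet> ?w v) = (\<lambda>v. j \<bullet> v)"
  have w: "orthogonal_transformation ?w"
    by (rule orthogonal_transformation_composite) (auto simp: orthogonal_transformation_reflection)
  have "?w j = i" using orthogonal_transformation_dual[OF w] fun_cong[OF eq] by simp
  then show "reflection i \<circ> ?w = ?w \<circ> reflection j"
    using reflection_conj[OF w, of j] by (simp add: fun_eq_iff)
qed

lemma W_word: "w \<in> W \<Longrightarrow> \<exists>is. set is \<subseteq> \<Delta> \<and> w = composite (map reflection is)"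
  using finite_walls.in_generated_iff[of \<Delta> w] by simp

lemma W_orthogonal:
  assumes "w \<in> W"
  shows "orthogonal_transformation w"
proof -
  obtain "is" where w: "w = composite (map reflection is)" using W_word[OF assms] by blast
  show ?thesis unfolding w
    by (rule orthogonal_transformation_composite) (auto simp: orthogonal_transformation_reflection)
qed

lemma W_root:
  assumes "w \<in> W" "\<beta> \<in> \<Phi>"
  shows "w \<beta> \<in> \<Phi>"
proof -
  obtain "is" where w: "set is \<subseteq> \<Delta>" "w = composite (map reflection is)"
    using W_word[OF assms(1)] by blast
  show ?thesis unfolding w(2)
    by (rule composite_reflections_in_closed[OF closed_roots]) (use w assms base_roots in auto)
qed

lemma W_comp: "g \<in> W \<Longrightarrow> h \<in> W \<Longrightarrow> g \<circ> h \<in> W"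
  by (rule generated_group_comp[OF reflection_image_involution])

lemma W_gen: "\<alpha> \<in> \<Delta> \<Longrightarrow> reflection \<alpha> \<in> W"
  by (rule generated_group_gen[OF reflection_image_involution]) auto

text \<open>
  A positive root \<open>\<gamma>\<close> has a positive pairing with some simple root, because \<open>\<langle>\<gamma>, \<gamma>\<rangle> > 0\<close>. Reflecting in
  that simple root lowers the height and keeps \<open>\<gamma>\<close> positive unless \<open>\<gamma>\<close> was simple, so a counterexample of
  minimal height cannot exist.
\<close>

lemma root_conjugate_base:
  assumes "\<beta> \<in> \<Phi>"
  shows "\<exists>w\<in>W. \<exists>\<alpha>\<in>\<Delta>. \<beta> = w \<alpha>"
proof -
  define bad where "bad = {\<beta>\<in>\<Phi>. 0 < height \<beta> \<and> \<not> (\<exists>w\<in>W. \<exists>\<alpha>\<in>\<Delta>. \<beta> = w \<alpha>)}"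
  have "bad = {}"
  proof (rule ccontr)
    assume "bad \<noteq> {}"
    moreover have "finite bad" using finite_roots by (simp add: bad_def)
    ultimately have "Min (height ` bad) \<in> height ` bad" by (intro Min_in) auto
    then obtain \<gamma> where \<gamma>: "\<gamma> \<in> bad" "height \<gamma> = Min (height ` bad)" by auto
    have min: "height \<gamma> \<le> height \<delta>" if "\<delta> \<in> bad" for \<delta>
      using \<gamma> that \<open>finite bad\<close> by simp
    have root: "\<gamma> \<in> \<Phi>" "0 < height \<gamma>" using \<gamma> by (auto simp: bad_def)
    have "0 < \<gamma> \<bullet> \<gamma>" using root by simp
    then have "0 < (\<Sum>\<alpha>\<in>\<Delta>. (coweight \<alpha> \<bullet> \<gamma>) * (\<gamma> \<bullet> \<alpha>))"
      unfolding inner_expansion[of \<gamma> \<gamma>, symmetric] .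
    then obtain \<alpha> where \<alpha>: "\<alpha> \<in> \<Delta>" "0 < (coweight \<alpha> \<bullet> \<gamma>) * (\<gamma> \<bullet> \<alpha>)"
      by (meson not_less sum_nonpos)
    then have "0 < \<gamma> \<bullet> \<alpha>"
      using coweight_nonneg[OF root \<alpha>(1)] by (auto simp: zero_less_mult_iff)
    then have "0 < \<alpha> \<bullet> \<gamma>" by (simp add: inner_commute)
    then have small: "height (reflection \<alpha> \<gamma>) < height \<gamma>"
      using \<alpha>(1) base_roots[OF \<alpha>(1)]
      by (simp add: reflection_def coroot_def inner_diff_left height_base)
    have "\<gamma> \<noteq> \<alpha>"
    proof
      assume "\<gamma> = \<alpha>"
      then have "\<gamma> = id \<alpha>" by simp
      moreover have "id \<in> W" by (rule generated_group_id[OF reflection_image_involution])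
      ultimately show False using \<gamma>(1) \<alpha>(1) unfolding bad_def by blast
    qed
    then have "0 < height (reflection \<alpha> \<gamma>)" "reflection \<alpha> \<gamma> \<in> \<Phi>"
      using simple_reflection_permutes_pos \<alpha> root base_roots reflection_root by blast+
    moreover have "reflection \<alpha> \<gamma> \<notin> bad" using min small by fastforce
    ultimately obtain w \<delta> where w: "w \<in> W" "\<delta> \<in> \<Delta>" "reflection \<alpha> \<gamma> = w \<delta>"
      unfolding bad_def by blast
    have "\<gamma> = reflection \<alpha> (reflection \<alpha> \<gamma>)" by simp
    then have "\<gamma> = (reflection \<alpha> \<circ> w) \<delta>" unfolding w(3) by simp
    moreover have "reflection \<alpha> \<circ> w \<in> W" using W_comp W_gen \<alpha>(1) w(1) by blast
    ultimately show False using \<gamma>(1) w(2) unfolding bad_def by blast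
  qed
  then have pos: "\<exists>w\<in>W. \<exists>\<alpha>\<in>\<Delta>. \<gamma> = w \<alpha>" if "\<gamma> \<in> \<Phi>" "0 < height \<gamma>" for \<gamma>
    using that by (auto simp: bad_def)
  show ?thesis
  proof (cases "0 < height \<beta>")
    case False
    then have "0 < height (- \<beta>)" using height_nonzero[OF assms] by simp
    then obtain w \<alpha> where w: "w \<in> W" "\<alpha> \<in> \<Delta>" "- \<beta> = w \<alpha>"
      using pos uminus_root[OF assms] by blast
    have "linear w" using W_orthogonal[OF w(1)] by (simp add: orthogonal_transformation_def)
    then have "\<beta> = (w \<circ> reflection \<alpha>) \<alpha>" using w(3) by (simp add: linear_neg flip: w(3))
    moreover have "w \<circ> reflection \<alpha> \<in> W" using W_comp W_gen w by blast
    ultimately show ?thesis using w(2) by blast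
  qed (use pos assms in blast)
qed

lemma W_inverse:
  assumes "w \<in> W"
  obtains w' where "w' \<in> W" "\<And>v. w' (w v) = v" "\<And>v. w (w' v) = v" "inv_into UNIV w = w'"
proof (rule generated_group_inverse[OF reflection_image_involution assms])
  fix h assume "h \<in> W" "h \<circ> w = id" "w \<circ> h = id" "inv_into UNIV w = h"
  then show thesis by (intro that[of h]) (simp_all add: fun_eq_iff)
qed

lemma root_reflection_conjugate:
  assumes "\<beta> \<in> \<Phi>"
  shows "\<exists>w\<in>W. \<exists>\<alpha>\<in>\<Delta>. reflection \<beta> = w \<circ> reflection \<alpha> \<circ> inv_into UNIV w"
proof -
  obtain w \<alpha> where w: "w \<in> W" "\<alpha> \<in> \<Delta>" "\<beta> = w \<alpha>" using root_conjugate_base[OF assms] by blast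
  obtain w' where w': "\<And>v. w (w' v) = v" "inv_into UNIV w = w'" using W_inverse[OF w(1)] by metis
  have "reflection \<beta> v = w (reflection \<alpha> (w' v))" for v
    using reflection_conj[OF W_orthogonal[OF w(1)], of \<alpha> "w' v"] by (simp add: w' w(3))
  then have "reflection \<beta> = w \<circ> reflection \<alpha> \<circ> inv_into UNIV w" by (simp add: fun_eq_iff w')
  then show ?thesis using w by blast
qed

lemma reflection_in_W:
  assumes "\<beta> \<in> \<Phi>"
  shows "reflection \<beta> \<in> W"
proof -
  obtain w \<alpha> where w: "w \<in> W" "\<alpha> \<in> \<Delta>" "reflection \<beta> = w \<circ> reflection \<alpha> \<circ> inv_into UNIV w"
    using root_reflection_conjugate[OF assms] by blast
  moreover have "inv_into UNIV w \<in> W" using W_inverse[OF w(1)] by metis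
  ultimately show ?thesis using W_comp W_gen by (metis image_eqI)
qed

lemma composite_reflections_in_W: "set \<beta>s \<subseteq> \<Phi> \<Longrightarrow> composite (map reflection \<beta>s) \<in> W"
proof (induction \<beta>s)
  case Nil
  show "composite (map reflection []) \<in> W"
    using generated_group_id[OF reflection_image_involution] by simp
next
  case (Cons \<beta> \<beta>s)
  then show "composite (map reflection (\<beta> # \<beta>s)) \<in> W"
    unfolding list.map composite_Cons by (intro W_comp reflection_in_W) auto
qed

lemma weyl_group_eq: "weyl_group \<Phi> = W"
proof (rule equalityI)
  show "weyl_group \<Phi> \<subseteq> W"
    unfolding weyl_group_def
    by (rule generated_group_subset) (auto simp: reflection_in_W reflection_image_involution)
  show "W \<subseteq> weyl_group \<Phi>"
    unfolding weyl_group_def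
    by (rule generated_group_mono) (auto simp: base_roots reflection_image_involution)
qed

text \<open>
  The separating set of \<open>w\<close> consists of the inversions of \<open>w\<inverse>\<close>, and \<open>\<gamma> \<mapsto> - w \<gamma>\<close> matches the inversions
  of \<open>w\<close> with them.
\<close>

lemma word_length_eq_card_inversions:
  assumes "w \<in> W"
  shows "word_length (reflection ` \<Delta>) w = card {\<gamma>\<in>\<Phi>. 0 < height \<gamma> \<and> height (w \<gamma>) < 0}"
proof -
  obtain w' where w': "w' \<in> W" "\<And>v. w' (w v) = v" "\<And>v. w (w' v) = v"
    using W_inverse[OF assms] by metis
  have lin: "linear w" "linear w'" using W_orthogonal assms w'(1)
    by (auto simp: orthogonal_transformation_def)
  have adj: "\<gamma> \<bullet> w v = w' \<gamma> \<bullet> v" for \<gamma> v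
    using W_orthogonal[OF assms] w'(3)[of \<gamma>] by (metis orthogonal_transformation_def)
  let ?N = "{\<gamma>\<in>\<Phi>. 0 < height \<gamma> \<and> height (w' \<gamma>) < 0}"
  let ?M = "{\<gamma>\<in>\<Phi>. 0 < height \<gamma> \<and> height (w \<gamma>) < 0}"
  have "finite_walls.separating w = (\<lambda>\<beta> v. \<beta> \<bullet> v) ` ?N"
    unfolding finite_walls.separating_def unfolding root_functions_def by (auto simp: adj)
  moreover have "inj_on (\<lambda>\<beta> v. \<beta> \<bullet> v) ?N"
    by (rule inj_onI) (metis vector_eq_rdot)
  ultimately have "card (finite_walls.separating w) = card ?N" by (simp add: card_image)
  also have "?N = (\<lambda>\<gamma>. - w \<gamma>) ` ?M"
  proof (intro equalityI subsetI)
    fix \<gamma> assume "\<gamma> \<in> ?N"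
    then have "- w' \<gamma> \<in> ?M" "\<gamma> = - w (- w' \<gamma>)"
      using w' W_root lin by (auto simp: linear_neg uminus_root)
    then show "\<gamma> \<in> (\<lambda>\<gamma>. - w \<gamma>) ` ?M" by blast
  next
    fix \<gamma> assume "\<gamma> \<in> (\<lambda>\<gamma>. - w \<gamma>) ` ?M"
    then show "\<gamma> \<in> ?N" using w' W_root[OF assms] lin by (auto simp: linear_neg uminus_root)
  qed
  also have "card \<dots> = card ?M"
    by (rule card_image, rule inj_onI) (metis neg_equal_iff_equal w'(2))
  finally show ?thesis
    using finite_walls.word_length_eq_card_separating[of \<Delta> w] assms by simp
qed

end

context based_root_system
begin

text \<open>
  Existence of a dominant conjugate: a simple reflection at which the current vector is negative
  decreases the number of positive roots at which it is negative.
\<close>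

lemma dominant_conjugate: "\<exists>w\<in>W. \<forall>\<alpha>\<in>\<Delta>. 0 \<le> w y \<bullet> \<alpha>"
proof -
  define N where "N w = {\<gamma>\<in>\<Phi>. 0 < height \<gamma> \<and> w y \<bullet> \<gamma> < 0}" for w
  have fin: "finite (N w)" for w using finite_roots by (simp add: N_def)
  have "\<exists>u\<in>W. \<forall>\<alpha>\<in>\<Delta>. 0 \<le> u y \<bullet> \<alpha>" if "w \<in> W" for w
    using that
  proof (induction "card (N w)" arbitrary: w rule: less_induct)
    case less
    show ?case
    proof (cases "\<forall>\<alpha>\<in>\<Delta>. 0 \<le> w y \<bullet> \<alpha>")
      case False
      then obtain \<alpha> where \<alpha>: "\<alpha> \<in> \<Delta>" "w y \<bullet> \<alpha> < 0" by force
      let ?w = "reflection \<alpha> \<circ> w"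
      have "reflection \<alpha> ` N ?w \<subseteq> N w - {\<alpha>}"
      proof
        fix \<delta> assume "\<delta> \<in> reflection \<alpha> ` N ?w"
        then obtain \<gamma> where \<gamma>: "\<gamma> \<in> \<Phi>" "0 < height \<gamma>" "w y \<bullet> reflection \<alpha> \<gamma> < 0"
          "\<delta> = reflection \<alpha> \<gamma>"
          by (auto simp: N_def reflection_inner_swap)
        have "\<gamma> \<noteq> \<alpha>" using \<gamma>(3) \<alpha>(2) by auto
        then have "0 < height \<delta>" using simple_reflection_permutes_pos[OF \<alpha>(1) \<gamma>(1,2)] \<gamma>(4) by simp
        moreover have "\<delta> \<noteq> \<alpha>"
        proof
          assume "\<delta> = \<alpha>"
          then have "\<gamma> = - \<alpha>" using \<gamma>(4) reflection_reflection[of \<alpha> \<gamma>] by simp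
          then show False using \<gamma>(2) \<alpha>(1) by (simp add: height_base)
        qed
        ultimately show "\<delta> \<in> N w - {\<alpha>}"
          using \<gamma> \<alpha>(1) by (simp add: N_def reflection_root base_roots)
      qed
      moreover have "\<alpha> \<in> N w" using \<alpha> by (simp add: N_def base_roots height_base)
      ultimately have "reflection \<alpha> ` N ?w \<subset> N w" by blast
      then have "card (reflection \<alpha> ` N ?w) < card (N w)" by (rule psubset_card_mono[OF fin])
      moreover have "card (reflection \<alpha> ` N ?w) = card (N ?w)"
        by (rule card_image, rule inj_on_inverseI[where g = "reflection \<alpha>"]) simp
      ultimately show ?thesis using less.hyps[of ?w] less.prems W_comp W_gen \<alpha>(1) by simp
    qed (use less.prems in blast)
  qed
  moreover have "id \<in> W" by (rule generated_group_id[OF reflection_image_involution])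
  ultimately show ?thesis by blast
qed

lemma W_descent:
  assumes "w \<in> W" "w \<noteq> id"
  obtains \<alpha> where "\<alpha> \<in> \<Delta>" "\<alpha> \<bullet> w height_vector < 0"
proof -
  have "\<exists>\<alpha>\<in>\<Delta>. \<alpha> \<bullet> w height_vector < 0"
  proof (rule ccontr)
    assume "\<not> ?thesis"
    then have "0 \<le> w height_vector \<bullet> \<alpha>" if "\<alpha> \<in> \<Delta>" for \<alpha>
      using that by (auto simp: inner_commute not_less)
    from dominant_nonneg[OF this] have "finite_walls.separating w = {}"
      unfolding finite_walls.separating_def unfolding root_functions_def
      by (fastforce simp: inner_commute)
    then show False
      using finite_walls.separating_empty_imp_id[of \<Delta> w] assms by simp
  qed
  then show thesis using that by blast
qed

text \<open>
  The dominant chamber is a fundamental domain, and stabilisers of dominant vectors are standard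
  parabolic. If \<open>\<alpha>\<close> is a descent of \<open>w\<close>, then \<open>\<langle>\<alpha>, w v\<rangle> = \<langle>w\<inverse> \<alpha>, v\<rangle>\<close> is both nonnegative and
  nonpositive, so \<open>w v\<close> is fixed by the reflection in \<open>\<alpha>\<close>.
\<close>

lemma dominant_stabilizer:
  assumes v: "\<And>\<alpha>. \<alpha> \<in> \<Delta> \<Longrightarrow> 0 \<le> v \<bullet> \<alpha>"
    and "w \<in> W" "\<And>\<alpha>. \<alpha> \<in> \<Delta> \<Longrightarrow> 0 \<le> w v \<bullet> \<alpha>"
  shows "w v = v \<and> w \<in> generated_group (reflection ` {\<alpha>\<in>\<Delta>. v \<bullet> \<alpha> = 0})"
  using assms(2,3)
proof (induction "card (finite_walls.separating w)" arbitrary: w rule: less_induct)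
  case less
  let ?I = "reflection ` {\<alpha>\<in>\<Delta>. v \<bullet> \<alpha> = 0}"
  show ?case
  proof (cases "w = id")
    case True
    then show ?thesis using generated_group_id[OF reflection_image_involution] by auto
  next
    case False
    obtain \<alpha> where \<alpha>: "\<alpha> \<in> \<Delta>" "\<alpha> \<bullet> w height_vector < 0" using W_descent[OF less.prems(1) False] .
    obtain w' where w': "w' \<in> W" "\<And>v. w (w' v) = v" using W_inverse[OF less.prems(1)] by metis
    have adj: "\<alpha> \<bullet> w u = w' \<alpha> \<bullet> u" for u
      using W_orthogonal[OF less.prems(1)] w'(2)[of \<alpha>] by (metis orthogonal_transformation_def)
    have "v \<bullet> w' \<alpha> \<le> 0"
      using \<alpha> w' W_root base_roots unfolding adj by (intro dominant_nonpos v) auto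
    then have "w v \<bullet> \<alpha> = 0" using less.prems(2)[OF \<alpha>(1)] adj[of v] by (simp add: inner_commute)
    then have fix_wv: "reflection \<alpha> (w v) = w v" by (simp add: reflection_orthogonal inner_commute)
    let ?u = "reflection \<alpha> \<circ> w"
    obtain "is" where "is": "set is \<subseteq> \<Delta>" "w = finite_walls.word is"
      using W_word[OF less.prems(1)] by blast
    have "card (finite_walls.separating ?u) < card (finite_walls.separating w)"
      using finite_walls.card_separating_down[OF \<alpha>(1) "is"(1)] \<alpha>(2) unfolding "is"(2) by simp
    moreover have u: "?u \<in> W" using W_comp W_gen \<alpha>(1) less.prems(1) by blast
    moreover have "0 \<le> ?u v \<bullet> \<gamma>" if "\<gamma> \<in> \<Delta>" for \<gamma> using fix_wv less.prems(2)[OF that] by simp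
    ultimately have IH: "?u v = v" "?u \<in> generated_group ?I" using less.hyps[of ?u] by blast+
    have wv: "w v = v" using IH(1) fix_wv by simp
    have "reflection \<alpha> \<in> generated_group ?I"
      using \<alpha>(1) \<open>w v \<bullet> \<alpha> = 0\<close> wv by (intro generated_group_gen[OF reflection_image_involution]) auto
    from generated_group_comp[OF reflection_image_involution this IH(2)]
    have "reflection \<alpha> \<circ> ?u \<in> generated_group ?I" by (simp only: comp_def)
    moreover have "reflection \<alpha> \<circ> ?u = w" by (simp add: fun_eq_iff)
    ultimately show ?thesis using wv by simp
  qed
qed


subsection \<open>The highest root\<close>

lemma base_obtuse:
  assumes "\<alpha> \<in> \<Delta>" "\<delta> \<in> \<Delta>" "\<alpha> \<noteq> \<delta>"
  shows "\<alpha> \<bullet> \<delta> \<le> 0"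
proof -
  have "0 < height (reflection \<alpha> \<delta>)"
    using assms by (intro simple_reflection_permutes_pos) (auto simp: base_roots height_base)
  then have "0 \<le> coweight \<alpha> \<bullet> reflection \<alpha> \<delta>"
    using assms by (intro coweight_nonneg) (auto simp: base_roots reflection_root)
  then have "(\<alpha> \<bullet> \<delta>) * (2 / (\<alpha> \<bullet> \<alpha>)) \<le> 0"
    using assms by (simp add: reflection_def coroot_def inner_diff_right coweight_base)
  moreover have "0 < 2 / (\<alpha> \<bullet> \<alpha>)" using base_roots[OF assms(1)] by simp
  ultimately show ?thesis by (metis mult_le_0_iff not_less)
qed

text \<open>
  If \<open>Z\<close> were orthogonal to the rest of the base, each simple reflection would preserve the set of roots
  lying in the span of one of the two parts. As every root is conjugate to a simple one, these
  spans would split \<open>\<Phi>\<close> into two orthogonal parts.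
\<close>

lemma base_connected:
  assumes "Z \<subseteq> \<Delta>" "Z \<noteq> {}" "Z \<noteq> \<Delta>"
  shows "\<exists>\<alpha>\<in>Z. \<exists>\<delta>\<in>\<Delta> - Z. \<alpha> \<bullet> \<delta> \<noteq> 0"
proof (rule ccontr)
  assume "\<not> ?thesis"
  then have none: "\<alpha> \<bullet> \<delta> = 0" "\<delta> \<bullet> \<alpha> = 0" if "\<alpha> \<in> Z" "\<delta> \<in> \<Delta> - Z" for \<alpha> \<delta>
    using that inner_commute by metis+
  define A where "A = {\<beta>\<in>\<Phi>. \<forall>\<delta>\<in>\<Delta> - Z. coweight \<delta> \<bullet> \<beta> = 0}"
  define B where "B = {\<beta>\<in>\<Phi>. \<forall>\<alpha>\<in>Z. coweight \<alpha> \<bullet> \<beta> = 0}"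
  have orthA: "\<beta> \<bullet> \<delta> = 0" if "\<beta> \<in> A" "\<delta> \<in> \<Delta> - Z" for \<beta> \<delta>
  proof -
    have "\<delta> \<bullet> \<beta> = (\<Sum>\<alpha>\<in>\<Delta>. (coweight \<alpha> \<bullet> \<beta>) * (\<delta> \<bullet> \<alpha>))" by (rule inner_expansion)
    also have "\<dots> = 0"
      using that none by (intro sum.neutral) (auto simp: A_def none)
    finally show ?thesis by (simp add: inner_commute)
  qed
  have orthB: "\<beta> \<bullet> \<alpha> = 0" if "\<beta> \<in> B" "\<alpha> \<in> Z" for \<beta> \<alpha>
  proof -
    have "\<alpha> \<bullet> \<beta> = (\<Sum>\<gamma>\<in>\<Delta>. (coweight \<gamma> \<bullet> \<beta>) * (\<alpha> \<bullet> \<gamma>))" by (rule inner_expansion)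
    also have "\<dots> = 0"
      using that none by (intro sum.neutral) (auto simp: B_def none)
    finally show ?thesis by (simp add: inner_commute)
  qed
  have step: "reflection \<gamma> \<beta> \<in> A \<union> B" if "\<gamma> \<in> \<Delta>" "\<beta> \<in> A \<union> B" for \<gamma> \<beta>
  proof -
    have root: "reflection \<gamma> \<beta> \<in> \<Phi>" using that by (auto simp: A_def B_def base_roots reflection_root)
    have coef: "coweight \<delta> \<bullet> reflection \<gamma> \<beta> = coweight \<delta> \<bullet> \<beta>" if "\<delta> \<in> \<Delta>" "\<delta> \<noteq> \<gamma>" for \<delta>
      using that \<open>\<gamma> \<in> \<Delta>\<close> by (simp add: reflection_def coroot_def inner_diff_right coweight_base)
    consider "\<beta> \<in> A" "\<gamma> \<in> Z" | "\<beta> \<in> A" "\<gamma> \<in> \<Delta> - Z" | "\<beta> \<in> B" "\<gamma> \<in> Z" | "\<beta> \<in> B" "\<gamma> \<in> \<Delta> - Z"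
      using \<open>\<gamma> \<in> \<Delta>\<close> \<open>\<beta> \<in> A \<union> B\<close> by blast
    then show ?thesis
    proof cases
      case 1
      have "coweight \<delta> \<bullet> reflection \<gamma> \<beta> = 0" if "\<delta> \<in> \<Delta> - Z" for \<delta>
      proof -
        have "\<delta> \<noteq> \<gamma>" using 1 that by blast
        then show ?thesis using coef that 1 by (simp add: A_def)
      qed
      then have "reflection \<gamma> \<beta> \<in> A" using root by (simp add: A_def)
      then show ?thesis by simp
    next
      case 2
      then show ?thesis using orthA by (simp add: reflection_orthogonal inner_commute)
    next
      case 3
      then show ?thesis using orthB by (simp add: reflection_orthogonal inner_commute)
    next
      case 4
      have "coweight \<delta> \<bullet> reflection \<gamma> \<beta> = 0" if "\<delta> \<in> Z" for \<delta>
      proof -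
        have "\<delta> \<noteq> \<gamma>" "\<delta> \<in> \<Delta>" using 4 that assms(1) by blast+
        then show ?thesis using coef that 4 by (simp add: B_def)
      qed
      then have "reflection \<gamma> \<beta> \<in> B" using root by (simp add: B_def)
      then show ?thesis by simp
    qed
  qed
  have "\<Phi> \<subseteq> A \<union> B"
  proof
    fix \<beta> assume "\<beta> \<in> \<Phi>"
    then obtain w \<alpha> where w: "w \<in> W" "\<alpha> \<in> \<Delta>" "\<beta> = w \<alpha>" using root_conjugate_base by blast
    obtain "is" where "is": "set is \<subseteq> \<Delta>" "w = composite (map reflection is)"
      using W_word[OF w(1)] by blast
    have "\<alpha> \<in> A \<union> B" using w(2) subsetD[OF assms(1)] by (auto simp: A_def B_def base_roots coweight_base)
    then have "composite (map reflection is) \<alpha> \<in> A \<union> B" using "is"(1) step by (induction "is") auto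
    then show "\<beta> \<in> A \<union> B" using "is" w by simp
  qed
  moreover have "A \<subseteq> \<Phi>" "B \<subseteq> \<Phi>" by (auto simp: A_def B_def)
  ultimately have AB: "A \<union> B = \<Phi>" by blast
  have disj: "A \<inter> B = {}"
  proof (rule ccontr)
    assume "A \<inter> B \<noteq> {}"
    then obtain \<beta> where "\<beta> \<in> A" "\<beta> \<in> B" by blast
    then have "\<beta> = 0" by (intro eq_zero_if_coweights) (auto simp: A_def B_def)
    then show False using \<open>\<beta> \<in> A\<close> zero_not_root by (auto simp: A_def)
  qed
  have orth: "\<alpha> \<bullet> \<beta> = 0" if "\<alpha> \<in> A" "\<beta> \<in> B" for \<alpha> \<beta>
  proof -
    have "\<alpha> \<bullet> \<beta> = (\<Sum>\<gamma>\<in>\<Delta>. (coweight \<gamma> \<bullet> \<beta>) * (\<alpha> \<bullet> \<gamma>))" by (rule inner_expansion)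
    also have "\<dots> = 0"
      using that orthA by (intro sum.neutral) (auto simp: B_def)
    finally show ?thesis .
  qed
  obtain z d where "z \<in> Z" "d \<in> \<Delta> - Z" using assms by blast
  then have "z \<in> A" "d \<in> B" using subsetD[OF assms(1)] by (auto simp: A_def B_def base_roots coweight_base)
  then have "A \<noteq> {} \<and> B \<noteq> {} \<and> A \<union> B = \<Phi> \<and> A \<inter> B = {} \<and> (\<forall>\<alpha>\<in>A. \<forall>\<beta>\<in>B. \<alpha> \<bullet> \<beta> = 0)"
    using AB disj orth by simp blast
  moreover have "\<not> (\<exists>A B. A \<noteq> {} \<and> B \<noteq> {} \<and> A \<union> B = \<Phi> \<and> A \<inter> B = {} \<and>
      (\<forall>\<alpha>\<in>A. \<forall>\<beta>\<in>B. \<alpha> \<bullet> \<beta> = 0))"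
    using irreducible unfolding irreducible_roots_def by (rule conjunct2)
  ultimately show False by (metis (no_types))
qed

text \<open>
  A simple root \<open>\<zeta>\<close> outside the support of \<open>\<gamma>\<close> pairs nonpositively with all simple roots in the support,
  and by connectedness some such \<open>\<zeta>\<close> has a strictly negative pairing, against dominance.
\<close>

lemma dominant_root_full_support:
  assumes "\<gamma> \<in> \<Phi>" "\<And>\<alpha>. \<alpha> \<in> \<Delta> \<Longrightarrow> 0 \<le> \<gamma> \<bullet> \<alpha>" "\<alpha> \<in> \<Delta>"
  shows "0 < coweight \<alpha> \<bullet> \<gamma>"
proof -
  have pos: "0 < height \<gamma>"
  proof (rule ccontr)
    assume "\<not> ?thesis"
    then have "\<gamma> \<bullet> \<gamma> \<le> 0"
      using height_nonzero assms(1,2) by (intro dominant_nonpos) (auto simp: less_le)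
    moreover have "0 < \<gamma> \<bullet> \<gamma>" using assms(1) by simp
    ultimately show False by linarith
  qed
  note nonneg = coweight_nonneg[OF assms(1) pos]
  define Z where "Z = {\<alpha>\<in>\<Delta>. coweight \<alpha> \<bullet> \<gamma> = 0}"
  have "Z \<noteq> \<Delta>" using eq_zero_if_coweights[of \<gamma>] assms(1) by (auto simp: Z_def)
  have "Z = {}"
  proof (rule ccontr)
    assume "Z \<noteq> {}"
    then obtain \<zeta> \<delta> where \<zeta>: "\<zeta> \<in> Z" "\<delta> \<in> \<Delta> - Z" "\<zeta> \<bullet> \<delta> \<noteq> 0"
      using base_connected[of Z] \<open>Z \<noteq> \<Delta>\<close> by (auto simp: Z_def)
    have terms: "(coweight \<epsilon> \<bullet> \<gamma>) * (\<zeta> \<bullet> \<epsilon>) \<le> 0" if "\<epsilon> \<in> \<Delta>" for \<epsilon>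
      using that \<zeta>(1) nonneg[OF that] base_obtuse[of \<zeta> \<epsilon>]
      by (cases "\<epsilon> = \<zeta>") (auto simp: Z_def mult_nonneg_nonpos)
    have "0 < coweight \<delta> \<bullet> \<gamma>" using \<zeta>(2) nonneg[of \<delta>] by (auto simp: Z_def less_le)
    moreover have "\<zeta> \<bullet> \<delta> < 0" using base_obtuse[of \<zeta> \<delta>] \<zeta> by (cases "\<zeta> = \<delta>") (auto simp: Z_def)
    ultimately have "(coweight \<delta> \<bullet> \<gamma>) * (\<zeta> \<bullet> \<delta>) < 0" by (rule mult_pos_neg)
    then have "(\<Sum>\<epsilon>\<in>\<Delta>. (coweight \<epsilon> \<bullet> \<gamma>) * (\<zeta> \<bullet> \<epsilon>)) < (\<Sum>\<epsilon>\<in>\<Delta>. 0)"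
      using terms \<zeta>(2) finite_base by (intro sum_strict_mono_ex1) auto
    then have "\<zeta> \<bullet> \<gamma> < 0" by (subst inner_expansion) simp
    then show False using assms(2)[of \<zeta>] \<zeta>(1) by (auto simp: Z_def inner_commute)
  qed
  then show ?thesis using nonneg[OF assms(3)] assms(3) by (auto simp: Z_def less_le)
qed

text \<open>
  Maximal length forces the pairings of a root with the coroot of \<open>\<beta>\<close> to lie strictly between
  -2 and 2, by Cauchy--Schwarz.
\<close>

lemma long_coroot_bound:
  fixes \<beta> \<gamma> :: "'b::euclidean_space"
  assumes "norm \<gamma> \<le> norm \<beta>" "\<gamma> \<noteq> \<beta>" "\<beta> \<noteq> 0"
  shows "\<gamma> \<bullet> coroot \<beta> < 2"
proof -
  have "0 < (\<gamma> - \<beta>) \<bullet> (\<gamma> - \<beta>)" using assms by simp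
  then have "2 * (\<gamma> \<bullet> \<beta>) < \<gamma> \<bullet> \<gamma> + \<beta> \<bullet> \<beta>"
    by (simp add: inner_diff_left inner_diff_right inner_commute)
  moreover have "\<gamma> \<bullet> \<gamma> \<le> \<beta> \<bullet> \<beta>"
    using assms(1) by (simp add: norm_le)
  ultimately have "\<gamma> \<bullet> \<beta> < \<beta> \<bullet> \<beta>" by linarith
  then show ?thesis using assms(3) by (simp add: coroot_def divide_simps)
qed

text \<open>
  A dominant root \<open>\<theta>\<close> of maximal length is highest. Every root lies below a dominant root
  \<open>\<gamma>\<close>, and by full support \<open>\<gamma>\<close> is not orthogonal to \<open>\<theta>\<close>. If \<open>\<gamma> \<noteq> \<theta>\<close>, then
  \<open>\<langle>\<gamma>, \<theta>\<^sup>\<or>\<rangle> = 1\<close>, so \<open>\<gamma> - \<theta>\<close> is a root with negative pairing with \<open>\<theta>\<close>, hence a negative root.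
\<close>

lemma long_dominant_root_highest:
  assumes top: "cascade_top height_vector \<Phi> \<theta>" and "\<beta> \<in> \<Phi>" "\<alpha> \<in> \<Delta>"
  shows "coweight \<alpha> \<bullet> \<beta> \<le> coweight \<alpha> \<bullet> \<theta>"
proof -
  define U where "U = {\<gamma>\<in>\<Phi>. \<forall>\<alpha>\<in>\<Delta>. coweight \<alpha> \<bullet> \<beta> \<le> coweight \<alpha> \<bullet> \<gamma>}"
  have "finite U" "\<beta> \<in> U" using finite_roots assms(2) by (auto simp: U_def)
  then have "Max (height ` U) \<in> height ` U" by (intro Max_in) auto
  then obtain \<gamma> where \<gamma>: "\<gamma> \<in> U" "height \<gamma> = Max (height ` U)" by auto
  have max: "height \<delta> \<le> height \<gamma>" if "\<delta> \<in> U" for \<delta>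
    using \<gamma>(2) that \<open>finite U\<close> by simp
  have root: "\<gamma> \<in> \<Phi>" "\<theta> \<in> \<Phi>" using \<gamma> top by (auto simp: U_def cascade_top_def)
  have dom_\<gamma>: "0 \<le> \<gamma> \<bullet> \<delta>" if "\<delta> \<in> \<Delta>" for \<delta>
  proof (rule ccontr)
    assume neg: "\<not> 0 \<le> \<gamma> \<bullet> \<delta>"
    define c where "c = - (\<delta> \<bullet> \<gamma>) * (2 / (\<delta> \<bullet> \<delta>))"
    have "0 < - (\<delta> \<bullet> \<gamma>)" "0 < 2 / (\<delta> \<bullet> \<delta>)"
      using neg base_roots[OF that] by (auto simp: inner_commute)
    then have "0 < c" unfolding c_def by (rule mult_pos_pos)
    have refl: "reflection \<delta> \<gamma> = \<gamma> + c *\<^sub>R \<delta>" by (simp add: c_def reflection_def coroot_def)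
    have "coweight \<epsilon> \<bullet> \<gamma> \<le> coweight \<epsilon> \<bullet> reflection \<delta> \<gamma>" if "\<epsilon> \<in> \<Delta>" for \<epsilon>
      using that \<open>\<delta> \<in> \<Delta>\<close> \<open>0 < c\<close> by (simp add: refl inner_add_right coweight_base)
    then have "reflection \<delta> \<gamma> \<in> U"
      using \<gamma>(1) reflection_root[OF base_roots[OF that] root(1)]
      unfolding U_def by (auto intro: order_trans)
    then show False
      using max[of "reflection \<delta> \<gamma>"] \<open>0 < c\<close> that by (simp add: refl inner_add_left height_base)
  qed
  have dom_\<theta>: "0 \<le> \<theta> \<bullet> \<delta>" if "\<delta> \<in> \<Phi>" "0 < height \<delta>" for \<delta>
    using cascade_top_dominant[OF closed_roots top that] by (simp add: inner_commute)
  have "coweight \<alpha> \<bullet> \<gamma> \<le> coweight \<alpha> \<bullet> \<theta>"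
  proof (cases "\<gamma> = \<theta>")
    case False
    have "\<exists>\<delta>\<in>\<Delta>. \<theta> \<bullet> \<delta> \<noteq> 0"
    proof (rule ccontr)
      assume "\<not> ?thesis"
      then have "\<theta> \<bullet> \<theta> = 0" by (subst inner_expansion) simp
      then show False using root by simp
    qed
    then obtain \<delta> where "\<delta> \<in> \<Delta>" "0 < \<theta> \<bullet> \<delta>"
      using dom_\<theta> base_roots by (fastforce simp: height_base less_le)
    then have "0 < (\<Sum>\<epsilon>\<in>\<Delta>. (coweight \<epsilon> \<bullet> \<gamma>) * (\<theta> \<bullet> \<epsilon>))"
      using finite_base dominant_root_full_support[OF root(1) dom_\<gamma>] dom_\<theta> base_roots
      by (intro sum_pos2[of _ \<delta>] mult_pos_pos mult_nonneg_nonneg)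
        (auto simp: height_base less_imp_le)
    then have "0 < \<theta> \<bullet> \<gamma>" unfolding inner_expansion[of \<theta> \<gamma>, symmetric] .
    then have "0 < \<gamma> \<bullet> coroot \<theta>" using root by (simp add: inner_coroot_pos inner_commute)
    moreover have "\<gamma> \<bullet> coroot \<theta> < 2"
      using top root False by (intro long_coroot_bound) (auto simp: cascade_top_def)
    ultimately have one: "\<gamma> \<bullet> coroot \<theta> = 1"
      using coroot_integer[OF root(2,1)] by (auto elim!: Ints_cases)
    then have half: "2 * (\<theta> \<bullet> \<gamma>) = \<theta> \<bullet> \<theta>"
      using root by (simp add: coroot_def inner_commute divide_simps)
    have "(\<theta> \<bullet> \<gamma>) *\<^sub>R coroot \<theta> = (\<gamma> \<bullet> coroot \<theta>) *\<^sub>R \<theta>"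
      by (simp add: coroot_def inner_commute)
    then have "(\<theta> \<bullet> \<gamma>) *\<^sub>R coroot \<theta> = \<theta>" using one by simp
    then have diff: "\<gamma> - \<theta> \<in> \<Phi>" using reflection_root[OF root(2,1)] by (simp add: reflection_def)
    have "\<not> 0 < height (\<gamma> - \<theta>)"
    proof
      assume "0 < height (\<gamma> - \<theta>)"
      from dom_\<theta>[OF diff this] have "\<theta> \<bullet> \<theta> \<le> \<theta> \<bullet> \<gamma>" by (simp add: inner_diff_right)
      moreover have "0 < \<theta> \<bullet> \<theta>" using root by simp
      ultimately show False using half by linarith
    qed
    then have "coweight \<alpha> \<bullet> (\<gamma> - \<theta>) \<le> 0"
      using coweight_nonpos[OF diff _ assms(3)] height_nonzero[OF diff] by linarith
    then show ?thesis by (simp add: inner_diff_right)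
  qed simp
  then show ?thesis using \<gamma>(1) assms(3) by (force simp: U_def)
qed

abbreviation \<theta> :: 'a where
  "\<theta> \<equiv> highest_root \<Phi> \<Delta>"

lemma highest_root_top: "cascade_top height_vector \<Phi> \<theta>"
proof -
  have "\<Phi> \<noteq> {}" using irreducible by (simp add: irreducible_roots_def)
  then obtain t where top: "cascade_top height_vector \<Phi> t"
    using cascade_top_exists[OF finite_roots closed_roots] height_nonzero by blast
  then have t: "t \<in> \<Phi>" by (simp add: cascade_top_def)
  have "t - \<beta> \<in> nonneg_comb \<Delta>" if "\<beta> \<in> \<Phi>" for \<beta>
    unfolding nonneg_comb_iff
  proof
    fix \<alpha> assume \<alpha>: "\<alpha> \<in> \<Delta>"
    have "coweight \<alpha> \<bullet> (t - \<beta>) \<in> \<int>" "0 \<le> coweight \<alpha> \<bullet> (t - \<beta>)"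
      using coweight_integer[OF t \<alpha>] coweight_integer[OF that \<alpha>]
        long_dominant_root_highest[OF top that \<alpha>] by (auto simp: inner_diff_right)
    then show "coweight \<alpha> \<bullet> (t - \<beta>) \<in> \<nat>" by (simp add: Nats_altdef2)
  qed
  then have "t \<in> \<Phi> \<and> (\<forall>\<beta>\<in>\<Phi>. t - \<beta> \<in> nonneg_comb \<Delta>)" using t by blast
  moreover have "s = t" if s: "s \<in> \<Phi> \<and> (\<forall>\<beta>\<in>\<Phi>. s - \<beta> \<in> nonneg_comb \<Delta>)" for s
  proof -
    have "coweight \<alpha> \<bullet> (s - t) = 0" if "\<alpha> \<in> \<Delta>" for \<alpha>
      using s t that calculation Nats_nonneg[of "coweight \<alpha> \<bullet> (s - t)"]
        Nats_nonneg[of "coweight \<alpha> \<bullet> (t - s)"]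
      by (auto simp: nonneg_comb_iff inner_diff_right)
    then have "s - t = 0" by (rule eq_zero_if_coweights)
    then show "s = t" by simp
  qed
  ultimately have "\<theta> = t" unfolding highest_root_def by (rule the_equality)
  then show ?thesis using top by simp
qed

lemma highest_root_root: "\<theta> \<in> \<Phi>" and highest_root_pos: "0 < height \<theta>"
  using highest_root_top by (auto simp: cascade_top_def)

lemma coweight_le_highest: "\<beta> \<in> \<Phi> \<Longrightarrow> \<alpha> \<in> \<Delta> \<Longrightarrow> coweight \<alpha> \<bullet> \<beta> \<le> coweight \<alpha> \<bullet> \<theta>"
  by (rule long_dominant_root_highest[OF highest_root_top])

lemma height_le_highest: "\<beta> \<in> \<Phi> \<Longrightarrow> height \<beta> \<le> height \<theta>"
  unfolding height_eq by (intro sum_mono coweight_le_highest)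

lemma height_less_highest:
  assumes "\<beta> \<in> \<Phi>" "\<beta> \<noteq> \<theta>"
  shows "height \<beta> < height \<theta>"
proof -
  have "\<exists>\<alpha>\<in>\<Delta>. coweight \<alpha> \<bullet> (\<theta> - \<beta>) \<noteq> 0" using eq_zero_if_coweights[of "\<theta> - \<beta>"] assms(2) by auto
  then have "\<exists>\<alpha>\<in>\<Delta>. coweight \<alpha> \<bullet> \<beta> < coweight \<alpha> \<bullet> \<theta>"
    using coweight_le_highest[OF assms(1)] by (force simp: inner_diff_right less_le)
  then show ?thesis
    unfolding height_eq using finite_base coweight_le_highest[OF assms(1)]
    by (intro sum_strict_mono_ex1) auto
qed

end

section \<open>Affine isometries\<close>

definition affine_isometry :: "('a::euclidean_space \<Rightarrow> 'a) \<Rightarrow> bool" where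
  "affine_isometry g \<longleftrightarrow> orthogonal_transformation (linear_part g)"

lemma affine_isometry_linear: "affine_isometry g \<Longrightarrow> linear (linear_part g)"
  by (simp add: affine_isometry_def orthogonal_transformation_def)

lemma linear_part_diff: "affine_isometry g \<Longrightarrow> linear_part g (v - w) = g v - g w"
  by (simp add: linear_diff affine_isometry_linear) (simp add: linear_part_def)

lemma linear_part_comp: "affine_isometry g \<Longrightarrow> linear_part (g \<circ> h) = linear_part g \<circ> linear_part h"
  by (simp add: fun_eq_iff linear_part_def[of h] linear_part_diff) (simp add: linear_part_def)

lemma linear_part_orthogonal: "orthogonal_transformation g \<Longrightarrow> linear_part g = g"
  by (simp add: fun_eq_iff linear_part_def linear_0 orthogonal_transformation_def)

lemma affine_isometry_comp: "affine_isometry g \<Longrightarrow> affine_isometry h \<Longrightarrow> affine_isometry (g \<circ> h)"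
  unfolding affine_isometry_def
  by (subst linear_part_comp) (auto simp: affine_isometry_def intro: orthogonal_transformation_compose)

lemma affine_isometry_composite:
  assumes "\<And>g. g \<in> set gs \<Longrightarrow> affine_isometry g"
  shows "affine_isometry (composite gs) \<and> linear_part (composite gs) = composite (map linear_part gs)"
  using assms
proof (induction gs)
  case Nil
  have "linear_part (id :: 'a \<Rightarrow> 'a) = id" by (simp add: fun_eq_iff linear_part_def)
  then show "affine_isometry (composite ([] :: ('a \<Rightarrow> 'a) list)) \<and>
      linear_part (composite ([] :: ('a \<Rightarrow> 'a) list)) = composite (map linear_part [])"
    by (simp add: affine_isometry_def id_def)
next
  case (Cons g gs)
  then have gs: "affine_isometry g" "affine_isometry (composite gs)"
    "linear_part (composite gs) = composite (map linear_part gs)" by auto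
  have "linear_part (composite (g # gs)) = composite (map linear_part (g # gs))"
    unfolding list.map composite_Cons linear_part_comp[OF gs(1)] gs(3) ..
  moreover have "affine_isometry (composite (g # gs))"
    unfolding composite_Cons using gs(1,2) by (rule affine_isometry_comp)
  ultimately show "affine_isometry (composite (g # gs)) \<and>
      linear_part (composite (g # gs)) = composite (map linear_part (g # gs))" by blast
qed

lemma linear_part_affine_reflection: "linear_part (affine_reflection a) = reflection (fst a)"
  by (simp add: fun_eq_iff linear_part_def affine_reflection_def reflection_def scaleR_add_left)

lemma affine_isometry_reflection: "affine_isometry (affine_reflection a)"
  by (simp add: affine_isometry_def linear_part_affine_reflection orthogonal_transformation_reflection)

lemma coroot_image: "orthogonal_transformation g \<Longrightarrow> g (coroot \<alpha>) = coroot (g \<alpha>)"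
  by (simp add: coroot_def orthogonal_transformation_def linear_cmul)

definition affine_form :: "'a::real_inner \<times> int \<Rightarrow> 'a \<Rightarrow> real" where
  "affine_form a v = fst a \<bullet> v + of_int (snd a)"

lemma affine_reflection_form: "affine_reflection a v = v - affine_form a v *\<^sub>R coroot (fst a)"
  by (simp add: affine_reflection_def affine_form_def)

lemma affine_form_reflection:
  "affine_form b (affine_reflection a v) = affine_form b v - affine_form a v * (fst b \<bullet> coroot (fst a))"
  by (simp add: affine_reflection_form affine_form_def[of b] inner_diff_right)

lemma affine_form_reflection_self:
  "fst a \<noteq> 0 \<Longrightarrow> affine_form a (affine_reflection a v) = - affine_form a v"
  by (simp add: affine_form_reflection inner_coroot_self)

lemma affine_reflection_reflection [simp]: "affine_reflection a (affine_reflection a v) = v"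
proof (cases "fst a = 0")
  case False
  then show ?thesis
    by (simp add: affine_reflection_form[of a "affine_reflection a v"] affine_form_reflection_self)
      (simp add: affine_reflection_form)
qed (simp add: affine_reflection_form coroot_def)

lemma affine_reflection_involution: "s \<in> affine_reflection ` A \<Longrightarrow> s \<circ> s = id"
  by (auto simp: fun_eq_iff)

lemma affine_form_dual:
  assumes g: "affine_isometry g" and eq: "\<And>v. affine_form b (g v) = affine_form a v"
  shows "linear_part g (fst a) = fst b"
proof (rule orthogonal_transformation_dual[where w = "linear_part g"])
  show "orthogonal_transformation (linear_part g)" using g by (simp add: affine_isometry_def)
  fix v
  show "fst b \<bullet> linear_part g v = fst a \<bullet> v"
    using eq[of v] eq[of 0] by (simp add: linear_part_def inner_diff_right affine_form_def)
qed

lemma affine_reflection_conj: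
  assumes g: "affine_isometry g" and eq: "\<And>v. affine_form b (g v) = affine_form a v"
  shows "affine_reflection b \<circ> g = g \<circ> affine_reflection a"
proof (rule ext)
  fix v
  have orth: "orthogonal_transformation (linear_part g)" using g by (simp add: affine_isometry_def)
  have "g v - g (affine_reflection a v) = linear_part g (affine_form a v *\<^sub>R coroot (fst a))"
    using linear_part_diff[OF g, of v "affine_reflection a v"] by (simp add: affine_reflection_form)
  also have "\<dots> = affine_form a v *\<^sub>R coroot (fst b)"
    using orth affine_form_dual[OF g eq]
    by (simp add: coroot_image orthogonal_transformation_scaleR)
  finally have "g (affine_reflection a v) = g v - affine_form a v *\<^sub>R coroot (fst b)"
    by (simp add: algebra_simps)
  then show "(affine_reflection b \<circ> g) v = (g \<circ> affine_reflection a) v"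
    by (simp add: affine_reflection_form[of b] eq)
qed

text \<open>
  The barycentre of an orbit is fixed.
\<close>

lemma finite_group_fixed_point:
  fixes G :: "('a::euclidean_space \<Rightarrow> 'a) set"
  assumes "finite G" "G \<noteq> {}" and iso: "\<And>u. u \<in> G \<Longrightarrow> affine_isometry u"
    and shift: "\<And>u. u \<in> G \<Longrightarrow> bij_betw (\<lambda>t. u \<circ> t) G G"
  shows "\<exists>q. \<forall>u\<in>G. u q = q"
proof -
  define q where "q = (1 / real (card G)) *\<^sub>R (\<Sum>t\<in>G. t 0)"
  have card: "card G \<noteq> 0" using assms by simp
  have "u q = q" if "u \<in> G" for u
  proof -
    note lin = affine_isometry_linear[OF iso[OF that]]
    have "u q = linear_part u q + u 0" by (simp add: linear_part_def)
    also have "linear_part u q = (1 / real (card G)) *\<^sub>R (\<Sum>t\<in>G. linear_part u (t 0))"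
      by (simp add: q_def linear_cmul[OF lin] linear_sum[OF lin])
    also have "\<dots> + u 0 = (1 / real (card G)) *\<^sub>R (\<Sum>t\<in>G. linear_part u (t 0) + u 0)"
      using card by (simp add: sum.distrib scaleR_add_right sum_constant_scaleR)
    also have "(\<Sum>t\<in>G. linear_part u (t 0) + u 0) = (\<Sum>t\<in>G. (u \<circ> t) 0)"
      by (simp add: linear_part_def)
    also have "\<dots> = (\<Sum>t\<in>G. t 0)" by (rule sum.reindex_bij_betw[OF shift[OF that]])
    finally show ?thesis by (simp add: q_def)
  qed
  then show ?thesis by blast
qed

lemma generated_group_fixed_point:
  fixes S :: "('a::euclidean_space \<Rightarrow> 'a) set"
  assumes inv: "\<And>s. s \<in> S \<Longrightarrow> s \<circ> s = id" and "finite (generated_group S)"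
    and iso: "\<And>u. u \<in> generated_group S \<Longrightarrow> affine_isometry u"
  shows "\<exists>q. \<forall>u\<in>generated_group S. u q = q"
proof (rule finite_group_fixed_point)
  show "generated_group S \<noteq> {}" using generated_group_id[OF inv] by blast
  fix u assume u: "u \<in> generated_group S"
  obtain h where h: "h \<in> generated_group S" "h \<circ> u = id" "u \<circ> h = id"
    using generated_group_inverse[OF inv u] by metis
  show "bij_betw (\<lambda>t. u \<circ> t) (generated_group S) (generated_group S)"
  proof (rule bij_betw_byWitness[where f' = "\<lambda>t. h \<circ> t"])
    show "\<forall>t\<in>generated_group S. h \<circ> (u \<circ> t) = t" "\<forall>t\<in>generated_group S. u \<circ> (h \<circ> t) = t"
      using h by (auto simp: comp_assoc[symmetric])
    show "(\<lambda>t. u \<circ> t) ` generated_group S \<subseteq> generated_group S"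
      "(\<lambda>t. h \<circ> t) ` generated_group S \<subseteq> generated_group S"
      using generated_group_comp[OF inv] u h(1) by auto
  qed
qed (use assms in auto)

text \<open>
  Linear parts turn a factorisation into reflections of the group into one into linear
  reflections, where the dimension count for orthogonal reflections applies.
\<close>

lemma reflection_length_orthogonal:
  assumes orth: "orthogonal_list \<beta>s"
    and refl: "\<And>r. r \<in> group_reflections J \<Longrightarrow> affine_isometry r \<and> (\<exists>\<alpha>. linear_part r = reflection \<alpha>)"
    and rs: "length rs = length \<beta>s" "set rs \<subseteq> group_reflections J"
    and lin: "linear_part (composite rs) = composite (map reflection \<beta>s)"
  shows "reflection_length J (composite rs) = length \<beta>s"
  unfolding reflection_length_def word_length_def composite_def[symmetric]
proof (rule Least_equality)
  show "\<exists>ws. length ws = length \<beta>s \<and> set ws \<subseteq> group_reflections J \<and> composite ws = composite rs"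
    using rs by blast
next
  fix l assume "\<exists>ws. length ws = l \<and> set ws \<subseteq> group_reflections J \<and> composite ws = composite rs"
  then obtain ws where ws: "length ws = l" "set ws \<subseteq> group_reflections J" "composite ws = composite rs"
    by blast
  obtain \<alpha> where \<alpha>: "linear_part r = reflection (\<alpha> r)" if "r \<in> group_reflections J" for r
    using refl by metis
  have "composite (map reflection \<beta>s) = composite (map linear_part ws)"
    using lin affine_isometry_composite[of ws] refl ws by auto
  also have "map linear_part ws = map reflection (map \<alpha> ws)" using \<alpha> ws(2) by auto
  finally show "length \<beta>s \<le> l" using orthogonal_reflections_minimal[OF orth] ws(1) by fastforce
qed


section \<open>The affine Weyl group\<close>

context based_root_system
begin

text \<open>
  The factor puts the point below the wall \<open>\<theta> = 1\<close>, so that it lies in the interior of the fundamental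
  alcove and all roots take values strictly between -1 and 1 there.
\<close>

definition alcove_point :: 'a where
  "alcove_point = (1 / (1 + height \<theta>)) *\<^sub>R height_vector"

abbreviation affine_base :: "('a \<times> int) set" where
  "affine_base \<equiv> affine_simple_roots \<Phi> \<Delta>"

definition affine_roots :: "('a \<Rightarrow> real) set" where
  "affine_roots = affine_form ` (\<Phi> \<times> UNIV)"

lemma affine_base_root: "a \<in> affine_base \<Longrightarrow> fst a \<in> \<Phi>"
  by (auto simp: affine_simple_roots_def highest_root_root uminus_root base_roots)

lemma affine_base_root_nonzero: "a \<in> affine_base \<Longrightarrow> fst a \<noteq> 0"
  using affine_base_root by simp

lemma inner_alcove: "x \<bullet> alcove_point = height x / (1 + height \<theta>)"
  by (simp add: alcove_point_def)

lemma inner_alcove_pos: "0 < x \<bullet> alcove_point \<longleftrightarrow> 0 < height x"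
  using highest_root_pos by (simp add: inner_alcove zero_less_divide_iff)

lemma inner_alcove_bounds:
  assumes "\<beta> \<in> \<Phi>"
  shows "\<beta> \<bullet> alcove_point < 1" "-1 < \<beta> \<bullet> alcove_point"
proof -
  have *: "\<gamma> \<bullet> alcove_point < 1" if "\<gamma> \<in> \<Phi>" for \<gamma>
    using height_le_highest[OF that] highest_root_pos by (simp add: inner_alcove)
  show "\<beta> \<bullet> alcove_point < 1" using *[OF assms] .
  show "-1 < \<beta> \<bullet> alcove_point" using *[OF uminus_root[OF assms]] by simp
qed

lemma long_coroot_bounds:
  assumes "\<beta> \<in> \<Phi>" "\<beta> \<noteq> \<theta>" "\<beta> \<noteq> - \<theta>"
  shows "-1 \<le> \<beta> \<bullet> coroot \<theta>"
proof -
  have "- \<beta> \<noteq> \<theta>" using assms(3) by (metis minus_minus)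
  then have "(- \<beta>) \<bullet> coroot \<theta> < 2"
    using assms highest_root_top uminus_root[OF assms(1)] highest_root_root
    by (intro long_coroot_bound) (auto simp: cascade_top_def)
  moreover obtain z where z: "\<beta> \<bullet> coroot \<theta> = of_int z"
    using coroot_integer[OF highest_root_root assms(1)] by (auto elim: Ints_cases)
  ultimately have "-2 < (of_int z :: real)" by simp
  then have "-1 \<le> z" by linarith
  then show ?thesis unfolding z by linarith
qed

text \<open>
  The reflection in \<open>\<theta> = 1\<close> moves the alcove point by a multiple \<open>r < 1\<close> of the coroot of \<open>\<theta>\<close>, and
  since \<open>\<theta>\<close> is long, pairings with that coroot are at least -1 except at \<open>-\<theta>\<close>.
\<close>

lemma affine_reflection_permutes_pos:
  assumes "\<beta> \<in> \<Phi>" "a \<in> affine_base" "0 < affine_form (\<beta>, k) alcove_point" "(\<beta>, k) \<noteq> a"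
  shows "0 < affine_form (\<beta>, k) (affine_reflection a alcove_point)"
proof -
  have val: "affine_form (\<beta>, k) alcove_point = \<beta> \<bullet> alcove_point + of_int k"
    by (simp add: affine_form_def)
  then have "-1 < (of_int k :: real)"
    using assms(3) inner_alcove_bounds(1)[OF assms(1)] by linarith
  then have k: "0 \<le> k" by linarith
  consider (finite) \<alpha> where "\<alpha> \<in> \<Delta>" "a = (\<alpha>, 0)" | (affine) "a = (- \<theta>, 1)"
    using assms(2) by (auto simp: affine_simple_roots_def)
  then show ?thesis
  proof cases
    case finite
    have root: "reflection \<alpha> \<beta> \<in> \<Phi>" using finite assms(1) by (simp add: base_roots reflection_root)
    have eq: "affine_form (\<beta>, k) (affine_reflection a alcove_point)
        = reflection \<alpha> \<beta> \<bullet> alcove_point + of_int k"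
      unfolding finite(2) affine_reflection_zero by (simp add: affine_form_def reflection_inner_swap)
    show ?thesis
    proof (cases "k = 0")
      case True
      then have "0 < height \<beta>" "\<beta> \<noteq> \<alpha>" using assms(3,4) finite val inner_alcove_pos by auto
      then have "0 < height (reflection \<alpha> \<beta>)"
        using simple_reflection_permutes_pos finite assms(1) by blast
      then show ?thesis unfolding eq using True inner_alcove_pos by simp
    next
      case False
      then have "1 \<le> (of_int k :: real)" using k by simp
      then show ?thesis unfolding eq using inner_alcove_bounds(2)[OF root] by linarith
    qed
  next
    case affine
    define r where "r = 1 - \<theta> \<bullet> alcove_point"
    have \<theta>_pos: "0 < \<theta> \<bullet> alcove_point" using highest_root_pos by (simp add: inner_alcove_pos)
    have r: "0 < r" "r < 1"
      using inner_alcove_bounds[OF highest_root_root] \<theta>_pos by (auto simp: r_def)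
    have co: "coroot (- \<theta>) = - coroot \<theta>" by (simp add: coroot_def)
    have eq: "affine_form (\<beta>, k) (affine_reflection a alcove_point)
        = \<beta> \<bullet> alcove_point + of_int k + r * (\<beta> \<bullet> coroot \<theta>)"
      unfolding affine affine_form_reflection by (simp add: affine_form_def co r_def)
    have two: "\<theta> \<bullet> coroot \<theta> = 2" using highest_root_root by (simp add: inner_coroot_self)
    consider "\<beta> = \<theta>" | "\<beta> = - \<theta>" | "\<beta> \<noteq> \<theta>" "\<beta> \<noteq> - \<theta>" by blast
    then show ?thesis
    proof cases
      case 1
      have "\<beta> \<bullet> coroot \<theta> = 2" "0 < \<beta> \<bullet> alcove_point" using 1 two \<theta>_pos by simp_all
      then show ?thesis unfolding eq using k r by simp
    next
      case 2
      have "0 < (of_int k :: real)" using assms(3) \<theta>_pos val 2 by simp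
      moreover have "k \<noteq> 1" using assms(4) affine 2 by simp
      ultimately have "2 \<le> (of_int k :: real)" by simp
      moreover have "\<beta> \<bullet> coroot \<theta> = -2" "\<beta> \<bullet> alcove_point = - (\<theta> \<bullet> alcove_point)"
        using 2 two by simp_all
      ultimately show ?thesis unfolding eq using \<theta>_pos by (simp add: r_def)
    next
      case 3
      show ?thesis
      proof (cases "k = 0")
        case True
        then have pos: "0 < height \<beta>" using assms(3) val inner_alcove_pos by simp
        then have "0 \<le> \<beta> \<bullet> \<theta>"
          using cascade_top_dominant[OF closed_roots highest_root_top assms(1)] by simp
        then have "0 \<le> \<beta> \<bullet> coroot \<theta>" using highest_root_root by (simp add: coroot_def)
        then show ?thesis
          unfolding eq using True pos r by (simp add: add_pos_nonneg inner_alcove_pos)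
      next
        case False
        then have k1: "1 \<le> (of_int k :: real)" using k by simp
        have "- \<beta> \<noteq> \<theta>" using 3(2) by (metis minus_minus)
        then have "height (- \<beta>) < height \<theta>"
          by (rule height_less_highest[OF uminus_root[OF assms(1)]])
        then have "0 < height (\<beta> + \<theta>)" by (simp add: inner_add_left)
        then have "0 < \<beta> \<bullet> alcove_point + \<theta> \<bullet> alcove_point"
          unfolding inner_alcove_pos[symmetric] by (simp add: inner_add_left)
        moreover have "- r \<le> r * (\<beta> \<bullet> coroot \<theta>)"
          using long_coroot_bounds[OF assms(1) 3] r mult_left_mono[of "-1" "\<beta> \<bullet> coroot \<theta>" r] by simp
        ultimately show ?thesis unfolding eq using k1 by (simp add: r_def)
      qed
    qed
  qed
qed

sublocale affine_walls: wall_system affine_roots alcove_point affine_base affine_reflection affine_form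
proof
  fix f i v
  show "i \<in> affine_base \<Longrightarrow> affine_reflection i (affine_reflection i v) = v" by simp
  show "i \<in> affine_base \<Longrightarrow> affine_form i \<in> affine_roots"
    using affine_base_root[of i] by (cases i) (auto simp: affine_roots_def)
  show "i \<in> affine_base \<Longrightarrow> affine_form i (affine_reflection i v) = - affine_form i v"
    by (simp add: affine_form_reflection_self affine_base_root_nonzero)
  show "0 < affine_form i alcove_point" if "i \<in> affine_base"
    using that inner_alcove_bounds(1)[OF highest_root_root]
    by (auto simp: affine_simple_roots_def affine_form_def inner_alcove_pos height_base)
  show "f alcove_point \<noteq> 0" if f: "f \<in> affine_roots"
  proof
    assume zero: "f alcove_point = 0"
    obtain \<beta> k where \<beta>: "\<beta> \<in> \<Phi>" "f = affine_form (\<beta>, k)" using f by (auto simp: affine_roots_def)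
    then have eq: "\<beta> \<bullet> alcove_point = - of_int k" using zero by (simp add: affine_form_def)
    then have "k = 0" using inner_alcove_bounds[OF \<beta>(1)] by simp
    then show False
      using eq height_nonzero[OF \<beta>(1)] highest_root_pos by (simp add: inner_alcove)
  qed
  show "(\<lambda>v. f (affine_reflection i v)) \<in> affine_roots" if f: "f \<in> affine_roots" "i \<in> affine_base"
  proof -
    obtain \<beta> k where \<beta>: "\<beta> \<in> \<Phi>" "f = affine_form (\<beta>, k)" using f(1) by (auto simp: affine_roots_def)
    obtain n where n: "\<beta> \<bullet> coroot (fst i) = of_int n"
      using coroot_integer[OF affine_base_root[OF f(2)] \<beta>(1)] by (auto elim: Ints_cases)
    have "f (affine_reflection i v) = affine_form (reflection (fst i) \<beta>, k - snd i * n) v" for v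
      unfolding \<beta>(2) affine_form_reflection using n
      by (simp add: affine_form_def reflection_def inner_diff_left coroot_def algebra_simps inner_commute)
    then have "(\<lambda>v. f (affine_reflection i v)) = affine_form (reflection (fst i) \<beta>, k - snd i * n)"
      by (rule ext)
    then show ?thesis
      using reflection_root[OF affine_base_root[OF f(2)] \<beta>(1)] by (auto simp: affine_roots_def)
  qed
  show "0 < f (affine_reflection i alcove_point)"
    if f: "f \<in> affine_roots" "i \<in> affine_base" "0 < f alcove_point" "f \<noteq> affine_form i"
  proof -
    obtain \<beta> k where \<beta>: "\<beta> \<in> \<Phi>" "f = affine_form (\<beta>, k)" using f(1) by (auto simp: affine_roots_def)
    with f(4) have "(\<beta>, k) \<noteq> i" by blast
    then show ?thesis using affine_reflection_permutes_pos[OF \<beta>(1) f(2)] f(3) \<beta>(2) by simp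
  qed
next
  fix i j and "is" :: "('a \<times> int) list"
  let ?w = "composite (map affine_reflection is)"
  assume eq: "(\<lambda>v. affine_form i (?w v)) = affine_form j"
  have "affine_isometry ?w"
    by (rule affine_isometry_composite[THEN conjunct1]) (auto simp: affine_isometry_reflection)
  then show "affine_reflection i \<circ> ?w = ?w \<circ> affine_reflection j"
    by (rule affine_reflection_conj) (use fun_cong[OF eq] in simp)
qed

text \<open>
  Lengths here are taken in the whole affine Weyl group; \<open>word_length_eq_card_separating\<close> identifies them
  with the separating numbers used for the parabolic subgroup.
\<close>

lemma longest_elementI:
  assumes A: "A \<subseteq> affine_base" and g: "g \<in> generated_group (affine_reflection ` A)"
    and neg: "\<And>a. a \<in> A \<Longrightarrow> affine_form a (g alcove_point) < 0"
  shows "longest_element \<Phi> \<Delta> (affine_reflection ` A) = g"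
proof -
  have sub: "generated_group (affine_reflection ` A) \<subseteq> generated_group (affine_reflection ` affine_base)"
    by (rule generated_group_mono[OF affine_reflection_involution]) (use A in auto)
  have len: "word_length (affine_simple_reflections \<Phi> \<Delta>) u = card (affine_walls.separating u)"
    if "u \<in> generated_group (affine_reflection ` A)" for u
    unfolding affine_simple_reflections_def
    by (rule affine_walls.word_length_eq_card_separating) (use that sub in auto)
  note long = affine_walls.opposite_chamber_longest[OF A g neg]
  show ?thesis
    unfolding longest_element_def
  proof (rule the_equality)
    show "g \<in> generated_group (affine_reflection ` A) \<and>
        (\<forall>u\<in>generated_group (affine_reflection ` A).
          word_length (affine_simple_reflections \<Phi> \<Delta>) u \<le> word_length (affine_simple_reflections \<Phi> \<Delta>) g)"
      using g long(1) by (simp add: len)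
  next
    fix w assume w: "w \<in> generated_group (affine_reflection ` A) \<and>
        (\<forall>u\<in>generated_group (affine_reflection ` A).
          word_length (affine_simple_reflections \<Phi> \<Delta>) u \<le> word_length (affine_simple_reflections \<Phi> \<Delta>) w)"
    then have "card (affine_walls.separating g) \<le> card (affine_walls.separating w)"
      using g len by force
    then show "w = g" using long w by (simp add: le_antisym)
  qed
qed

text \<open>
  The alcove point is a positive multiple of the height vector, and elements of \<open>W\<close> are linear, so the sign
  condition at the alcove can be tested on the height vector.
\<close>

lemma finite_longest_elementI:
  assumes I: "I \<subseteq> \<Delta>" and g: "g \<in> generated_group (reflection ` I)"
    and neg: "\<And>\<alpha>. \<alpha> \<in> I \<Longrightarrow> \<alpha> \<bullet> g height_vector < 0"
  shows "longest_element \<Phi> \<Delta> (reflection ` I) = g"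
proof -
  have eq: "reflection ` I = affine_reflection ` (\<lambda>\<alpha>. (\<alpha>, 0)) ` I"
    by (simp add: image_image affine_reflection_zero)
  have "generated_group (reflection ` I) \<subseteq> W"
    by (rule generated_group_mono[OF reflection_image_involution]) (use I in auto)
  then have "g \<in> W" using g by blast
  then have lin: "linear g" using W_orthogonal by (simp add: orthogonal_transformation_def)
  show ?thesis
    unfolding eq
  proof (rule longest_elementI)
    show "(\<lambda>\<alpha>. (\<alpha>, 0)) ` I \<subseteq> affine_base" using I by (auto simp: affine_simple_roots_def)
    show "g \<in> generated_group (affine_reflection ` (\<lambda>\<alpha>. (\<alpha>, 0)) ` I)" using g unfolding eq .
    fix a assume "a \<in> (\<lambda>\<alpha>. (\<alpha>, 0 :: int)) ` I"
    then obtain \<alpha> where "\<alpha> \<in> I" "a = (\<alpha>, 0)" by blast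
    then show "affine_form a (g alcove_point) < 0"
      using neg highest_root_pos
      by (auto simp: affine_form_def alcove_point_def linear_cmul[OF lin] intro!: divide_neg_pos)
  qed
qed

lemma affine_group_isometry:
  assumes "A \<subseteq> affine_base" "u \<in> generated_group (affine_reflection ` A)"
  shows "affine_isometry u" "linear_part u \<in> W"
proof -
  obtain as where as: "set as \<subseteq> A" "u = composite (map affine_reflection as)"
    using assms affine_walls.in_generated_iff by blast
  have *: "affine_isometry u \<and> linear_part u = composite (map linear_part (map affine_reflection as))"
    unfolding as(2) by (rule affine_isometry_composite) (auto simp: affine_isometry_reflection)
  then show "affine_isometry u" by blast
  have lin: "map linear_part (map affine_reflection as) = map reflection (map fst as)"
    by (simp add: linear_part_affine_reflection)
  have "set (map fst as) \<subseteq> \<Phi>" using as(1) assms(1) affine_base_root by auto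
  then have "composite (map reflection (map fst as)) \<in> W" by (rule composite_reflections_in_W)
  then show "linear_part u \<in> W" using * unfolding lin by simp
qed

lemma group_reflection_linear_part:
  assumes A: "A \<subseteq> affine_base" and u: "u \<in> generated_group (affine_reflection ` A)" and a: "a \<in> A"
  defines "r \<equiv> u \<circ> affine_reflection a \<circ> inv_into UNIV u"
  shows "r \<in> generated_group (affine_reflection ` A)" "affine_isometry r"
    "linear_part r = reflection (linear_part u (fst a))"
proof -
  note inv = affine_reflection_involution[where A = A]
  obtain h where h: "h \<in> generated_group (affine_reflection ` A)" "h \<circ> u = id" "u \<circ> h = id"
    "inv_into UNIV u = h"
    using generated_group_inverse[OF inv u] by metis
  have s: "affine_reflection a \<in> generated_group (affine_reflection ` A)"
    by (rule generated_group_gen[OF inv]) (use a in auto)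
  show r: "r \<in> generated_group (affine_reflection ` A)"
    unfolding r_def h(4)
    by (rule generated_group_comp[OF inv generated_group_comp[OF inv u s] h(1)])
  then show "affine_isometry r" using affine_group_isometry[OF A] by blast
  note iso = affine_group_isometry(1)[OF A]
  have orth: "orthogonal_transformation (linear_part u)" using iso[OF u] by (simp add: affine_isometry_def)
  have "linear_part u (linear_part h v) = v" for v
  proof -
    have "linear_part u \<circ> linear_part h = linear_part (u \<circ> h)" by (simp add: linear_part_comp[OF iso[OF u]])
    also have "\<dots> = id" unfolding h(3) by (simp add: fun_eq_iff linear_part_def)
    finally show ?thesis by (simp add: fun_eq_iff)
  qed
  moreover have "linear_part r = linear_part u \<circ> (reflection (fst a) \<circ> linear_part h)"
    unfolding r_def h(4) comp_assoc
    by (simp add: linear_part_comp iso[OF u] affine_isometry_reflection linear_part_affine_reflection)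
  ultimately show "linear_part r = reflection (linear_part u (fst a))"
    by (simp add: fun_eq_iff reflection_conj[OF orth])
qed

lemma group_reflections_isometry:
  assumes "A \<subseteq> affine_base" "r \<in> group_reflections (affine_reflection ` A)"
  shows "affine_isometry r \<and> (\<exists>\<alpha>. linear_part r = reflection \<alpha>)"
  using assms group_reflection_linear_part unfolding group_reflections_def by blast

text \<open>
  A finite parabolic subgroup fixes a point \<open>q\<close>, so it acts near \<open>q\<close> as the finite reflection group
  of the roots through \<open>q\<close>, with the alcove point seen from \<open>q\<close> as the regular vector.
  The cascade of this root system lifts to a factorisation of \<open>w\<^sub>J\<close>.
\<close>

lemma spherical_longest_element:
  assumes A: "A \<subseteq> affine_base" and fin: "finite (generated_group (affine_reflection ` A))"
  obtains \<beta>s p where "orthogonal_list \<beta>s" "set \<beta>s \<subseteq> \<Phi>"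
    "linear_part (longest_element \<Phi> \<Delta> (affine_reflection ` A)) = composite (map reflection \<beta>s)"
    "reflection_length (affine_reflection ` A) (longest_element \<Phi> \<Delta> (affine_reflection ` A)) = length \<beta>s"
    "\<And>a. a \<in> A \<Longrightarrow> 0 < fst a \<bullet> p"
    "\<And>a. a \<in> A \<Longrightarrow> fst a \<bullet> composite (map reflection \<beta>s) p < 0"
proof -
  let ?J = "affine_reflection ` A"
  let ?G = "generated_group ?J"
  note inv = affine_reflection_involution[where A = A] and iso = affine_group_isometry(1)[OF A]
  obtain q where q: "u q = q" if "u \<in> ?G" for u
    using generated_group_fixed_point[OF inv fin iso] by blast
  define p where "p = alcove_point - q"
  define \<Psi> where "\<Psi> = {linear_part u (fst a) | u a. u \<in> ?G \<and> a \<in> A}"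
  have simple: "fst a \<in> \<Psi>" if "a \<in> A" for a
  proof -
    have "fst a = linear_part id (fst a)" by (simp add: linear_part_def)
    then show ?thesis using that generated_group_id[OF inv] unfolding \<Psi>_def by blast
  qed
  have sub: "\<Psi> \<subseteq> \<Phi>"
    using affine_group_isometry(2)[OF A] W_root affine_base_root A by (auto simp: \<Psi>_def)
  have lift: "\<exists>r. r \<in> group_reflections ?J \<and> r \<in> ?G \<and> linear_part r = reflection \<beta>" if "\<beta> \<in> \<Psi>" for \<beta>
    using that group_reflection_linear_part[OF A] unfolding \<Psi>_def group_reflections_def by blast
  have form: "affine_form a (u alcove_point) = fst a \<bullet> linear_part u p" if "u \<in> ?G" "a \<in> A" for u a
  proof -
    have "affine_reflection a \<in> ?G" using that(2) by (intro generated_group_gen[OF inv]) auto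
    then have "affine_form a q *\<^sub>R coroot (fst a) = 0"
      using q[of "affine_reflection a"] by (simp add: affine_reflection_form)
    moreover have "coroot (fst a) \<noteq> 0"
      using affine_base_root_nonzero[of a] that(2) A by (auto simp: coroot_def)
    ultimately have "affine_form a q = 0" by simp
    moreover have "linear_part u p = u alcove_point - q"
      unfolding p_def using linear_part_diff[OF iso[OF that(1)]] q[OF that(1)] by simp
    ultimately show ?thesis by (simp add: affine_form_def inner_diff_right)
  qed
  have closed: "reflection_closed \<Psi>"
    unfolding reflection_closed_def
  proof (intro ballI)
    fix \<alpha> \<beta> assume "\<alpha> \<in> \<Psi>" "\<beta> \<in> \<Psi>"
    then obtain r u a where r: "r \<in> ?G" "linear_part r = reflection \<alpha>"
      and u: "u \<in> ?G" "a \<in> A" "\<beta> = linear_part u (fst a)"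
      using lift unfolding \<Psi>_def by blast
    have "reflection \<alpha> \<beta> = linear_part (r \<circ> u) (fst a)"
      using linear_part_comp[OF iso[OF r(1)], of u] r(2) u(3) by simp
    then show "reflection \<alpha> \<beta> \<in> \<Psi>"
      using generated_group_comp[OF inv r(1) u(1)] u(2) unfolding \<Psi>_def by blast
  qed
  have regular: "\<gamma> \<bullet> p \<noteq> 0" if \<gamma>: "\<gamma> \<in> \<Psi>" for \<gamma>
  proof -
    obtain u a where u: "u \<in> ?G" "a \<in> A" "\<gamma> = linear_part u (fst a)" using \<gamma> by (auto simp: \<Psi>_def)
    obtain h where h: "h \<in> ?G" "u \<circ> h = id" using generated_group_inverse[OF inv u(1)] by metis
    have "linear_part u (linear_part h p) = p"
    proof -
      have "linear_part u \<circ> linear_part h = linear_part (u \<circ> h)"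
        by (simp add: linear_part_comp[OF iso[OF u(1)]])
      also have "\<dots> = id" unfolding h(2) by (simp add: fun_eq_iff linear_part_def)
      finally show ?thesis by (simp add: fun_eq_iff)
    qed
    then have "\<gamma> \<bullet> p = fst a \<bullet> linear_part h p"
      using iso[OF u(1)] u(3) by (metis affine_isometry_def orthogonal_transformation_def)
    also have "\<dots> = affine_form a (h alcove_point)" using form[OF h(1) u(2)] by simp
    also have "\<dots> \<noteq> 0"
      using affine_walls.in_generated_iff[OF A, of h] h(1) u(2) A
        affine_walls.simple_root_word_nonzero[of a] by blast
    finally show ?thesis .
  qed
  obtain \<beta>s where casc: "cascade p \<Psi> \<beta>s"
    using cascade_exists[OF finite_subset[OF sub finite_roots] closed regular] by blast
  note orth = cascade_orthogonal[OF casc]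
  obtain \<rho> where \<rho>: "\<rho> \<beta> \<in> group_reflections ?J" "\<rho> \<beta> \<in> ?G" "linear_part (\<rho> \<beta>) = reflection \<beta>"
    if "\<beta> \<in> \<Psi>" for \<beta>
    using lift by metis
  define rs where "rs = map \<rho> \<beta>s"
  have rs: "set rs \<subseteq> group_reflections ?J" "set rs \<subseteq> ?G" "map linear_part rs = map reflection \<beta>s"
    using cascade_subset[OF casc] \<rho> by (auto simp: rs_def)
  have G: "composite rs \<in> ?G"
    using rs(2)
  proof (induction rs)
    case Nil
    show "composite [] \<in> ?G" using generated_group_id[OF inv] by simp
  next
    case (Cons r rs)
    then show "composite (r # rs) \<in> ?G"
      unfolding composite_Cons by (intro generated_group_comp[OF inv]) auto
  qed
  have lin: "linear_part (composite rs) = composite (map reflection \<beta>s)"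
    using affine_isometry_composite[of rs] rs iso by auto
  have pos: "0 < fst a \<bullet> p" if "a \<in> A" for a
    using form[OF generated_group_id[OF inv] that] affine_walls.simple_root_pos[of a] that A
    by (auto simp: linear_part_def)
  have neg: "fst a \<bullet> composite (map reflection \<beta>s) p < 0" if "a \<in> A" for a
    by (rule cascade_negates[OF closed regular casc simple[OF that] pos[OF that]])
  have long: "longest_element \<Phi> \<Delta> ?J = composite rs"
    by (rule longest_elementI[OF A G]) (use form[OF G] neg lin in simp)
  have "reflection_length ?J (composite rs) = length \<beta>s"
    by (rule reflection_length_orthogonal[OF orth _ _ rs(1) lin])
      (use group_reflections_isometry[OF A] in \<open>auto simp: rs_def\<close>)
  then show thesis
    using that[OF orth _ _ _ pos neg] cascade_subset[OF casc] sub lin long by auto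
qed

lemma finite_reflection_length:
  assumes "orthogonal_list \<beta>s" "set \<beta>s \<subseteq> \<Phi>"
  shows "reflection_length (reflection ` \<Delta>) (composite (map reflection \<beta>s)) = length \<beta>s"
proof (rule reflection_length_orthogonal[OF assms(1)])
  have eq: "reflection ` \<Delta> = affine_reflection ` (\<lambda>\<alpha>. (\<alpha>, 0)) ` \<Delta>"
    by (simp add: image_image affine_reflection_zero)
  have sub: "(\<lambda>\<alpha>. (\<alpha>, 0)) ` \<Delta> \<subseteq> affine_base" by (auto simp: affine_simple_roots_def)
  show "affine_isometry r \<and> (\<exists>\<alpha>. linear_part r = reflection \<alpha>)"
    if "r \<in> group_reflections (reflection ` \<Delta>)" for r
    using group_reflections_isometry[OF sub] that unfolding eq by blast
  show "set (map reflection \<beta>s) \<subseteq> group_reflections (reflection ` \<Delta>)"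
    using root_reflection_conjugate assms(2) unfolding group_reflections_def by fastforce
  have "orthogonal_transformation (composite (map reflection \<beta>s))"
    by (rule orthogonal_transformation_reflections[OF assms(1)])
  then show "linear_part (composite (map reflection \<beta>s)) = composite (map reflection \<beta>s)"
    by (rule linear_part_orthogonal)
qed simp

end

section \<open>Downward paths in the quantum Bruhat graph\<close>

context based_root_system
begin

text \<open>
  A consequence of being a parabolic subsystem that suffices for comparing lengths and, unlike a
  description by simple roots, passes directly to the roots orthogonal to a cascade top.
\<close>

definition parabolic_like :: "'a set \<Rightarrow> bool" where
  "parabolic_like \<Psi> \<longleftrightarrow> \<Psi> \<subseteq> \<Phi> \<and> reflection_closed \<Psi> \<and>
     (\<forall>\<gamma>\<in>\<Phi> - \<Psi>. 0 < height \<gamma> \<longrightarrow> (\<forall>\<beta>\<in>\<Psi>. 0 < height (reflection \<beta> \<gamma>)))"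

lemma parabolic_like_orthogonal:
  assumes par: "parabolic_like \<Psi>" and top: "cascade_top height_vector \<Psi> \<beta>"
  shows "parabolic_like {\<gamma>\<in>\<Psi>. \<gamma> \<bullet> \<beta> = 0}"
proof -
  have sub: "\<Psi> \<subseteq> \<Phi>" and closed: "reflection_closed \<Psi>" using par by (auto simp: parabolic_like_def)
  have "0 < height (reflection \<delta> \<gamma>)"
    if \<gamma>: "\<gamma> \<in> \<Phi>" "\<not> (\<gamma> \<in> \<Psi> \<and> \<gamma> \<bullet> \<beta> = 0)" "0 < height \<gamma>" and \<delta>: "\<delta> \<in> \<Psi>" "\<delta> \<bullet> \<beta> = 0" for \<gamma> \<delta>
  proof (cases "\<gamma> \<in> \<Psi>")
    case True
    then have pos: "0 < \<gamma> \<bullet> \<beta>"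
      using cascade_top_dominant[OF closed top True \<gamma>(3)] \<gamma>(2) by simp
    have root: "reflection \<delta> \<gamma> \<in> \<Psi>" using closed \<delta>(1) True by (simp add: reflection_closed_def)
    have "reflection \<delta> \<gamma> \<bullet> \<beta> = \<gamma> \<bullet> \<beta>"
      using \<delta>(2) by (simp add: reflection_inner_swap reflection_orthogonal)
    moreover have "- reflection \<delta> \<gamma> \<in> \<Psi>"
      using closed root reflection_self[of "reflection \<delta> \<gamma>"] unfolding reflection_closed_def by metis
    ultimately have "\<not> 0 < height (- reflection \<delta> \<gamma>)"
      using cascade_top_dominant[OF closed top, of "- reflection \<delta> \<gamma>"] pos by auto
    moreover have "height (reflection \<delta> \<gamma>) \<noteq> 0" using root sub height_nonzero by blast
    ultimately show ?thesis by simp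
  qed (use par \<gamma> \<delta> in \<open>auto simp: parabolic_like_def\<close>)
  then show ?thesis
    using sub reflection_closed_orthogonal[OF closed] unfolding parabolic_like_def by blast
qed

text \<open>
  Let \<open>D\<close> be the set of positive roots in \<open>\<Psi>\<close> with positive pairing with \<open>\<beta>\<close>. These are the roots
  that the reflection in \<open>\<beta>\<close> makes negative; it permutes the other positive roots. As \<open>y\<close> makes
  all of \<open>D\<close> negative, the length drops by \<open>|D|\<close>. On the other hand the pairings
  with the coroot of \<open>\<beta>\<close> are 2 at \<open>\<beta>\<close>, 1 at the rest of \<open>D\<close> because \<open>\<beta>\<close> is long in \<open>\<Psi>\<close>, and cancel
  outside \<open>D\<close>, whence \<open>\<langle>2\<rho>, \<beta>\<^sup>\<or>\<rangle> = |D| + 1\<close>.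
\<close>

lemma cascade_top_downward_edge:
  assumes par: "parabolic_like \<Psi>" and top: "cascade_top height_vector \<Psi> \<beta>" and y: "y \<in> W"
    and neg: "\<And>\<gamma>. \<gamma> \<in> \<Psi> \<Longrightarrow> 0 < height \<gamma> \<Longrightarrow> height (y \<gamma>) < 0"
  shows "(y, y \<circ> reflection \<beta>) \<in> quantum_bruhat_edges \<Phi> \<Delta>"
proof -
  have sub: "\<Psi> \<subseteq> \<Phi>" and closed: "reflection_closed \<Psi>"
    and stable: "\<And>\<gamma> \<delta>. \<gamma> \<in> \<Phi> \<Longrightarrow> \<gamma> \<notin> \<Psi> \<Longrightarrow> 0 < height \<gamma> \<Longrightarrow> \<delta> \<in> \<Psi> \<Longrightarrow> 0 < height (reflection \<delta> \<gamma>)"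
    using par by (auto simp: parabolic_like_def)
  have \<beta>: "\<beta> \<in> \<Psi>" "0 < height \<beta>" "\<beta> \<in> \<Phi>" "\<beta> \<noteq> 0"
    using top sub by (auto simp: cascade_top_def)
  have refl_\<Psi>: "reflection \<beta> \<gamma> \<in> \<Psi> \<longleftrightarrow> \<gamma> \<in> \<Psi>" for \<gamma>
    using closed \<beta>(1) reflection_reflection[of \<beta> \<gamma>] unfolding reflection_closed_def by metis
  define P where "P = {\<gamma>\<in>\<Phi>. 0 < height \<gamma>}"
  define D where "D = {\<gamma>\<in>\<Psi>. 0 < height \<gamma> \<and> 0 < \<gamma> \<bullet> \<beta>}"
  define C where "C = P - D"
  have fin: "finite P" "finite D" "finite C"
    using finite_roots finite_subset[OF sub finite_roots] by (auto simp: P_def D_def C_def)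
  have P: "P = C \<union> D" "C \<inter> D = {}" using sub by (auto simp: P_def D_def C_def)
  have C_refl: "reflection \<beta> \<gamma> \<in> C" if "\<gamma> \<in> C" for \<gamma>
  proof (cases "\<gamma> \<in> \<Psi>")
    case True
    then have "\<gamma> \<bullet> \<beta> = 0"
      using cascade_top_dominant[OF closed top True] that by (auto simp: C_def P_def D_def)
    then show ?thesis using that by (simp add: reflection_orthogonal inner_commute)
  next
    case False
    then have "0 < height (reflection \<beta> \<gamma>)" "reflection \<beta> \<gamma> \<notin> \<Psi>" "reflection \<beta> \<gamma> \<in> \<Phi>"
      using that stable \<beta> refl_\<Psi> reflection_root by (auto simp: C_def P_def)
    then show ?thesis by (auto simp: C_def P_def D_def)
  qed
  have bijC: "bij_betw (reflection \<beta>) C C"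
    by (rule bij_betw_byWitness[where f' = "reflection \<beta>"]) (auto simp: C_refl)
  have lin: "linear y" using W_orthogonal[OF y] by (simp add: orthogonal_transformation_def)
  have D_refl: "0 < height (y (reflection \<beta> \<gamma>))" if "\<gamma> \<in> D" for \<gamma>
  proof -
    let ?\<delta> = "- reflection \<beta> \<gamma>"
    have \<gamma>: "\<gamma> \<in> \<Psi>" "0 < \<gamma> \<bullet> \<beta>" using that by (auto simp: D_def)
    have r: "reflection \<beta> \<gamma> \<in> \<Psi>" using \<gamma> refl_\<Psi> by simp
    have "reflection \<beta> \<gamma> \<bullet> \<beta> < 0" using \<gamma>(2) by (simp add: reflection_inner_swap)
    then have "\<not> 0 < height (reflection \<beta> \<gamma>)" using cascade_top_dominant[OF closed top r] by linarith
    moreover have "height (reflection \<beta> \<gamma>) \<noteq> 0" using r sub height_nonzero by blast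
    ultimately have "0 < height ?\<delta>" by simp
    moreover have "?\<delta> \<in> \<Psi>"
      using closed r reflection_self[of "reflection \<beta> \<gamma>"] unfolding reflection_closed_def by metis
    ultimately have "height (y ?\<delta>) < 0" using neg by blast
    then show ?thesis by (simp add: linear_neg[OF lin])
  qed
  define E where "E = {\<gamma>\<in>C. height (y \<gamma>) < 0}"
  have "{\<gamma>\<in>\<Phi>. 0 < height \<gamma> \<and> height (y \<gamma>) < 0} = {\<gamma>\<in>P. height (y \<gamma>) < 0}" by (auto simp: P_def)
  also have "\<dots> = D \<union> E" unfolding P(1) using neg by (auto simp: E_def D_def)
  finally have Ny: "{\<gamma>\<in>\<Phi>. 0 < height \<gamma> \<and> height (y \<gamma>) < 0} = D \<union> E" .
  have "{\<gamma>\<in>\<Phi>. 0 < height \<gamma> \<and> height ((y \<circ> reflection \<beta>) \<gamma>) < 0}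
      = {\<gamma>\<in>P. height (y (reflection \<beta> \<gamma>)) < 0}" by (auto simp: P_def)
  also have "\<dots> = reflection \<beta> ` E"
  proof (intro equalityI subsetI)
    fix \<gamma> assume \<gamma>: "\<gamma> \<in> {\<gamma>\<in>P. height (y (reflection \<beta> \<gamma>)) < 0}"
    then have "\<gamma> \<notin> D" using D_refl by force
    then have "reflection \<beta> \<gamma> \<in> E" using \<gamma> P C_refl by (auto simp: E_def)
    then have "reflection \<beta> (reflection \<beta> \<gamma>) \<in> reflection \<beta> ` E" by (rule imageI)
    then show "\<gamma> \<in> reflection \<beta> ` E" by simp
  next
    fix \<gamma> assume "\<gamma> \<in> reflection \<beta> ` E"
    then show "\<gamma> \<in> {\<gamma>\<in>P. height (y (reflection \<beta> \<gamma>)) < 0}" using C_refl P by (auto simp: E_def)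
  qed
  finally have Nyr: "{\<gamma>\<in>\<Phi>. 0 < height \<gamma> \<and> height ((y \<circ> reflection \<beta>) \<gamma>) < 0} = reflection \<beta> ` E" .
  let ?l = "word_length (reflection ` \<Delta>)"
  have yr: "y \<circ> reflection \<beta> \<in> W" using W_comp y reflection_in_W \<beta> by blast
  have "D \<inter> E = {}" "finite E" using P fin by (auto simp: E_def)
  then have ly: "?l y = card D + card E"
    unfolding word_length_eq_card_inversions[OF y] Ny using fin by (simp add: card_Un_disjoint)
  have "card (reflection \<beta> ` E) = card E"
    by (rule card_image, rule inj_on_inverseI[where g = "reflection \<beta>"]) simp
  then have lyr: "?l (y \<circ> reflection \<beta>) = card E"
    unfolding word_length_eq_card_inversions[OF yr] Nyr .
  have "two_rho \<Phi> \<Delta> = (\<Sum>\<gamma>\<in>P. \<gamma>)"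
    by (auto simp: two_rho_def P_def positive_iff_height intro!: sum.cong)
  then have "two_rho \<Phi> \<Delta> \<bullet> coroot \<beta> = (\<Sum>\<gamma>\<in>C. \<gamma> \<bullet> coroot \<beta>) + (\<Sum>\<gamma>\<in>D. \<gamma> \<bullet> coroot \<beta>)"
    using P fin by (simp add: inner_sum_left sum.union_disjoint inner_add_left)
  also have "(\<Sum>\<gamma>\<in>C. \<gamma> \<bullet> coroot \<beta>) = 0"
  proof -
    have "(\<Sum>\<gamma>\<in>C. \<gamma> \<bullet> coroot \<beta>) = (\<Sum>\<gamma>\<in>C. reflection \<beta> \<gamma> \<bullet> coroot \<beta>)"
      by (rule sum.reindex_bij_betw[OF bijC, symmetric])
    also have "\<dots> = - (\<Sum>\<gamma>\<in>C. \<gamma> \<bullet> coroot \<beta>)"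
      by (simp add: coroot_def reflection_inner_swap sum_negf)
    finally show ?thesis by simp
  qed
  also have "(\<Sum>\<gamma>\<in>D. \<gamma> \<bullet> coroot \<beta>) = (\<Sum>\<gamma>\<in>D. if \<gamma> = \<beta> then 2 else 1)"
  proof (rule sum.cong)
    fix \<gamma> assume \<gamma>: "\<gamma> \<in> D"
    show "\<gamma> \<bullet> coroot \<beta> = (if \<gamma> = \<beta> then 2 else 1)"
    proof (cases "\<gamma> = \<beta>")
      case False
      have "\<gamma> \<bullet> coroot \<beta> < 2"
        using top \<gamma> False \<beta>(4) by (intro long_coroot_bound) (auto simp: cascade_top_def D_def)
      moreover have "0 < \<gamma> \<bullet> coroot \<beta>" using \<gamma> \<beta>(4) by (simp add: inner_coroot_pos D_def)
      moreover have "\<gamma> \<bullet> coroot \<beta> \<in> \<int>" using coroot_integer[OF \<beta>(3)] \<gamma> sub by (auto simp: D_def)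
      ultimately show ?thesis using False by (auto elim!: Ints_cases)
    qed (simp add: inner_coroot_self \<beta>(4))
  qed simp
  also have "\<dots> = real (card D) + 1"
  proof -
    have "\<beta> \<in> D" using \<beta> by (simp add: D_def)
    then have "(\<Sum>\<gamma>\<in>D. if \<gamma> = \<beta> then 2 else 1 :: real) = 2 + (\<Sum>\<gamma>\<in>D - {\<beta>}. 1)"
      using fin by (subst sum.remove[of D \<beta>]) (auto intro!: sum.cong)
    also have "\<dots> = real (card D) + 1"
      using \<open>\<beta> \<in> D\<close> fin card_Suc_Diff1[of D \<beta>] by simp
    finally show ?thesis .
  qed
  finally have "real (?l (y \<circ> reflection \<beta>)) = real (?l y) - two_rho \<Phi> \<Delta> \<bullet> coroot \<beta> + 1"
    using ly lyr by simp
  moreover have "\<beta> \<in> positive_roots \<Phi> \<Delta>" using \<beta> by (simp add: positive_iff_height)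
  ultimately show ?thesis
    using y unfolding quantum_bruhat_edges_def weyl_group_eq simple_reflections_def Let_def by blast
qed

text \<open>
  The reflection in the top root fixes all roots orthogonal to it, so the next element on the path still makes
  the positive roots of the next subsystem negative.
\<close>

lemma cascade_path:
  assumes "cascade height_vector \<Psi> \<beta>s" "parabolic_like \<Psi>" "y \<in> W"
    and "\<And>\<gamma>. \<gamma> \<in> \<Psi> \<Longrightarrow> 0 < height \<gamma> \<Longrightarrow> height (y \<gamma>) < 0"
  shows "(y, y \<circ> composite (map reflection \<beta>s)) \<in> quantum_bruhat_edges \<Phi> \<Delta> ^^ length \<beta>s"
  using assms
proof (induction \<beta>s arbitrary: \<Psi> y)
  case Nil
  show "(y, y \<circ> composite (map reflection [])) \<in> quantum_bruhat_edges \<Phi> \<Delta> ^^ length []" by simp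
next
  case (Cons \<beta> \<beta>s)
  have top: "cascade_top height_vector \<Psi> \<beta>" and casc: "cascade height_vector {\<gamma>\<in>\<Psi>. \<gamma> \<bullet> \<beta> = 0} \<beta>s"
    using Cons.prems(1) by auto
  have "\<beta> \<in> \<Phi>" using top Cons.prems(2) by (auto simp: cascade_top_def parabolic_like_def)
  then have yr: "y \<circ> reflection \<beta> \<in> W" using W_comp Cons.prems(3) reflection_in_W by blast
  have edge: "(y, y \<circ> reflection \<beta>) \<in> quantum_bruhat_edges \<Phi> \<Delta>"
    by (rule cascade_top_downward_edge[OF Cons.prems(2) top Cons.prems(3)]) (rule Cons.prems(4))
  have "(y \<circ> reflection \<beta>, (y \<circ> reflection \<beta>) \<circ> composite (map reflection \<beta>s))
      \<in> quantum_bruhat_edges \<Phi> \<Delta> ^^ length \<beta>s"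
    using Cons.prems(4)
    by (intro Cons.IH[OF casc parabolic_like_orthogonal[OF Cons.prems(2) top] yr])
      (simp add: reflection_orthogonal inner_commute)
  from relpow_Suc_I2[OF edge this]
  show "(y, y \<circ> composite (map reflection (\<beta> # \<beta>s))) \<in> quantum_bruhat_edges \<Phi> \<Delta> ^^ length (\<beta> # \<beta>s)"
    by (simp only: list.map composite_Cons comp_assoc list.size One_nat_def add_Suc_right add_0_right)
qed

lemma path_reflections:
  "(x, z) \<in> quantum_bruhat_edges \<Phi> \<Delta> ^^ n \<Longrightarrow> \<exists>\<alpha>s. length \<alpha>s = n \<and> z = x \<circ> composite (map reflection \<alpha>s)"
proof (induction n arbitrary: z)
  case 0
  then have "z = x \<circ> composite (map reflection [])" by simp
  then show ?case by (metis list.size(3))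
next
  case (Suc n)
  then obtain y where y: "(x, y) \<in> quantum_bruhat_edges \<Phi> \<Delta> ^^ n" "(y, z) \<in> quantum_bruhat_edges \<Phi> \<Delta>"
    by auto
  obtain \<alpha>s where \<alpha>s: "length \<alpha>s = n" "y = x \<circ> composite (map reflection \<alpha>s)" using Suc.IH[OF y(1)] by blast
  obtain \<alpha> where "z = y \<circ> reflection \<alpha>" using y(2) by (auto simp: quantum_bruhat_edges_def)
  then have "z = x \<circ> composite (map reflection (\<alpha>s @ [\<alpha>]))"
    using \<alpha>s(2) by (simp add: comp_assoc)
  then show ?case using \<alpha>s(1) by (metis length_append_singleton)
qed

text \<open>
  An edge multiplies by a reflection, so a shorter path would factor a product of orthogonal
  reflections into fewer reflections.
\<close>

lemma quantum_bruhat_distance_cascade: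
  assumes casc: "cascade height_vector \<Psi> \<beta>s" and par: "parabolic_like \<Psi>" and x: "x \<in> W"
    and neg: "\<And>\<gamma>. \<gamma> \<in> \<Psi> \<Longrightarrow> 0 < height \<gamma> \<Longrightarrow> height (x \<gamma>) < 0"
  shows "quantum_bruhat_distance \<Phi> \<Delta> x (x \<circ> composite (map reflection \<beta>s)) = length \<beta>s"
  unfolding quantum_bruhat_distance_def
proof (rule Least_equality)
  show "(x, x \<circ> composite (map reflection \<beta>s)) \<in> quantum_bruhat_edges \<Phi> \<Delta> ^^ length \<beta>s"
    by (rule cascade_path[OF casc par x]) (rule neg)
next
  fix n assume "(x, x \<circ> composite (map reflection \<beta>s)) \<in> quantum_bruhat_edges \<Phi> \<Delta> ^^ n"
  then obtain \<alpha>s where \<alpha>s: "length \<alpha>s = n"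
    "x \<circ> composite (map reflection \<beta>s) = x \<circ> composite (map reflection \<alpha>s)"
    using path_reflections by blast
  obtain x' where "\<And>v. x' (x v) = v" using W_inverse[OF x] by metis
  then have "composite (map reflection \<beta>s) = composite (map reflection \<alpha>s)"
    using \<alpha>s(2) by (simp add: fun_eq_iff) metis
  then show "length \<beta>s \<le> n"
    using orthogonal_reflections_minimal[OF cascade_orthogonal[OF casc]] \<alpha>s(1) by blast
qed

end


section \<open>The decomposition of the longest element\<close>

lemma small_multiple:
  fixes y z :: "'a::euclidean_space"
  assumes "finite H" "\<And>f. f \<in> H \<Longrightarrow> f \<bullet> y \<noteq> 0"
  shows "\<exists>\<epsilon>>0. \<forall>f\<in>H. \<bar>\<epsilon> * (f \<bullet> z)\<bar> < \<bar>f \<bullet> y\<bar>"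
proof -
  have "\<forall>\<^sub>F \<epsilon> in at_right 0. \<bar>\<epsilon> * (f \<bullet> z)\<bar> < \<bar>f \<bullet> y\<bar>" if "f \<in> H" for f
  proof (rule order_tendstoD(2))
    show "((\<lambda>\<epsilon>. \<bar>\<epsilon> * (f \<bullet> z)\<bar>) \<longlongrightarrow> \<bar>0 * (f \<bullet> z)\<bar>) (at_right 0)" by (intro tendsto_intros)
    show "\<bar>0 * (f \<bullet> z)\<bar> < \<bar>f \<bullet> y\<bar>" using assms(2)[OF that] by simp
  qed
  then have "\<forall>\<^sub>F \<epsilon> in at_right 0. \<forall>f\<in>H. \<bar>\<epsilon> * (f \<bullet> z)\<bar> < \<bar>f \<bullet> y\<bar>"
    using assms(1) by (intro eventually_ball_finite) auto
  moreover have "\<forall>\<^sub>F \<epsilon> in at_right 0. (0::real) < \<epsilon>" by (rule eventually_at_right_less)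
  ultimately have "\<forall>\<^sub>F \<epsilon> in at_right 0. 0 < \<epsilon> \<and> (\<forall>f\<in>H. \<bar>\<epsilon> * (f \<bullet> z)\<bar> < \<bar>f \<bullet> y\<bar>)"
    by (rule eventually_conj[rotated])
  then show ?thesis
    using eventually_happens'[of "at_right (0::real)"] by (auto simp: trivial_limit_at_right_real)
qed

lemma generic_perturbation:
  fixes U :: "'a::euclidean_space set"
  assumes "finite F" "finite P" "subspace U" "y \<in> U"
    and "\<And>f. f \<in> P \<Longrightarrow> 0 < f \<bullet> y" "\<And>f. f \<in> F \<Longrightarrow> \<exists>z\<in>U. f \<bullet> z \<noteq> 0"
  shows "\<exists>y'\<in>U. (\<forall>f\<in>P. 0 < f \<bullet> y') \<and> (\<forall>f\<in>F. f \<bullet> y' \<noteq> 0)"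
  using assms(1,6)
proof (induction F rule: finite_induct)
  case empty
  then show ?case using assms by auto
next
  case (insert g F)
  then obtain y' where y': "y' \<in> U" "\<forall>f\<in>P. 0 < f \<bullet> y'" "\<forall>f\<in>F. f \<bullet> y' \<noteq> 0" by auto
  obtain z where z: "z \<in> U" "g \<bullet> z \<noteq> 0" using insert.prems by auto
  show ?case
  proof (cases "g \<bullet> y' = 0")
    case True
    obtain \<epsilon> where \<epsilon>: "0 < \<epsilon>" "\<And>f. f \<in> P \<union> F \<Longrightarrow> \<bar>\<epsilon> * (f \<bullet> z)\<bar> < \<bar>f \<bullet> y'\<bar>"
      using small_multiple[of "P \<union> F" y' z] y' assms(2) insert.hyps by fastforce
    let ?y = "y' + \<epsilon> *\<^sub>R z"
    have "?y \<in> U" using y' z assms(3) by (intro subspace_add subspace_scale)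
    moreover have "0 < f \<bullet> ?y" if "f \<in> P" for f
      using \<epsilon>(2)[of f] y'(2) that by (force simp: inner_add_right abs_less_iff)
    moreover have "f \<bullet> ?y \<noteq> 0" if "f \<in> F" for f
      using \<epsilon>(2)[of f] that by (auto simp: inner_add_right add_eq_0_iff)
    moreover have "g \<bullet> ?y \<noteq> 0" using True z \<epsilon>(1) by (simp add: inner_add_right)
    ultimately show ?thesis by blast
  qed (use y' in auto)
qed

lemma composite_reflections_conj:
  assumes "orthogonal_transformation w"
  shows "composite (map reflection (map w \<beta>s)) (w v) = w (composite (map reflection \<beta>s) v)"
  by (induction \<beta>s) (simp_all add: reflection_conj[OF assms])

lemma orthogonal_list_append_image:
  assumes w: "orthogonal_transformation w" and "orthogonal_list \<beta>s" "orthogonal_list \<delta>s"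
    and cross: "\<And>\<beta> \<delta>. \<beta> \<in> set \<beta>s \<Longrightarrow> \<delta> \<in> set \<delta>s \<Longrightarrow> w \<beta> \<bullet> \<delta> = 0"
  shows "orthogonal_list (map w \<beta>s @ \<delta>s)"
proof -
  have inj: "inj w" using w by (rule orthogonal_transformation_inj)
  have "w 0 = 0" using w by (simp add: orthogonal_transformation_def linear_0)
  then have nz: "0 \<notin> w ` set \<beta>s"
    using inj_image_mem_iff[OF inj, of 0 "set \<beta>s"] assms(2) by (simp add: orthogonal_list_def)
  have "w ` set \<beta>s \<inter> set \<delta>s = {}"
  proof (rule ccontr)
    assume "w ` set \<beta>s \<inter> set \<delta>s \<noteq> {}"
    then obtain \<beta> where "\<beta> \<in> set \<beta>s" "w \<beta> \<in> set \<delta>s" by blast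
    then have "w \<beta> = 0" using cross by fastforce
    then show False using \<open>w \<beta> \<in> set \<delta>s\<close> assms(3) by (simp add: orthogonal_list_def)
  qed
  moreover have "pairwise orthogonal (w ` set \<beta>s \<union> set \<delta>s)"
    unfolding pairwise_def orthogonal_def
  proof (intro ballI impI)
    fix a b assume ab: "a \<in> w ` set \<beta>s \<union> set \<delta>s" "b \<in> w ` set \<beta>s \<union> set \<delta>s" "a \<noteq> b"
    have imgs: "w \<beta> \<bullet> w \<gamma> = 0" if "\<beta> \<in> set \<beta>s" "\<gamma> \<in> set \<beta>s" "\<beta> \<noteq> \<gamma>" for \<beta> \<gamma>
      using that assms(2) w
      by (simp add: orthogonal_list_def pairwise_def orthogonal_def orthogonal_transformation_def)
    have rest: "\<gamma> \<bullet> \<delta> = 0" if "\<gamma> \<in> set \<delta>s" "\<delta> \<in> set \<delta>s" "\<gamma> \<noteq> \<delta>" for \<gamma> \<delta>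
      using that assms(3) by (simp add: orthogonal_list_def pairwise_def orthogonal_def)
    have cross': "\<delta> \<bullet> w \<beta> = 0" if "\<beta> \<in> set \<beta>s" "\<delta> \<in> set \<delta>s" for \<beta> \<delta>
      using cross[OF that] by (simp add: inner_commute)
    show "a \<bullet> b = 0" using ab imgs rest cross cross' by blast
  qed
  ultimately show ?thesis
    using assms nz inj_on_subset[OF inj] by (auto simp: orthogonal_list_def distinct_map)
qed

text \<open>
  This is applied to the (-1)-eigenspace \<open>U\<close> of the linear part of \<open>w\<^sub>J\<close>; the vector \<open>x v\<close> is a generic
  point of \<open>U\<close> close to \<open>y\<^sub>0\<close>. Moving this point slightly against the height vector before taking the
  dominant conjugate selects, among all \<open>x\<close> with the same \<open>v\<close>, the one that makes the positive roots
  orthogonal to \<open>v\<close> negative.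
\<close>

lemma (in based_root_system) generic_dominant_conjugate:
  assumes U: "subspace U" "y\<^sub>0 \<in> U" and P: "finite P" "\<And>f. f \<in> P \<Longrightarrow> 0 < f \<bullet> y\<^sub>0"
  obtains w x v where "w \<in> W" "x \<in> W" "\<And>u. w (x u) = u" "\<And>u. x (w u) = u" "inv_into UNIV x = w"
    "x v \<in> U" "\<And>f. f \<in> P \<Longrightarrow> 0 < w f \<bullet> v"
    "\<And>\<gamma> z. \<gamma> \<in> \<Phi> \<Longrightarrow> \<gamma> \<bullet> v = 0 \<Longrightarrow> z \<in> U \<Longrightarrow> x \<gamma> \<bullet> z = 0"
    "\<And>\<alpha>. \<alpha> \<in> \<Delta> \<Longrightarrow> 0 \<le> v \<bullet> \<alpha>"
    "\<And>\<gamma>. \<gamma> \<in> \<Phi> \<Longrightarrow> 0 < height \<gamma> \<Longrightarrow> \<gamma> \<bullet> v = 0 \<Longrightarrow> height (x \<gamma>) < 0"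
proof -
  define F where "F = {\<gamma>\<in>\<Phi>. \<exists>z\<in>U. \<gamma> \<bullet> z \<noteq> 0}"
  have "finite F" using finite_roots by (simp add: F_def)
  then obtain y where y: "y \<in> U" "\<And>f. f \<in> P \<Longrightarrow> 0 < f \<bullet> y" "\<And>f. f \<in> F \<Longrightarrow> f \<bullet> y \<noteq> 0"
    using generic_perturbation[of F P U y\<^sub>0] U P unfolding F_def by blast
  define H where "H = {\<gamma>\<in>\<Phi>. \<gamma> \<bullet> y \<noteq> 0}"
  have "finite H" using finite_roots by (simp add: H_def)
  then have "\<exists>\<epsilon>>0. \<forall>f\<in>H. \<bar>\<epsilon> * height f\<bar> < \<bar>f \<bullet> y\<bar>"
    by (rule small_multiple) (simp add: H_def)
  then obtain \<epsilon> where \<epsilon>: "0 < \<epsilon>" "\<And>f. f \<in> H \<Longrightarrow> \<bar>\<epsilon> * height f\<bar> < \<bar>f \<bullet> y\<bar>"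
    by blast
  define y' where "y' = y - \<epsilon> *\<^sub>R height_vector"
  obtain w where w: "w \<in> W" "\<And>\<alpha>. \<alpha> \<in> \<Delta> \<Longrightarrow> 0 \<le> w y' \<bullet> \<alpha>"
    using dominant_conjugate[of y'] by blast
  obtain x where x: "x \<in> W" "\<And>u. x (w u) = u" "\<And>u. w (x u) = u" using W_inverse[OF w(1)] by metis
  have inv: "inv_into UNIV x = w" using x by (intro inv_equality) auto
  have adj: "w u \<bullet> t = u \<bullet> x t" for u t
    using W_orthogonal[OF w(1)] x(3)[of t] by (metis orthogonal_transformation_def)
  have y': "y' \<bullet> x t = w y \<bullet> t - \<epsilon> * height (x t)" for t
    by (simp add: y'_def adj inner_diff_left inner_commute[of height_vector])
  have xroot: "x \<gamma> \<in> \<Phi>" if "\<gamma> \<in> \<Phi>" for \<gamma> using W_root[OF x(1) that] .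
  have dom: "0 \<le> w y \<bullet> \<alpha>" if \<alpha>: "\<alpha> \<in> \<Delta>" for \<alpha>
  proof (rule ccontr)
    assume neg: "\<not> 0 \<le> w y \<bullet> \<alpha>"
    have eq: "x \<alpha> \<bullet> y = w y \<bullet> \<alpha>" by (simp add: adj inner_commute[of "x \<alpha>"])
    then have "x \<alpha> \<in> H" using xroot[OF base_roots[OF \<alpha>]] neg by (auto simp: H_def)
    then have "\<bar>\<epsilon> * height (x \<alpha>)\<bar> < \<bar>w y \<bullet> \<alpha>\<bar>" using \<epsilon>(2) eq by fastforce
    moreover have "0 \<le> w y \<bullet> \<alpha> - \<epsilon> * height (x \<alpha>)" using w(2)[OF \<alpha>] adj[of y' \<alpha>] y' by simp
    ultimately show False using neg by linarith
  qed
  show thesis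
  proof (rule that[of w x "w y"])
    show "x (w y) \<in> U" using y(1) x(2) by simp
    show "0 < w f \<bullet> w y" if "f \<in> P" for f
      using y(2)[OF that] W_orthogonal[OF w(1)] by (simp add: orthogonal_transformation_def)
    show "x \<gamma> \<bullet> z = 0" if "\<gamma> \<in> \<Phi>" "\<gamma> \<bullet> w y = 0" "z \<in> U" for \<gamma> z
    proof (rule ccontr)
      assume "x \<gamma> \<bullet> z \<noteq> 0"
      then have "x \<gamma> \<in> F" using that xroot by (auto simp: F_def)
      then have "x \<gamma> \<bullet> y \<noteq> 0" by (rule y(3))
      then show False using that(2) adj[of y \<gamma>] by (simp add: inner_commute)
    qed
    show "height (x \<gamma>) < 0" if \<gamma>: "\<gamma> \<in> \<Phi>" "0 < height \<gamma>" "\<gamma> \<bullet> w y = 0" for \<gamma>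
    proof -
      have "0 \<le> w y' \<bullet> \<gamma>" by (rule dominant_nonneg[OF w(2) \<gamma>(1,2)])
      then have "\<epsilon> * height (x \<gamma>) \<le> 0" using \<gamma>(3) y'[of \<gamma>] adj[of y' \<gamma>] inner_commute[of \<gamma>] by simp
      then have "height (x \<gamma>) \<le> 0" using \<epsilon>(1) by (simp add: mult_le_0_iff)
      then show ?thesis using height_nonzero[OF xroot[OF \<gamma>(1)]] by linarith
    qed
  qed (use w(1) x inv dom in auto)
qed

theorem proposition5p1:
  fixes \<Phi> \<Delta> :: "'a::euclidean_space set"
    and J :: "('a \<Rightarrow> 'a) set"
  assumes "root_system \<Phi>" and "crystallographic \<Phi>" and "reduced_roots \<Phi>"
    and "irreducible_roots \<Phi>"
    and "simple_system \<Phi> \<Delta>"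
    and "J \<subseteq> affine_simple_reflections \<Phi> \<Delta>"
    and "finite (generated_group J)"
  shows "\<exists>x\<in>left_coset_reps \<Phi> \<Delta> J. \<exists>I\<subseteq>simple_reflections \<Delta>.
     (let S = simple_reflections \<Delta>;
          w0 = longest_element \<Phi> \<Delta> S;
          wJ = longest_element \<Phi> \<Delta> J;
          wI = longest_element \<Phi> \<Delta> I
      in w0 = (inv_into UNIV x \<circ> linear_part wJ \<circ> x) \<circ> wI \<and>
         reflection_length S w0 = reflection_length J wJ + reflection_length S wI \<and>
         quantum_bruhat_distance \<Phi> \<Delta> x (x \<circ> wI) = reflection_length S wI)"
proof -
  interpret based_root_system \<Phi> \<Delta> using assms(1-5) by unfold_locales
  define A where "A = {a \<in> affine_base. affine_reflection a \<in> J}"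
  have A: "A \<subseteq> affine_base" and J: "J = affine_reflection ` A"
    using assms(6) by (auto simp: A_def affine_simple_reflections_def)
  obtain \<beta>s p where \<beta>s: "orthogonal_list \<beta>s" "set \<beta>s \<subseteq> \<Phi>"
    and wJ: "linear_part (longest_element \<Phi> \<Delta> J) = composite (map reflection \<beta>s)"
      "reflection_length J (longest_element \<Phi> \<Delta> J) = length \<beta>s"
    and p: "\<And>a. a \<in> A \<Longrightarrow> 0 < fst a \<bullet> p" "\<And>a. a \<in> A \<Longrightarrow> fst a \<bullet> composite (map reflection \<beta>s) p < 0"
    using spherical_longest_element[OF A] assms(7) unfolding J by metis
  define g where "g = composite (map reflection \<beta>s)"
  have g_orth: "orthogonal_transformation g"
    unfolding g_def by (rule orthogonal_transformation_reflections[OF \<beta>s(1)])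
  then have g_lin: "linear g" by (rule orthogonal_transformation_linear)
  have gg: "g (g v) = v" for v unfolding g_def by (rule orthogonal_reflections_involution[OF \<beta>s(1)])
  have gW: "g \<in> W" unfolding g_def by (rule composite_reflections_in_W[OF \<beta>s(2)])

  define U where "U = {v. g v = - v}"
  have U: "subspace U"
    by (auto simp: U_def subspace_def linear_add[OF g_lin] linear_cmul[OF g_lin] linear_0[OF g_lin])
  have diffU: "v - g v \<in> U" for v by (simp add: U_def linear_diff[OF g_lin] gg)
  have "finite \<Delta>" by (rule finite_base)
  then have fin: "finite (fst ` A)"
    using finite_subset[OF A] by (simp add: affine_simple_roots_def)
  have pos: "0 < f \<bullet> (p - g p)" if "f \<in> fst ` A" for f
    using that p by (force simp: inner_diff_right g_def)
  obtain w x v where wx: "w \<in> W" "x \<in> W" "\<And>u. w (x u) = u" "\<And>u. x (w u) = u" "inv_into UNIV x = w"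
    and v: "x v \<in> U" "\<And>f. f \<in> fst ` A \<Longrightarrow> 0 < w f \<bullet> v"
      "\<And>\<gamma> z. \<gamma> \<in> \<Phi> \<Longrightarrow> \<gamma> \<bullet> v = 0 \<Longrightarrow> z \<in> U \<Longrightarrow> x \<gamma> \<bullet> z = 0"
      "\<And>\<alpha>. \<alpha> \<in> \<Delta> \<Longrightarrow> 0 \<le> v \<bullet> \<alpha>"
      "\<And>\<gamma>. \<gamma> \<in> \<Phi> \<Longrightarrow> 0 < height \<gamma> \<Longrightarrow> \<gamma> \<bullet> v = 0 \<Longrightarrow> height (x \<gamma>) < 0"
    by (rule generic_dominant_conjugate[OF U diffU[of p] fin pos], assumption) (rule that; assumption)
  have w_orth: "orthogonal_transformation w" using W_orthogonal[OF wx(1)] .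
  have w_lin: "linear w" using w_orth by (rule orthogonal_transformation_linear)

  define u where "u = w \<circ> g \<circ> x"
  have uW: "u \<in> W" unfolding u_def using W_comp wx gW by blast
  have uu: "u (u t) = t" for t by (simp add: u_def wx gg)
  have u_inner: "u s \<bullet> u t = s \<bullet> t" for s t
    using W_orthogonal[OF uW] by (simp add: orthogonal_transformation_def)
  have u_lin: "linear u" using W_orthogonal[OF uW] by (rule orthogonal_transformation_linear)
  have uv: "u v = - v" using v(1) wx(3)[of v] by (simp add: u_def U_def linear_neg[OF w_lin])
  have u_fix: "u \<gamma> = \<gamma>" if "\<gamma> \<in> \<Phi>" "\<gamma> \<bullet> v = 0" for \<gamma>
  proof -
    \<comment> \<open>The displacement \<open>d\<close> lies in the (-1)-eigenspace and is orthogonal to \<open>x \<gamma>\<close>, hence to itself.\<close>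
    define d where "d = x \<gamma> - g (x \<gamma>)"
    have 0: "x \<gamma> \<bullet> d = 0" unfolding d_def by (rule v(3)[OF that diffU])
    have "g (x \<gamma>) \<bullet> d = g (g (x \<gamma>)) \<bullet> g d"
      using g_orth by (simp add: orthogonal_transformation_def)
    also have "g d = - d" using diffU by (simp add: U_def d_def)
    finally have "d \<bullet> d = 0" using 0 by (subst (1) d_def) (simp add: gg inner_diff_left)
    then have "g (x \<gamma>) = x \<gamma>" by (simp add: d_def)
    then show ?thesis by (simp add: u_def wx)
  qed

  obtain \<gamma>s where \<gamma>s: "cascade height_vector \<Phi> \<gamma>s"
    using cascade_exists[OF finite_roots closed_roots] height_nonzero by blast
  define w0 where "w0 = composite (map reflection \<gamma>s)"
  have w0W: "w0 \<in> W"
    unfolding w0_def by (rule composite_reflections_in_W[OF cascade_subset[OF \<gamma>s]])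
  have w0w0: "w0 (w0 t) = t" for t
    unfolding w0_def by (rule orthogonal_reflections_involution[OF cascade_orthogonal[OF \<gamma>s]])
  have w0_swap: "w0 s \<bullet> t = s \<bullet> w0 t" for s t
    unfolding w0_def by (rule orthogonal_reflections_swap[OF cascade_orthogonal[OF \<gamma>s]])
  have w0_lin: "linear w0" using W_orthogonal[OF w0W] by (rule orthogonal_transformation_linear)
  have w0_neg: "\<gamma> \<bullet> w0 height_vector < 0" if "\<gamma> \<in> \<Phi>" "0 < height \<gamma>" for \<gamma>
    unfolding w0_def by (rule cascade_negates[OF closed_roots height_nonzero \<gamma>s that])
  have long0: "longest_element \<Phi> \<Delta> (reflection ` \<Delta>) = w0"
    by (rule finite_longest_elementI) (use w0W w0_neg in \<open>auto simp: base_roots height_base\<close>)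

  have w0v: "w0 v = - v"
  proof -
    have "0 \<le> (w0 \<circ> u) v \<bullet> \<alpha>" if \<alpha>: "\<alpha> \<in> \<Delta>" for \<alpha>
    proof -
      have "height (w0 \<alpha>) < 0" using w0_neg[of \<alpha>] \<alpha> by (simp add: w0_swap base_roots height_base)
      then have "v \<bullet> w0 \<alpha> \<le> 0"
        using W_root[OF w0W base_roots[OF \<alpha>]] by (intro dominant_nonpos v(4))
      then show ?thesis by (simp add: uv w0_swap linear_neg[OF w0_lin])
    qed
    then have "(w0 \<circ> u) v = v"
      using dominant_stabilizer[OF v(4) W_comp[OF w0W uW]] by blast
    then have "- w0 v = v" by (simp add: uv linear_neg[OF w0_lin])
    then show ?thesis by (metis minus_minus)
  qed

  define I where "I = {\<alpha>\<in>\<Delta>. v \<bullet> \<alpha> = 0}"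
  have stab: "k \<in> generated_group (reflection ` I)" if "k \<in> W" "k v = v" for k
    using dominant_stabilizer[of v k] v(4) that unfolding I_def by simp
  have IR: "\<alpha> \<in> \<Phi>" "\<alpha> \<bullet> v = 0" "0 < height \<alpha>" if "\<alpha> \<in> I" for \<alpha>
    using that by (auto simp: I_def base_roots height_base inner_commute)
  have I_sub: "I \<subseteq> \<Delta>" by (auto simp: I_def)

  define \<Psi> where "\<Psi> = {\<gamma>\<in>\<Phi>. \<gamma> \<bullet> v = 0}"
  have \<Psi>: "finite \<Psi>" "reflection_closed \<Psi>" "\<And>\<gamma>. \<gamma> \<in> \<Psi> \<Longrightarrow> height \<gamma> \<noteq> 0"
    using finite_roots reflection_closed_orthogonal[OF closed_roots] height_nonzero
    by (auto simp: \<Psi>_def)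
  obtain \<delta>s where \<delta>s: "cascade height_vector \<Psi> \<delta>s" using cascade_exists[OF \<Psi>] by blast
  have \<delta>s_sub: "\<delta> \<in> \<Phi>" "\<delta> \<bullet> v = 0" if "\<delta> \<in> set \<delta>s" for \<delta>
    using cascade_subset[OF \<delta>s] that by (auto simp: \<Psi>_def)
  define k where "k = composite (map reflection \<delta>s)"
  have "k \<in> W" unfolding k_def by (rule composite_reflections_in_W) (use \<delta>s_sub in blast)
  moreover have "k v = v"
    unfolding k_def by (rule orthogonal_reflections_fix[OF cascade_orthogonal[OF \<delta>s]]) (rule \<delta>s_sub)
  ultimately have longI: "longest_element \<Phi> \<Delta> (reflection ` I) = k"
    using IR unfolding k_def
    by (intro finite_longest_elementI[OF I_sub stab] cascade_negates[OF \<Psi>(2,3) \<delta>s])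
      (auto simp: \<Psi>_def)

  \<comment> \<open>Both sides fix \<open>v\<close> and negate the simple roots orthogonal to \<open>v\<close>, on which \<open>u\<close> is trivial.\<close>
  have "u \<circ> w0 = k"
  proof -
    have "u \<circ> w0 \<in> generated_group (reflection ` I)"
      by (rule stab) (use W_comp uW w0W in blast, simp add: w0v uv linear_neg[OF u_lin])
    moreover have "\<alpha> \<bullet> (u \<circ> w0) height_vector < 0" if "\<alpha> \<in> I" for \<alpha>
      using u_inner[of \<alpha> "w0 height_vector"] u_fix IR[OF that] w0_neg by simp
    ultimately have "longest_element \<Phi> \<Delta> (reflection ` I) = u \<circ> w0"
      by (intro finite_longest_elementI[OF I_sub])
    then show ?thesis using longI by simp
  qed
  then have w0_eq: "w0 = (inv_into UNIV x \<circ> g \<circ> x) \<circ> k"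
    using uu by (simp add: fun_eq_iff wx(5) u_def[unfolded comp_def] flip: \<open>u \<circ> w0 = k\<close>)

  have wb: "u (w \<beta>) = - w \<beta>" if "\<beta> \<in> set \<beta>s" for \<beta>
    using orthogonal_reflections_negate[OF \<beta>s(1) that]
    by (simp add: u_def wx g_def linear_neg[OF w_lin])
  have cross: "w \<beta> \<bullet> \<delta> = 0" if "\<beta> \<in> set \<beta>s" "\<delta> \<in> set \<delta>s" for \<beta> \<delta>
    using u_inner[of "w \<beta>" \<delta>] wb[OF that(1)] u_fix[OF \<delta>s_sub[OF that(2)]] by simp
  have orth_all: "orthogonal_list (map w \<beta>s @ \<delta>s)"
    using orthogonal_list_append_image[OF w_orth \<beta>s(1) cascade_orthogonal[OF \<delta>s]] cross by blast
  have "composite (map reflection (map w \<beta>s @ \<delta>s)) t = w0 t" for t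
    using composite_reflections_conj[OF w_orth, of \<beta>s "x (k t)"]
    by (simp add: w0_eq wx g_def flip: k_def)
  then have prod_all: "composite (map reflection (map w \<beta>s @ \<delta>s)) = w0" by (rule ext)
  have len0: "reflection_length (reflection ` \<Delta>) w0 = length \<beta>s + length \<delta>s"
    using finite_reflection_length[OF orth_all] \<beta>s(2) \<delta>s_sub(1) W_root[OF wx(1)]
    unfolding prod_all by auto
  have lenI: "reflection_length (reflection ` \<Delta>) k = length \<delta>s"
    unfolding k_def using \<delta>s_sub(1) by (intro finite_reflection_length cascade_orthogonal[OF \<delta>s]) blast

  have par: "parabolic_like \<Psi>"
    unfolding parabolic_like_def
  proof (intro conjI ballI impI)
    fix \<gamma> \<beta> assume \<gamma>: "\<gamma> \<in> \<Phi> - \<Psi>" "0 < height \<gamma>" and \<beta>: "\<beta> \<in> \<Psi>"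
    have "0 \<le> v \<bullet> \<gamma>" using dominant_nonneg[OF v(4)] \<gamma> by blast
    then have "0 < v \<bullet> \<gamma>" using \<gamma>(1) by (auto simp: \<Psi>_def inner_commute less_le)
    moreover have "v \<bullet> reflection \<beta> \<gamma> = v \<bullet> \<gamma>"
      using \<beta> by (simp add: \<Psi>_def reflection_orthogonal flip: reflection_inner_swap)
    moreover have root: "reflection \<beta> \<gamma> \<in> \<Phi>" using \<beta> \<gamma> reflection_root by (auto simp: \<Psi>_def)
    ultimately show "0 < height (reflection \<beta> \<gamma>)"
      using dominant_nonpos[OF v(4) root] height_nonzero[OF root] by linarith
  qed (use \<Psi> in \<open>auto simp: \<Psi>_def\<close>)
  have dist: "quantum_bruhat_distance \<Phi> \<Delta> x (x \<circ> k) = length \<delta>s"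
    unfolding k_def
    by (rule quantum_bruhat_distance_cascade[OF \<delta>s par wx(2)]) (use v(5) in \<open>auto simp: \<Psi>_def\<close>)

  have rep: "x \<in> left_coset_reps \<Phi> \<Delta> J"
    unfolding left_coset_reps_def weyl_group_eq
  proof (intro CollectI conjI ballI impI)
    fix a assume a: "a \<in> affine_base" "affine_reflection a \<in> J"
    have root: "w (fst a) \<in> \<Phi>" using W_root[OF wx(1)] affine_base_root[OF a(1)] by blast
    have "0 < v \<bullet> w (fst a)" using v(2)[of "fst a"] a by (auto simp: A_def inner_commute)
    then have "0 < height (w (fst a))"
      using dominant_nonpos[OF v(4) root] height_nonzero[OF root] by linarith
    then show "inv_into UNIV x (fst a) \<in> positive_roots \<Phi> \<Delta>"
      using root by (simp add: wx(5) positive_iff_height)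
  qed (rule wx(2))

  show ?thesis
    unfolding Let_def simple_reflections_def
  proof (intro bexI[of _ x] exI[of _ "reflection ` I"] conjI)
    show "reflection ` I \<subseteq> reflection ` \<Delta>" using I_sub by (rule image_mono)
    show "longest_element \<Phi> \<Delta> (reflection ` \<Delta>) =
        (inv_into UNIV x \<circ> linear_part (longest_element \<Phi> \<Delta> J) \<circ> x) \<circ> longest_element \<Phi> \<Delta> (reflection ` I)"
      unfolding long0 longI wJ(1) using w0_eq unfolding g_def .
    show "reflection_length (reflection ` \<Delta>) (longest_element \<Phi> \<Delta> (reflection ` \<Delta>)) =
        reflection_length J (longest_element \<Phi> \<Delta> J) +
        reflection_length (reflection ` \<Delta>) (longest_element \<Phi> \<Delta> (reflection ` I))"
      unfolding long0 longI len0 lenI wJ(2) ..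
    show "quantum_bruhat_distance \<Phi> \<Delta> x (x \<circ> longest_element \<Phi> \<Delta> (reflection ` I)) =
        reflection_length (reflection ` \<Delta>) (longest_element \<Phi> \<Delta> (reflection ` I))"
      unfolding longI lenI by (rule dist)
  qed (rule rep)
qed

end
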